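(* There are absolute constants $C'>1$, $a\ge0$, $c>0$ and $\epsilon_0>0$ such that for all positive integers $n,k$ with $k<n/C'$ and all $0<\epsilon<\epsilon_0$, the class $\mathcal{P}^{\pm}_{n,k}$ of degree-$k$ polynomial threshold functions on $\{\pm1\}^n$ satisfies the following: each of the two quantities $m^{\mathrm{test}}_\epsilon(\mathcal{P}^{\pm}_{n,k})$ and $q^{\mathrm{test}}_{0,\epsilon}(\mathcal{P}^{\pm}_{n,k})$ is at least $$c\cdot\frac{\binom{\lfloor n-\log\binom{n}{k}-a\rfloor}{\le k}^2}{\binom{n}{\le k}\log\binom{n}{\le k}},$$ and consequently is at least $$c\cdot\frac{\left(\frac{n}{4ek}\right)^k}{k\log(n/k)}.$$
   Context: $\log$ is base $2$ and $\binom{N}{\le k}=\sum_{i=0}^k\binom{N}{i}$. $\mathcal{P}^{\pm}_{n,k}$ is the set of functions $\{\pm1\}^n\to\{\pm1\}$ of the form $x\mapsto\mathrm{sign}(p(x))$ where $p$ is a real polynomial in $n$ variables of degree at most $k$, and $\mathrm{sign}(z)=1$ for $z\ge0$ and $-1$ otherwise. For a class $\mathcal{H}$ of two-valued functions on $\mathcal{X}$ and a probability distribution $\mathcal{D}$ on $\mathcal{X}$, $\mathrm{dist}_{\mathcal{D}}(f,g)=\Pr_{x\sim\mathcal{D}}[f(x)\ne g(x)]$ and $\mathrm{dist}_{\mathcal{D}}(f,\mathcal{H})=\inf_{h\in\mathcal{H}}\mathrm{dist}_{\mathcal{D}}(f,h)$. All testers are computationally unbounded randomized algorithms that must work for every unknown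 distribution $\mathcal{D}$ on $\mathcal{X}$ and every unknown two-valued function $f$ on $\mathcal{X}$. (i) $m^{\mathrm{test}}_\epsilon(\mathcal{H})$ is the minimum $m$ such that some algorithm receiving $m$ labelled examples $(x,f(x))$, $x\sim\mathcal{D}$ independently, accepts with probability $\ge 2/3$ if $f\in\mathcal{H}$ and rejects with probability $\ge2/3$ if $\mathrm{dist}_{\mathcal{D}}(f,\mathcal{H})\ge\epsilon$. (ii) $q^{\mathrm{test}}_{0,\epsilon}(\mathcal{H})$ is the minimum $q$ such that some algorithm making in total at most $q$ adaptive queries to $f$ at arbitrary points of $\mathcal{X}$ and independent labelled samples $(x,f(x))$, $x\sim\mathcal{D}$, accepts with probability $\ge2/3$ if $\mathrm{dist}_{\mathcal{D}}(f,\mathcal{H})=0$ and rejects with probability $\ge2/3$ if $\mathrm{dist}_{\mathcal{D}}(f,\mathcal{H})\ge\epsilon$. *)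

theory Defs
  imports "HOL-Probability.Probability" "HOL-Library.Poly_Mapping"
begin

section \<open>Polynomial threshold functions on the Boolean cube\<close>

definition cube :: "nat \<Rightarrow> (nat \<Rightarrow> real) set" where
  "cube n = {..<n} \<rightarrow>\<^sub>E {-1, 1}"

text \<open>A real polynomial is a finitely supported map from monomials to coefficients, and a monomial
  is a finitely supported map from variable indices to exponents.\<close>

type_synonym real_mpoly = "(nat \<Rightarrow>\<^sub>0 nat) \<Rightarrow>\<^sub>0 real"

definition polys :: "nat \<Rightarrow> nat \<Rightarrow> real_mpoly set" where
  "polys n k = {p. \<forall>m\<in>Poly_Mapping.keys p. Poly_Mapping.keys m \<subseteq> {..<n} \<and>
      (\<Sum>i\<in>Poly_Mapping.keys m. Poly_Mapping.lookup m i) \<le> k}"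

definition poly_eval :: "real_mpoly \<Rightarrow> (nat \<Rightarrow> real) \<Rightarrow> real" where
  "poly_eval p x = (\<Sum>m\<in>Poly_Mapping.keys p. Poly_Mapping.lookup p m *
      (\<Prod>i\<in>Poly_Mapping.keys m. x i ^ Poly_Mapping.lookup m i))"

text \<open>Unlike the library's \<^const>\<open>sgn\<close>, this function takes the value 1 at 0.\<close>

definition sign :: "real \<Rightarrow> real" where
  "sign z = (if z \<ge> 0 then 1 else -1)"

definition PTF :: "nat \<Rightarrow> nat \<Rightarrow> ((nat \<Rightarrow> real) \<Rightarrow> real) set" where
  "PTF n k = (\<lambda>p. \<lambda>x\<in>cube n. sign (poly_eval p x)) ` polys n k"

text \<open>A negative integer upper index is truncated to 0 by \<^const>\<open>nat\<close> where this is used with a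
  rounded real number; the ratio of \<open>n\<close> to \<open>k\<close> can be required large enough for this not to occur.\<close>

definition binom_le :: "nat \<Rightarrow> nat \<Rightarrow> nat" where
  "binom_le N k = (\<Sum>i\<le>k. N choose i)"

section \<open>Distribution-free testing\<close>

text \<open>Functions on a domain \<open>X\<close> with values in \<open>{-1, 1}\<close> are extensional, i.e. \<^const>\<open>undefined\<close>
  outside \<open>X\<close>. A distribution on \<open>X\<close> is a \<open>pmf\<close> supported in \<open>X\<close>; this is fully general
  for finite (indeed countable) \<open>X\<close>.\<close>

definition two_valued :: "'a set \<Rightarrow> ('a \<Rightarrow> real) set" where
  "two_valued X = X \<rightarrow>\<^sub>E {-1, 1}"

definition dist_fun :: "'a pmf \<Rightarrow> ('a \<Rightarrow> real) \<Rightarrow> ('a \<Rightarrow> real) \<Rightarrow> real" where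
  "dist_fun D f g = measure_pmf.prob D {x. f x \<noteq> g x}"

definition dist_class :: "'a pmf \<Rightarrow> ('a \<Rightarrow> real) \<Rightarrow> ('a \<Rightarrow> real) set \<Rightarrow> real" where
  "dist_class D f H = (INF h\<in>H. dist_fun D f h)"

subsection \<open>Testers that only receive labelled samples\<close>

definition sample_run ::
  "(('a \<times> real) list \<Rightarrow> bool pmf) \<Rightarrow> nat \<Rightarrow> 'a pmf \<Rightarrow> ('a \<Rightarrow> real) \<Rightarrow> bool pmf" where
  "sample_run T m D f =
     bind_pmf (replicate_pmf m D) (\<lambda>xs. T (map (\<lambda>x. (x, f x)) xs))"

definition is_sample_tester ::
  "'a set \<Rightarrow> ('a \<Rightarrow> real) set \<Rightarrow> real \<Rightarrow> nat \<Rightarrow> (('a \<times> real) list \<Rightarrow> bool pmf) \<Rightarrow> bool" where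
  "is_sample_tester X H \<epsilon> m T \<longleftrightarrow>
     (\<forall>D f. set_pmf D \<subseteq> X \<longrightarrow> f \<in> two_valued X \<longrightarrow>
        (f \<in> H \<longrightarrow> pmf (sample_run T m D f) True \<ge> 2/3) \<and>
        (dist_class D f H \<ge> \<epsilon> \<longrightarrow> pmf (sample_run T m D f) False \<ge> 2/3))"

text \<open>The minimum is taken in \<open>enat\<close>, so that it is \<open>\<infinity>\<close> if there is no tester at all.\<close>

definition m_test :: "'a set \<Rightarrow> ('a \<Rightarrow> real) set \<Rightarrow> real \<Rightarrow> enat" where
  "m_test X H \<epsilon> = Inf {enat m |m. \<exists>T. is_sample_tester X H \<epsilon> m T}"

subsection \<open>Testers with adaptive queries and labelled samples\<close>

text \<open>A deterministic adaptive algorithm is a decision tree in which every inner node either queries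
  the unknown function at a point or draws a fresh labelled sample, and continues depending on
  the answer; a leaf accepts (\<open>True\<close>) or rejects (\<open>False\<close>). A randomized algorithm is a
  probability distribution on such trees. On a finite domain a bounded number of accesses leaves
  only finitely many trees up to unreachable branches, so discrete distributions lose no
  generality.\<close>

datatype 'a dtree =
    Output bool
  | Query 'a "real \<Rightarrow> 'a dtree"
  | Sample "'a \<Rightarrow> real \<Rightarrow> 'a dtree"

text \<open>\<open>accesses_le t X q\<close>: along every branch reachable by possible answers, \<open>t\<close> makes at most \<open>q\<close>
  accesses, queries and samples counted together, and only queries points of \<open>X\<close>.\<close>

primrec accesses_le :: "'a dtree \<Rightarrow> 'a set \<Rightarrow> nat \<Rightarrow> bool" where
  "accesses_le (Output b) X q \<longleftrightarrow> True"
| "accesses_le (Query x t) X q \<longleftrightarrow> x \<in> X \<and> q > 0 \<and> (\<forall>y\<in>{-1, 1}. accesses_le (t y) X (q - 1))"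
| "accesses_le (Sample t) X q \<longleftrightarrow> q > 0 \<and> (\<forall>x\<in>X. \<forall>y\<in>{-1, 1}. accesses_le (t x y) X (q - 1))"

primrec dtree_run :: "'a dtree \<Rightarrow> 'a pmf \<Rightarrow> ('a \<Rightarrow> real) \<Rightarrow> bool pmf" where
  "dtree_run (Output b) D f = return_pmf b"
| "dtree_run (Query x t) D f = dtree_run (t (f x)) D f"
| "dtree_run (Sample t) D f = bind_pmf D (\<lambda>x. dtree_run (t x (f x)) D f)"

definition query_run :: "'a dtree pmf \<Rightarrow> 'a pmf \<Rightarrow> ('a \<Rightarrow> real) \<Rightarrow> bool pmf" where
  "query_run T D f = bind_pmf T (\<lambda>t. dtree_run t D f)"

definition is_query_tester ::
  "'a set \<Rightarrow> ('a \<Rightarrow> real) set \<Rightarrow> real \<Rightarrow> nat \<Rightarrow> 'a dtree pmf \<Rightarrow> bool" where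
  "is_query_tester X H \<epsilon> q T \<longleftrightarrow>
     (\<forall>t\<in>set_pmf T. accesses_le t X q) \<and>
     (\<forall>D f. set_pmf D \<subseteq> X \<longrightarrow> f \<in> two_valued X \<longrightarrow>
        (dist_class D f H = 0 \<longrightarrow> pmf (query_run T D f) True \<ge> 2/3) \<and>
        (dist_class D f H \<ge> \<epsilon> \<longrightarrow> pmf (query_run T D f) False \<ge> 2/3))"

definition q_test :: "'a set \<Rightarrow> ('a \<Rightarrow> real) set \<Rightarrow> real \<Rightarrow> enat" where
  "q_test X H \<epsilon> = Inf {enat q |q. \<exists>T. is_query_tester X H \<epsilon> q T}"

end

theory Submission
  imports Defs "HOL-Real_Asymp.Real_Asymp"
begin

text \<open>Write \<open>V = binom_le n k\<close>. Put \<open>N = 40 V\<close> generic points of the cube in play and draw a random distribution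
  on them, giving each point an independent random weight and the remaining mass to an extra point. The
  weights follow one of two laws with equal moments up to order \<open>L \<approx> log V\<close>: under \<open>\<alpha>\<close> a weight is almost always
  0, so that the support has at most \<open>d\<close> points; under \<open>\<beta>\<close> it is almost always 1. The acceptance probability
  of an algorithm with \<open>m\<close> samples is a polynomial in each single weight whose coefficients beyond degree
  \<open>L\<close> are negligible when \<open>m\<close> is a small multiple of \<open>d / log V\<close>, so exchanging \<open>\<alpha>\<close> for \<open>\<beta>\<close> one point at a time
  is not noticed.

  Under \<open>\<alpha>\<close> the support is shattered, because \<open>d\<close> random points of the cube are independent for polynomials
  of degree \<open>k\<close>: a set that is determined by fewer than \<open>binom_le r k\<close> evaluations has less than \<open>2 ^ r\<close> points.
  Hence every function is consistent with the class. Under \<open>\<beta>\<close> a random function is far from the class by a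
  VC counting argument. The function is chosen independently of the distribution, so queries do not
  help.\<close>

section \<open>Multilinear polynomials on the cube\<close>

text \<open>Independence is not asked of every \<open>d\<close> of the points, only of the random
  support with high probability, so no union bound over all supports is paid. For one support of at
  most \<open>d\<close> points, uniformly random points fail with probability at most
  \<open>d * 2 ^ r / 2 ^ n\<close>, apart from collisions. Since \<open>d\<close> is at most twice
  \<open>n choose k\<close>, this is small once \<open>r\<close> lies a constant below
  \<open>n - log 2 (n choose k)\<close>, which explains the upper index in the statement.

  Only one logarithm is lost, for the following reason. Under \<alpha> a weight is nonzero with
  probability of order \<open>d / N\<close>, so the mean that \<beta> places near 1 has to come from
  weights of order \<open>B = N / d\<close>. Matching \<open>L\<close> moments stretches the largest
  weight to order \<open>B * L^2\<close>, and the part of the acceptance polynomial beyond degree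
  \<open>L\<close> is negligible while \<open>m * B * L^2 / N\<close> is a small multiple of
  \<open>L\<close>, that is, while \<open>m\<close> is a small multiple of \<open>d / L\<close>.

  Leaving the spare mass to an extra point, instead of dividing by the random total weight, is what
  keeps the acceptance probability a polynomial in each weight.\<close>

lemma underdetermined_system:
  fixes a :: "'i \<Rightarrow> 'j \<Rightarrow> real"
  assumes "finite I" "finite J" "card I < card J"
  shows "\<exists>c. (\<exists>j\<in>J. c j \<noteq> 0) \<and> (\<forall>i\<in>I. (\<Sum>j\<in>J. a i j * c j) = 0)"
  using assms
proof (induction I arbitrary: J a rule: finite_induct)
  case empty
  then have "J \<noteq> {}" by auto
  then show ?case by (intro exI[of _ "\<lambda>_. 1"]) auto
next
  case (insert i I)
  show ?case
  proof (cases "\<forall>j\<in>J. a i j = 0")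
    case True
    have "card I < card J" using insert by simp
    from insert.IH[OF insert.prems(1) this, of a] True show ?thesis by auto
  next
    case False
    then obtain j0 where j0: "j0 \<in> J" "a i j0 \<noteq> 0" by auto
    define J' where "J' = J - {j0}"
    have J: "J = insert j0 J'" "j0 \<notin> J'" "finite J'"
      using j0 insert.prems by (auto simp: J'_def)
    have "card I < card J'"
      using insert.prems insert.hyps J by simp
    from insert.IH[OF J(3) this, of "\<lambda>i' j. a i' j - a i' j0 * a i j / a i j0"]
    obtain c j1 where c: "j1 \<in> J'" "c j1 \<noteq> 0"
      "\<And>i'. i' \<in> I \<Longrightarrow> (\<Sum>j\<in>J'. (a i' j - a i' j0 * a i j / a i j0) * c j) = 0" by blast
    define s where "s = (\<Sum>j\<in>J'. a i j * c j)"
    \<comment> \<open>Equation \<open>i\<close> solved for the eliminated unknown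
      \<open>j0\<close>.\<close>
    define c' where "c' = c(j0 := - s / a i j0)"
    have sum: "(\<Sum>j\<in>J. a i' j * c' j) = - a i' j0 * s / a i j0 + (\<Sum>j\<in>J'. a i' j * c j)" for i'
    proof -
      have "(\<Sum>j\<in>J'. a i' j * c' j) = (\<Sum>j\<in>J'. a i' j * c j)"
        using J by (intro sum.cong) (auto simp: c'_def)
      then show ?thesis using J by (simp add: c'_def)
    qed
    have "(\<Sum>j\<in>J. a i' j * c' j) = 0" if "i' \<in> I" for i'
    proof -
      have "0 = (\<Sum>j\<in>J'. a i' j * c j - (a i' j0 / a i j0) * (a i j * c j))"
        using c(3)[OF that] by (simp add: algebra_simps)
      also have "\<dots> = (\<Sum>j\<in>J'. a i' j * c j) - (a i' j0 / a i j0) * s"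
        by (simp add: sum_subtractf sum_distrib_left s_def)
      finally show ?thesis using sum[of i'] by simp
    qed
    moreover have "(\<Sum>j\<in>J. a i j * c' j) = 0"
      using sum[of i] j0 by (simp add: s_def)
    moreover have "c' j1 \<noteq> 0" "j1 \<in> J"
      using c J by (auto simp: c'_def)
    ultimately show ?thesis by (intro exI[of _ c']) auto
  qed
qed

definition chi :: "nat set \<Rightarrow> (nat \<Rightarrow> real) \<Rightarrow> real" where
  "chi T x = (\<Prod>i\<in>T. x i)"

definition small_sets :: "nat \<Rightarrow> nat \<Rightarrow> nat set set" where
  "small_sets n k = {T. T \<subseteq> {..<n} \<and> card T \<le> k}"

definition multilin :: "nat \<Rightarrow> nat \<Rightarrow> (nat set \<Rightarrow> real) \<Rightarrow> (nat \<Rightarrow> real) \<Rightarrow> real" where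
  "multilin n k c x = (\<Sum>T\<in>small_sets n k. c T * chi T x)"

lemma finite_small_sets [simp]: "finite (small_sets n k)"
  by (rule finite_subset[of _ "Pow {..<n}"]) (auto simp: small_sets_def)

lemma card_subsets_le:
  assumes "finite A"
  shows "card {T. T \<subseteq> A \<and> card T \<le> k} = binom_le (card A) k"
proof -
  have "{T. T \<subseteq> A \<and> card T \<le> k} = (\<Union>i\<le>k. {T. T \<subseteq> A \<and> card T = i})" by auto
  also have "card \<dots> = (\<Sum>i\<le>k. card {T. T \<subseteq> A \<and> card T = i})"
    using assms by (intro card_UN_disjoint) (auto intro: finite_subset[of _ "Pow A"])
  also have "\<dots> = binom_le (card A) k"
    using assms by (simp add: binom_le_def n_subsets)
  finally show ?thesis .
qed

lemma card_small_sets: "card (small_sets n k) = binom_le n k"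
  using card_subsets_le[of "{..<n}" k] by (simp add: small_sets_def)

lemma finite_cube [simp]: "finite (cube n)"
  by (auto simp: cube_def intro: finite_PiE)

lemma card_cube: "card (cube n) = 2 ^ n"
  by (simp add: cube_def card_PiE numeral_2_eq_2)

lemma cube_cases: "x \<in> cube n \<Longrightarrow> i < n \<Longrightarrow> x i = -1 \<or> x i = 1"
  by (auto simp: cube_def PiE_iff)

text \<open>Squares of coordinates are 1 on the cube, so a monomial only remembers its variables of
  odd exponent. Each of these contributes at least 1 to the degree, so at most \<open>k\<close> of
  them occur.\<close>

lemma poly_eval_eq_multilin:
  assumes "p \<in> polys n k"
  shows "\<exists>c. \<forall>x\<in>cube n. poly_eval p x = multilin n k c x"
proof -
  define odds :: "(nat \<Rightarrow>\<^sub>0 nat) \<Rightarrow> nat set"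
    where "odds m = {i \<in> Poly_Mapping.keys m. odd (Poly_Mapping.lookup m i)}" for m
  define c where "c T = (\<Sum>m\<in>{m\<in>Poly_Mapping.keys p. odds m = T}. Poly_Mapping.lookup p m)" for T
  have odds: "odds m \<in> small_sets n k" if "m \<in> Poly_Mapping.keys p" for m
  proof -
    have m: "Poly_Mapping.keys m \<subseteq> {..<n}" "(\<Sum>i\<in>Poly_Mapping.keys m. Poly_Mapping.lookup m i) \<le> k"
      using assms that by (auto simp: polys_def)
    have "card (odds m) = (\<Sum>i\<in>odds m. 1)" by simp
    also have "\<dots> \<le> (\<Sum>i\<in>odds m. Poly_Mapping.lookup m i)"
      by (intro sum_mono) (auto simp: odds_def Suc_le_eq in_keys_iff)
    also have "\<dots> \<le> (\<Sum>i\<in>Poly_Mapping.keys m. Poly_Mapping.lookup m i)"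
      by (intro sum_mono2) (auto simp: odds_def)
    finally show ?thesis using m by (auto simp: small_sets_def odds_def)
  qed
  have mono: "(\<Prod>i\<in>Poly_Mapping.keys m. x i ^ Poly_Mapping.lookup m i) = chi (odds m) x"
    if "m \<in> Poly_Mapping.keys p" "x \<in> cube n" for m x
  proof -
    have m: "Poly_Mapping.keys m \<subseteq> {..<n}" using assms that by (auto simp: polys_def)
    have "(\<Prod>i\<in>Poly_Mapping.keys m. x i ^ Poly_Mapping.lookup m i) =
        (\<Prod>i\<in>Poly_Mapping.keys m. if i \<in> odds m then x i else 1)"
    proof (rule prod.cong)
      fix i assume i: "i \<in> Poly_Mapping.keys m"
      then have "x i = -1 \<or> x i = 1" using m that(2) cube_cases by blast
      then show "x i ^ Poly_Mapping.lookup m i = (if i \<in> odds m then x i else 1)"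
        using i by (cases "odd (Poly_Mapping.lookup m i)") (auto simp: odds_def)
    qed simp
    also have "\<dots> = chi (odds m) x"
      by (simp add: prod.If_cases chi_def) (rule prod.cong, auto simp: odds_def)
    finally show ?thesis .
  qed
  have "poly_eval p x = multilin n k c x" if x: "x \<in> cube n" for x
  proof -
    have "poly_eval p x = (\<Sum>m\<in>Poly_Mapping.keys p. Poly_Mapping.lookup p m * chi (odds m) x)"
      unfolding poly_eval_def using mono x by (intro sum.cong) auto
    also have "\<dots> = (\<Sum>T\<in>small_sets n k. \<Sum>m\<in>{m\<in>Poly_Mapping.keys p. odds m = T}.
        Poly_Mapping.lookup p m * chi (odds m) x)"
      using odds by (intro sum.group[symmetric]) auto
    also have "\<dots> = multilin n k c x"
      unfolding multilin_def c_def by (intro sum.cong) (auto simp: sum_distrib_right)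
    finally show ?thesis .
  qed
  then show ?thesis by blast
qed

lemma multilin_eq_poly_eval:
  "\<exists>p\<in>polys n k. \<forall>x. poly_eval p x = multilin n k c x"
proof -
  define mono :: "nat set \<Rightarrow> (nat \<Rightarrow>\<^sub>0 nat)"
    where "mono T = Abs_poly_mapping (\<lambda>i. if i \<in> T then 1 else 0)" for T
  have lookup: "Poly_Mapping.lookup (mono T) = (\<lambda>i. if i \<in> T then 1 else 0)" if "finite T" for T
    using that by (simp add: mono_def)
  have keys: "Poly_Mapping.keys (mono T) = T" if "finite T" for T
    using that by (auto simp: in_keys_iff lookup split: if_splits)
  have fin: "finite T" if "T \<in> small_sets n k" for T
    using that by (auto simp: small_sets_def intro: finite_subset)
  have inj: "inj_on mono (small_sets n k)"
    by (rule inj_onI) (metis keys fin)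
  \<comment> \<open>\<open>Poly_Mapping.keys\<close> is a left inverse of \<open>mono\<close>, so it
    recovers the set whose coefficient belongs to a monomial.\<close>
  define p :: real_mpoly where "p = Abs_poly_mapping
    (\<lambda>m. if m \<in> mono ` small_sets n k then c (Poly_Mapping.keys m) else 0)"
  have lp: "Poly_Mapping.lookup p m =
      (if m \<in> mono ` small_sets n k then c (Poly_Mapping.keys m) else 0)" for m
  proof -
    have "finite {m. (if m \<in> mono ` small_sets n k then c (Poly_Mapping.keys m) else 0) \<noteq> 0}"
      by (rule finite_subset[of _ "mono ` small_sets n k"]) (auto split: if_splits)
    then show ?thesis by (simp add: p_def)
  qed
  have kp: "Poly_Mapping.keys p \<subseteq> mono ` small_sets n k"
    by (auto simp: in_keys_iff lp split: if_splits)
  have "p \<in> polys n k"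
    unfolding polys_def
  proof (safe, goal_cases)
    case (1 m i)
    then obtain T where "T \<in> small_sets n k" "m = mono T" using kp by auto
    then have "i \<in> T" using 1(2) keys[OF fin] by metis
    then show ?case using \<open>T \<in> small_sets n k\<close> unfolding small_sets_def by blast
  next
    case (2 m)
    then obtain T where T: "T \<in> small_sets n k" "m = mono T" using kp by auto
    then show ?case using fin[OF T(1)] by (simp add: keys lookup small_sets_def)
  qed
  moreover have "poly_eval p x = multilin n k c x" for x
  proof -
    have "poly_eval p x = (\<Sum>m\<in>mono ` small_sets n k. Poly_Mapping.lookup p m *
      (\<Prod>i\<in>Poly_Mapping.keys m. x i ^ Poly_Mapping.lookup m i))"
      unfolding poly_eval_def using kp by (intro sum.mono_neutral_left) (auto simp: in_keys_iff)
    also have "\<dots> = (\<Sum>T\<in>small_sets n k. Poly_Mapping.lookup p (mono T) *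
      (\<Prod>i\<in>Poly_Mapping.keys (mono T). x i ^ Poly_Mapping.lookup (mono T) i))"
      using inj by (simp add: sum.reindex)
    also have "\<dots> = multilin n k c x"
      unfolding multilin_def chi_def
      by (intro sum.cong) (auto simp: lp keys fin lookup intro!: prod.cong)
    finally show ?thesis .
  qed
  ultimately show ?thesis by blast
qed

lemma PTF_eq: "PTF n k = range (\<lambda>c. \<lambda>x\<in>cube n. sign (multilin n k c x))"
proof (safe, goal_cases)
  case (1 h)
  then obtain p where p: "p \<in> polys n k" "h = (\<lambda>x\<in>cube n. sign (poly_eval p x))"
    by (auto simp: PTF_def)
  obtain c where "\<forall>x\<in>cube n. poly_eval p x = multilin n k c x" using poly_eval_eq_multilin[OF p(1)] by blast
  then have "h = (\<lambda>x\<in>cube n. sign (multilin n k c x))" using p by (auto simp: restrict_def)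
  then show ?case by blast
next
  case (2 h c)
  obtain p where p: "p \<in> polys n k" "\<forall>x. poly_eval p x = multilin n k c x" using multilin_eq_poly_eval by blast
  then show ?case unfolding PTF_def by (intro image_eqI[of _ _ p]) auto
qed

text \<open>The number of \<open>i < s\<close> with fewer than \<open>j\<close> ones in binary, by recursion on the last bit.\<close>

fun weight_count :: "nat \<Rightarrow> nat \<Rightarrow> nat" where
  "weight_count j s = (if j = 0 \<or> s = 0 then 0 else if s = 1 then 1
     else weight_count j ((s + 1) div 2) + weight_count (j - 1) (s div 2))"

declare weight_count.simps [simp del]

lemma weight_count_0 [simp]: "weight_count 0 s = 0" "weight_count j 0 = 0"
  by (simp_all add: weight_count.simps)

lemma weight_count_1 [simp]: "weight_count (Suc j) (Suc 0) = 1"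
  by (simp add: weight_count.simps)

lemma weight_count_double: "weight_count j (2 * s) = weight_count j s + weight_count (j - 1) s"
proof (cases "j = 0 \<or> s = 0")
  case False
  then show ?thesis by (subst weight_count.simps) auto
qed auto

lemma weight_count_Suc_double:
  "weight_count j (Suc (2 * s)) = weight_count j (Suc s) + weight_count (j - 1) s"
proof (cases "j = 0 \<or> s = 0")
  case False
  then show ?thesis by (subst weight_count.simps) auto
qed auto

text \<open>The two increments from \<open>b\<close> to \<open>Suc b\<close> are the indicators that
  \<open>b\<close> has fewer than \<open>j - 1\<close>, respectively fewer than \<open>j\<close>,
  ones in binary, and the first condition implies the second. The induction rederives this from the
  last-bit recursion.\<close>

lemma weight_count_increment:
  "weight_count j b + weight_count (j - 1) (Suc b) \<le> weight_count j (Suc b) + weight_count (j - 1) b"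
proof (induction b arbitrary: j rule: less_induct)
  case (less b)
  show ?case
  proof (cases "b = 0")
    case True
    then show ?thesis by (cases j; cases "j - 1") auto
  next
    case False
    show ?thesis
    proof (cases "even b")
      case True
      then obtain c where c: "b = 2 * c" by blast
      have "c < b" using c False by simp
      then show ?thesis using less.IH[of c j]
        by (simp add: c weight_count_double weight_count_Suc_double)
    next
      case odd: False
      then obtain c where c: "b = Suc (2 * c)" by (auto elim!: oddE)
      have "Suc b = 2 * Suc c" using c by simp
      moreover have "c < b" using c by simp
      ultimately show ?thesis using less.IH[of c "j - 1"]
        unfolding c by (simp only: weight_count_double weight_count_Suc_double) simp
    qed
  qed
qed

text \<open>This is the inequality that lets a set be cut into the union and the intersection of two
  opposite faces. Halving both numbers reduces it to itself, with the parities deciding how the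
  halves are paired.\<close>

lemma weight_count_add:
  "b \<le> a \<Longrightarrow> weight_count j (a + b) \<le> weight_count j a + weight_count (j - 1) b"
proof (induction "a + b" arbitrary: a b j rule: less_induct)
  case less
  show ?case
  proof (cases "a = b \<or> b = 0")
    case True
    then show ?thesis using weight_count_double[of j a] by (auto simp: mult_2)
  next
    case False
    then have ab: "b < a" "0 < b" using less.prems by auto
    define a' b' where "a' = a div 2" and "b' = b div 2"
    consider "a = 2 * a'" "b = 2 * b'" | "a = Suc (2 * a')" "b = 2 * b'"
      | "a = 2 * a'" "b = Suc (2 * b')" | "a = Suc (2 * a')" "b = Suc (2 * b')"
      unfolding a'_def b'_def by (metis dvd_mult_div_cancel odd_two_times_div_two_succ Suc_eq_plus1)
    then show ?thesis
    proof cases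
      case 1
      then have s: "a + b = 2 * (a' + b')" by simp
      show ?thesis
        using less.hyps[of a' b' j] less.hyps[of a' b' "j - 1"] ab
        unfolding s unfolding 1 weight_count_double by simp
    next
      case 2
      then have s: "a + b = Suc (2 * (a' + b'))" by simp
      show ?thesis
        using less.hyps[of "Suc a'" b' j] less.hyps[of a' b' "j - 1"] ab 2
        unfolding s unfolding 2 weight_count_double weight_count_Suc_double by simp
    next
      case 3
      then have s: "a + b = Suc (2 * (a' + b'))" by simp
      show ?thesis
        using less.hyps[of a' "Suc b'" j] less.hyps[of a' b' "j - 1"] ab 3
        unfolding s unfolding 3 weight_count_double weight_count_Suc_double by simp
    next
      \<comment> \<open>Two odd numbers have an even sum, so one half must be rounded up on either
        side in turn; the resulting mismatch is exactly
        \<open>weight_count_increment\<close>.\<close>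
      case 4
      then have s: "a + b = 2 * Suc (a' + b')" by simp
      show ?thesis
        using less.hyps[of "Suc a'" b' j] less.hyps[of a' "Suc b'" "j - 1"] ab 4
          weight_count_increment[of "j - 1" b']
        unfolding s unfolding 4 weight_count_double weight_count_Suc_double by simp
    qed
  qed
qed

text \<open>The numbers below \<open>2 ^ r\<close> are the strings of \<open>r\<close> bits, and the
  last-bit recursion becomes Pascal's rule.\<close>

lemma weight_count_power2: "weight_count (Suc k) (2 ^ r) = binom_le r k"
proof (induction r arbitrary: k)
  case 0
  have "binom_le 0 k = 1" by (induction k) (auto simp: binom_le_def)
  then show ?case by simp
next
  case (Suc r)
  show ?case
  proof (cases k)
    case 0
    then show ?thesis using Suc[of 0] by (simp add: weight_count_double binom_le_def)
  next
    case (Suc k')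
    have "binom_le (Suc r) (Suc k') = binom_le r (Suc k') + binom_le r k'"
      unfolding binom_le_def
      by (subst (1 2) sum.atMost_Suc_shift) (simp add: sum.distrib)
    then show ?thesis using Suc.IH[of "Suc k'"] Suc.IH[of k']
      by (simp add: weight_count_double Suc)
  qed
qed

text \<open>Splitting along the last coordinate into the faces \<open>P (-1)\<close> and \<open>P 1\<close>, one combines independent
  characters on \<open>P (-1) \<union> P 1\<close> with the products of the last variable and independent characters on
  \<open>P (-1) \<inter> P 1\<close>.\<close>

lemma independent_characters:
  assumes "A \<subseteq> cube n"
  shows "\<exists>\<T>. \<T> \<subseteq> {T. T \<subseteq> {..<n} \<and> card T < j} \<and> weight_count j (card A) \<le> card \<T> \<and>
    (\<forall>c. (\<forall>x\<in>A. (\<Sum>T\<in>\<T>. c T * chi T x) = 0) \<longrightarrow> (\<forall>T\<in>\<T>. c T = 0))"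
  using assms
proof (induction n arbitrary: A j)
  case 0
  show ?case
  proof (cases "A = {} \<or> j = 0")
    case True
    then show ?thesis by (intro exI[of _ "{}"]) auto
  next
    case False
    then have A: "A = {\<lambda>_. undefined}" using 0 by (auto simp: cube_def)
    obtain j' where "j = Suc j'" using False by (cases j) auto
    then show ?thesis by (intro exI[of _ "{{}}"]) (auto simp: A chi_def)
  qed
next
  case (Suc n)
  show ?case
  proof (cases "j = 0")
    case True
    then show ?thesis by (intro exI[of _ "{}"]) auto
  next
    case False
    define P where "P v = {x\<in>cube n. x(n := v) \<in> A}" for v :: real
    have P: "P v \<subseteq> cube n" "finite (P v)" for v by (auto simp: P_def)
    have A_eq: "A = (\<lambda>x. x(n := -1)) ` P (-1) \<union> (\<lambda>x. x(n := 1)) ` P 1"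
    proof (intro equalityI subsetI)
      fix x assume x: "x \<in> A"
      have "x n = -1 \<or> x n = 1" using Suc.prems x cube_cases by blast
      moreover have "x(n := undefined) \<in> cube n"
      proof -
        have "x \<in> cube (Suc n)" using Suc.prems x by blast
        then show ?thesis unfolding cube_def by (intro PiE_I) (auto simp: PiE_iff extensional_def)
      qed
      moreover have "(x(n := undefined))(n := x n) = x" by simp
      ultimately show "x \<in> (\<lambda>x. x(n := -1)) ` P (-1) \<union> (\<lambda>x. x(n := 1)) ` P 1"
        using x unfolding P_def by (smt (verit) UnCI image_eqI mem_Collect_eq)
    qed (auto simp: P_def)
    have inj: "inj_on (\<lambda>x. x(n := v)) (P v)" for v
    proof (rule inj_onI)
      fix x y assume "x \<in> P v" "y \<in> P v" and eq: "x(n := v) = y(n := v)"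
      then have "x n = undefined" "y n = undefined" by (auto simp: P_def cube_def PiE_iff extensional_def)
      then show "x = y" using eq by (metis fun_upd_triv fun_upd_upd)
    qed
    have "card A = card ((\<lambda>x. x(n := -1)) ` P (-1)) + card ((\<lambda>x. x(n := 1)) ` P 1)"
    proof -
      have "x(n := -1) \<noteq> y(n := 1)" for x y :: "nat \<Rightarrow> real"
        by (metis fun_upd_same one_neq_neg_one)
      then show ?thesis unfolding A_eq using P by (intro card_Un_disjoint) auto
    qed
    also have "\<dots> = card (P (-1) \<union> P 1) + card (P (-1) \<inter> P 1)"
      unfolding card_image[OF inj] by (rule card_Un_Int[OF P(2) P(2)])
    finally have card_A: "card A = card (P (-1) \<union> P 1) + card (P (-1) \<inter> P 1)" .
    obtain \<T>1 where T1: "\<T>1 \<subseteq> {T. T \<subseteq> {..<n} \<and> card T < j}"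
      "weight_count j (card (P (-1) \<union> P 1)) \<le> card \<T>1"
      "\<And>c. (\<forall>x\<in>P (-1) \<union> P 1. (\<Sum>T\<in>\<T>1. c T * chi T x) = 0) \<Longrightarrow> (\<forall>T\<in>\<T>1. c T = 0)"
      using Suc.IH[of "P (-1) \<union> P 1" j] P by auto
    \<comment> \<open>The intersection only gets the bound \<open>j - 1\<close>, because its
      characters are later multiplied by the last variable.\<close>
    have sub: "P (-1) \<inter> P 1 \<subseteq> cube n" using P by blast
    obtain \<T>2 where T2: "\<T>2 \<subseteq> {T. T \<subseteq> {..<n} \<and> card T < j - 1}"
      "weight_count (j - 1) (card (P (-1) \<inter> P 1)) \<le> card \<T>2"
      "\<And>c. (\<forall>x\<in>P (-1) \<inter> P 1. (\<Sum>T\<in>\<T>2. c T * chi T x) = 0) \<Longrightarrow> (\<forall>T\<in>\<T>2. c T = 0)"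
      using Suc.IH[OF sub, of "j - 1"] by auto
    have fin: "finite \<T>1" "finite \<T>2"
      using T1(1) T2(1) by (auto intro: finite_subset[of _ "Pow {..<n}"])
    have fin': "finite T" if "T \<in> \<T>1 \<union> \<T>2" for T
      using T1(1) T2(1) that by (auto intro: finite_subset[of _ "{..<n}"])
    have notin: "n \<notin> T" if "T \<in> \<T>1 \<union> \<T>2" for T using T1(1) T2(1) that by auto
    have inj2: "inj_on (insert n) \<T>2"
      by (rule inj_onI) (metis Diff_insert_absorb UnI2 notin)
    have disj: "\<T>1 \<inter> insert n ` \<T>2 = {}" using notin by auto
    define \<T> where "\<T> = \<T>1 \<union> insert n ` \<T>2"
    have "T \<subseteq> {..<Suc n} \<and> card T < j" if "T \<in> \<T>" for T
    proof (cases "T \<in> \<T>1")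
      case True
      then have "T \<subseteq> {..<n}" "card T < j" using T1(1) by blast+
      then show ?thesis by (auto simp: less_Suc_eq)
    next
      case False
      then obtain T' where T': "T' \<in> \<T>2" "T = insert n T'" using \<open>T \<in> \<T>\<close> unfolding \<T>_def by blast
      then have "card T = Suc (card T')" using notin fin' by simp
      moreover have "T' \<subseteq> {..<n}" "card T' < j - 1" using T' T2(1) by blast+
      ultimately show ?thesis using T' by (auto simp: less_Suc_eq)
    qed
    moreover have "weight_count j (card A) \<le> card \<T>"
    proof -
      have "weight_count j (card A) \<le> weight_count j (card (P (-1) \<union> P 1))
          + weight_count (j - 1) (card (P (-1) \<inter> P 1))"
        unfolding card_A using P by (intro weight_count_add card_mono) auto
      also have "\<dots> \<le> card \<T>1 + card (insert n ` \<T>2)"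
        using T1(2) T2(2) by (simp add: card_image[OF inj2])
      also have "\<dots> = card \<T>" unfolding \<T>_def using fin disj by (simp add: card_Un_disjoint)
      finally show ?thesis .
    qed
    moreover have "\<forall>T\<in>\<T>. c T = 0" if c: "\<forall>x\<in>A. (\<Sum>T\<in>\<T>. c T * chi T x) = 0" for c
    proof -
      define p where "p x = (\<Sum>T\<in>\<T>1. c T * chi T x)" for x
      define q where "q x = (\<Sum>T\<in>\<T>2. c (insert n T) * chi T x)" for x
      have chi_upd: "chi T (x(n := v)) = chi T x" if "T \<in> \<T>1 \<union> \<T>2" for T x and v :: real
        unfolding chi_def using notin[OF that] by (intro prod.cong) auto
      have "p x + v * q x = 0" if "x \<in> P v" for x v
      proof -
        have "0 = (\<Sum>T\<in>\<T>. c T * chi T (x(n := v)))" using c that by (simp add: P_def)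
        also have "\<dots> = (\<Sum>T\<in>\<T>1. c T * chi T (x(n := v)))
            + (\<Sum>T\<in>insert n ` \<T>2. c T * chi T (x(n := v)))"
          unfolding \<T>_def using fin disj by (intro sum.union_disjoint) auto
        also have "(\<Sum>T\<in>\<T>1. c T * chi T (x(n := v))) = p x"
          unfolding p_def using chi_upd by (intro sum.cong) auto
        also have "(\<Sum>T\<in>insert n ` \<T>2. c T * chi T (x(n := v))) =
            (\<Sum>T\<in>\<T>2. c (insert n T) * chi (insert n T) (x(n := v)))"
          by (simp add: sum.reindex[OF inj2])
        also have "\<dots> = v * q x"
          unfolding q_def sum_distrib_left
        proof (rule sum.cong[OF refl])
          fix T assume T: "T \<in> \<T>2"
          have "chi (insert n T) (x(n := v)) = v * chi T (x(n := v))"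
            unfolding chi_def using T notin fin' by (subst prod.insert) auto
          then show "c (insert n T) * chi (insert n T) (x(n := v)) = v * (c (insert n T) * chi T x)"
            using chi_upd T by simp
        qed
        finally show ?thesis by simp
      qed
      note pq = this
      \<comment> \<open>On the face \<open>v\<close> the combination equals
        \<open>p + v * q\<close>. Over the intersection it vanishes for both signs, so
        \<open>q\<close> vanishes there and all its coefficients are 0; then \<open>p\<close>
        vanishes on the whole union.\<close>
      have "q x = 0" if "x \<in> P (-1) \<inter> P 1" for x
        using pq[of x "-1"] pq[of x 1] that by simp
      then have c2: "\<forall>T\<in>\<T>2. c (insert n T) = 0"
        using T2(3)[of "\<lambda>T. c (insert n T)"] unfolding q_def by blast
      then have "q x = 0" for x unfolding q_def by (intro sum.neutral) auto
      then have "p x = 0" if "x \<in> P (-1) \<union> P 1" for x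
        using pq[of x "-1"] pq[of x 1] that by auto
      then have "\<forall>T\<in>\<T>1. c T = 0" using T1(3) unfolding p_def by blast
      then show ?thesis using c2 by (auto simp: \<T>_def)
    qed
    ultimately show ?thesis by blast
  qed
qed

section \<open>Closure under evaluations of degree \<open>k\<close>, and interpolation\<close>

text \<open>The flat spanned by \<open>Y\<close> in the matroid of point evaluations on
  degree-\<open>k\<close> polynomials. Points that avoid the closures of their predecessors have
  linearly independent evaluations.\<close>

definition deg_closure :: "nat \<Rightarrow> nat \<Rightarrow> (nat \<Rightarrow> real) set \<Rightarrow> (nat \<Rightarrow> real) set" where
  "deg_closure n k Y = {x\<in>cube n. \<forall>c. (\<forall>y\<in>Y. multilin n k c y = 0) \<longrightarrow> multilin n k c x = 0}"

text \<open>On \<open>2 ^ r\<close> points at least \<open>binom_le r k\<close> characters are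
  independent. This exceeds the number of conditions imposed by \<open>Y\<close>, so some nonzero
  combination of them vanishes on \<open>Y\<close>, hence on the closure, against
  independence.\<close>

lemma card_deg_closure_less:
  assumes "finite Y" "card Y < binom_le r k"
  shows "card (deg_closure n k Y) < 2 ^ r"
proof (rule ccontr)
  assume "\<not> card (deg_closure n k Y) < 2 ^ r"
  then obtain A where A: "A \<subseteq> deg_closure n k Y" "card A = 2 ^ r"
    by (metis not_less obtain_subset_with_card_n)
  then have "A \<subseteq> cube n" by (auto simp: deg_closure_def)
  from independent_characters[OF this, of "Suc k"] obtain \<T> where
    T: "\<T> \<subseteq> small_sets n k" "binom_le r k \<le> card \<T>"
      "\<And>c. (\<forall>x\<in>A. (\<Sum>T\<in>\<T>. c T * chi T x) = 0) \<Longrightarrow> (\<forall>T\<in>\<T>. c T = 0)"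
    by (auto simp: A(2) weight_count_power2 less_Suc_eq_le small_sets_def)
  have "finite \<T>" using T(1) finite_small_sets by (rule finite_subset)
  moreover have "card Y < card \<T>" using assms T by simp
  ultimately obtain c where c: "\<exists>T\<in>\<T>. c T \<noteq> 0" "\<forall>y\<in>Y. (\<Sum>T\<in>\<T>. chi T y * c T) = 0"
    using underdetermined_system[OF assms(1), of \<T> "\<lambda>y T. chi T y"] by blast
  define c' where "c' T = (if T \<in> \<T> then c T else 0)" for T
  have multilin: "multilin n k c' x = (\<Sum>T\<in>\<T>. c T * chi T x)" for x
    unfolding multilin_def using T(1) by (intro sum.mono_neutral_cong_right) (auto simp: c'_def)
  have "\<forall>y\<in>Y. multilin n k c' y = 0" using c(2) by (simp add: multilin mult.commute)
  then have "\<forall>x\<in>A. multilin n k c' x = 0" using A(1) by (auto simp: deg_closure_def)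
  then show False using T(3)[of c] c(1) by (auto simp: multilin)
qed

lemma multilin_add: "multilin n k (\<lambda>T. c T + a * b T) x = multilin n k c x + a * multilin n k b x"
  by (simp add: multilin_def sum.distrib sum_distrib_left algebra_simps)

text \<open>Newton interpolation in increasing order of the indices: outside the closure of the
  earlier points there is a polynomial vanishing on all of them but not at the new point, and a
  multiple of it corrects the value there.\<close>

lemma interpolate_generic:
  fixes I :: "nat set"
  assumes "finite I" "\<And>i. i \<in> I \<Longrightarrow> y i \<in> cube n"
    "\<And>i. i \<in> I \<Longrightarrow> y i \<notin> deg_closure n k (y ` {l\<in>I. l < i})"
  shows "\<exists>c. \<forall>i\<in>I. multilin n k c (y i) = f i"
  using assms
proof (induction I rule: finite_linorder_max_induct)
  case (insert b I)
  have gen: "y i \<notin> deg_closure n k (y ` {l\<in>I. l < i})" if "i \<in> I" for i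
  proof -
    have "{l \<in> insert b I. l < i} = {l\<in>I. l < i}" using insert.hyps that by auto
    then show ?thesis using insert.prems(2)[of i] that by (metis insertI2)
  qed
  have "\<exists>c. \<forall>i\<in>I. multilin n k c (y i) = f i"
    using gen insert.prems(1) by (intro insert.IH) blast+
  then obtain c where c: "\<forall>i\<in>I. multilin n k c (y i) = f i" by blast
  have "{l \<in> insert b I. l < b} = I" using insert.hyps by auto
  then have "y b \<notin> deg_closure n k (y ` I)" using insert.prems(2)[of b] by (metis insertI1)
  moreover have "y b \<in> cube n" using insert.prems(1) by blast
  ultimately have "\<exists>e. (\<forall>i\<in>I. multilin n k e (y i) = 0) \<and> multilin n k e (y b) \<noteq> 0"
    unfolding deg_closure_def by blast
  then obtain e where e: "\<forall>i\<in>I. multilin n k e (y i) = 0" "multilin n k e (y b) \<noteq> 0" by blast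
  define a where "a = (f b - multilin n k c (y b)) / multilin n k e (y b)"
  have "multilin n k (\<lambda>T. c T + a * e T) (y i) = f i" if "i \<in> insert b I" for i
  proof (cases "i = b")
    case True
    then show ?thesis using e(2) unfolding multilin_add by (simp add: a_def)
  next
    case False
    then show ?thesis using that c e(1) by (simp add: multilin_add)
  qed
  then show ?case by blast
qed auto

lemma PTF_shatters_generic:
  fixes I :: "nat set"
  assumes "finite I" "\<And>i. i \<in> I \<Longrightarrow> y i \<in> cube n"
    "\<And>i. i \<in> I \<Longrightarrow> y i \<notin> deg_closure n k (y ` {l\<in>I. l < i})" "f \<in> two_valued (cube n)"
  shows "\<exists>h\<in>PTF n k. \<forall>i\<in>I. h (y i) = f (y i)"
proof -
  obtain c where c: "\<forall>i\<in>I. multilin n k c (y i) = f (y i)"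
    using interpolate_generic[of I y n k "\<lambda>i. f (y i)"] assms by blast
  have "f (y i) \<in> {-1, 1}" if "i \<in> I" for i
    using assms(2)[OF that] assms(4) by (auto simp: two_valued_def PiE_iff)
  then have "\<forall>i\<in>I. (\<lambda>x\<in>cube n. sign (multilin n k c x)) (y i) = f (y i)"
    using c assms(2) by (fastforce simp: sign_def)
  then show ?thesis unfolding PTF_eq by blast
qed

section \<open>VC dimension of threshold functions and the number of their traces\<close>

definition shatters :: "'a set set \<Rightarrow> 'a set \<Rightarrow> bool" where
  "shatters F S \<longleftrightarrow> (\<forall>Z\<subseteq>S. \<exists>X\<in>F. X \<inter> S = Z)"

text \<open>The family is split by membership of \<open>q\<close>. Sets shattered by one half are
  shattered by \<open>F\<close>; those shattered by both halves count a second time with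
  \<open>q\<close> inserted.\<close>

lemma pajor:
  assumes "finite Q" "F \<subseteq> Pow Q"
  shows "card F \<le> card {S. S \<subseteq> Q \<and> shatters F S}"
  using assms
proof (induction Q arbitrary: F rule: finite_induct)
  case empty
  show ?case
  proof (cases "F = {}")
    case False
    then have "F = {{}}" using empty by auto
    then have "{S. S \<subseteq> {} \<and> shatters F S} = {{}}" by (auto simp: shatters_def)
    then show ?thesis using \<open>F = {{}}\<close> by simp
  qed simp
next
  case (insert q Q)
  define F0 where "F0 = {X\<in>F. q \<notin> X}"
  define F1 where "F1 = (\<lambda>X. X - {q}) ` {X\<in>F. q \<in> X}"
  have finF: "finite F" using insert by (meson finite_Pow_iff finite_insert finite_subset)
  have F01: "F0 \<subseteq> Pow Q" "F1 \<subseteq> Pow Q" using insert.prems by (auto simp: F0_def F1_def)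
  have inj: "inj_on (\<lambda>X. X - {q}) {X\<in>F. q \<in> X}" by (rule inj_onI) blast
  have "F = F0 \<union> {X\<in>F. q \<in> X}" by (auto simp: F0_def)
  then have "card F = card F0 + card {X\<in>F. q \<in> X}"
    using finF by (subst \<open>F = _\<close>, intro card_Un_disjoint) (auto simp: F0_def)
  then have cF: "card F = card F0 + card F1" using card_image[OF inj] by (simp add: F1_def)
  define A where "A = {S. S \<subseteq> Q \<and> shatters F0 S}"
  define B where "B = {S. S \<subseteq> Q \<and> shatters F1 S}"
  have fin: "finite A" "finite B"
    using insert.hyps by (auto simp: A_def B_def intro: finite_subset[of _ "Pow Q"])
  have inj2: "inj_on (insert q) (A \<inter> B)"
  proof (rule inj_onI)
    fix S S' assume "S \<in> A \<inter> B" "S' \<in> A \<inter> B" "insert q S = insert q S'"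
    moreover from this have "q \<notin> S" "q \<notin> S'" using insert.hyps by (auto simp: A_def)
    ultimately show "S = S'" by (metis Diff_insert_absorb)
  qed
  have "A \<union> B \<union> insert q ` (A \<inter> B) \<subseteq> {S. S \<subseteq> insert q Q \<and> shatters F S}"
  proof (intro Un_least; rule subsetI; rule CollectI; rule conjI)
    fix S assume "S \<in> A"
    then show "S \<subseteq> insert q Q" by (auto simp: A_def)
    from \<open>S \<in> A\<close> show "shatters F S" unfolding A_def shatters_def F0_def by blast
  next
    fix S assume S: "S \<in> B"
    then show "S \<subseteq> insert q Q" by (auto simp: B_def)
    show "shatters F S"
      unfolding shatters_def
    proof (intro allI impI)
      fix Z assume "Z \<subseteq> S"
      then obtain X where "X \<in> F1" "X \<inter> S = Z" using S unfolding B_def shatters_def by blast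
      then obtain X' where "X' \<in> F" "(X' - {q}) \<inter> S = Z" unfolding F1_def by blast
      moreover have "q \<notin> S" using S insert.hyps by (auto simp: B_def)
      ultimately show "\<exists>X\<in>F. X \<inter> S = Z" by blast
    qed
  next
    fix S assume "S \<in> insert q ` (A \<inter> B)"
    then obtain S' where S': "S = insert q S'" "S' \<in> A" "S' \<in> B" by auto
    then show "S \<subseteq> insert q Q" by (auto simp: B_def)
    have q: "q \<notin> S'" using S' insert.hyps by (auto simp: B_def)
    show "shatters F S"
      unfolding shatters_def
    proof (intro allI impI)
      fix Z assume Z: "Z \<subseteq> S"
      show "\<exists>X\<in>F. X \<inter> S = Z"
      proof (cases "q \<in> Z")
        case True
        have "Z - {q} \<subseteq> S'" using Z S' by auto
        then obtain X where "X \<in> F1" "X \<inter> S' = Z - {q}" using S' unfolding B_def shatters_def by blast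
        then obtain X' where "X' \<in> F" "q \<in> X'" "(X' - {q}) \<inter> S' = Z - {q}" unfolding F1_def by blast
        then have "X' \<inter> S = Z" using S' q True by blast
        then show ?thesis using \<open>X' \<in> F\<close> by blast
      next
        case False
        then have "Z \<subseteq> S'" using Z S' by auto
        then obtain X where "X \<in> F0" "X \<inter> S' = Z" using S' unfolding A_def shatters_def by blast
        then show ?thesis unfolding F0_def S' by blast
      qed
    qed
  qed
  then have "card (A \<union> B \<union> insert q ` (A \<inter> B)) \<le> card {S. S \<subseteq> insert q Q \<and> shatters F S}"
    using insert.hyps by (intro card_mono) (auto intro: finite_subset[of _ "Pow (insert q Q)"])
  moreover have "card (A \<union> B \<union> insert q ` (A \<inter> B)) = card (A \<union> B) + card (insert q ` (A \<inter> B))"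
    using fin insert.hyps by (intro card_Un_disjoint) (auto simp: A_def B_def)
  moreover have "card (insert q ` (A \<inter> B)) = card (A \<inter> B)" by (rule card_image[OF inj2])
  moreover have "card A + card B = card (A \<union> B) + card (A \<inter> B)" using fin by (rule card_Un_Int)
  moreover have "card F0 \<le> card A" "card F1 \<le> card B"
    unfolding A_def B_def using F01 insert.IH by auto
  ultimately show ?case using cF by linarith
qed

definition ptf_trace :: "nat \<Rightarrow> nat \<Rightarrow> (nat \<Rightarrow> real) set \<Rightarrow> (nat \<Rightarrow> real) set set" where
  "ptf_trace n k Q = (\<lambda>h. {x\<in>Q. h x = 1}) ` PTF n k"

text \<open>More than \<open>binom_le n k\<close> points carry a nonzero signed weight orthogonal to
  all characters of degree at most \<open>k\<close>. A threshold function realising the opposite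
  sign pattern would make this zero sum negative.\<close>

lemma ptf_trace_shatters:
  assumes "Q \<subseteq> cube n" "S \<subseteq> Q" "shatters (ptf_trace n k Q) S"
  shows "card S \<le> binom_le n k"
proof (rule ccontr)
  assume "\<not> ?thesis"
  then have "card (small_sets n k) < card S" by (simp add: card_small_sets)
  moreover have finS: "finite S" using assms finite_cube by (meson finite_subset)
  ultimately obtain b x0 where b: "x0 \<in> S" "b x0 \<noteq> 0"
    "\<And>T. T \<in> small_sets n k \<Longrightarrow> (\<Sum>x\<in>S. chi T x * b x) = 0"
    using underdetermined_system[OF finite_small_sets finS, of n k chi] by blast
  \<comment> \<open>\<open>sign\<close> is 1 at 0, so a prescribed value 1 only yields a nonnegative
    polynomial. Strictness has to come from a point with \<open>g > 0\<close>, which this choice of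
    sign provides.\<close>
  define s where "s = (if b x0 > 0 then 1 else -1 :: real)"
  define g where "g x = s * b x" for x
  have g: "g x0 > 0" using b by (auto simp: g_def s_def)
  have "{x\<in>S. g x \<le> 0} \<subseteq> S" by auto
  then obtain X where "X \<in> ptf_trace n k Q" "X \<inter> S = {x\<in>S. g x \<le> 0}"
    using assms(3) unfolding shatters_def by blast
  then obtain c where X: "{x\<in>Q. (\<lambda>x\<in>cube n. sign (multilin n k c x)) x = 1} \<inter> S = {x\<in>S. g x \<le> 0}"
    unfolding ptf_trace_def PTF_eq by auto
  then have c: "sign (multilin n k c x) = 1 \<longleftrightarrow> g x \<le> 0" if "x \<in> S" for x
    
  proof -
    have "x \<in> Q" "x \<in> cube n" using assms(1,2) that by blast+
    moreover have "x \<in> {x\<in>Q. (\<lambda>x\<in>cube n. sign (multilin n k c x)) x = 1} \<inter> S \<longleftrightarrow> x \<in> {x\<in>S. g x \<le> 0}"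
      using X by (rule arg_cong)
    ultimately show ?thesis using that by simp
  qed
  have orth: "(\<Sum>x\<in>S. g x * multilin n k c x) = 0"
  proof -
    have "(\<Sum>x\<in>S. g x * multilin n k c x) = (\<Sum>x\<in>S. \<Sum>T\<in>small_sets n k. s * c T * (chi T x * b x))"
      unfolding multilin_def g_def sum_distrib_left by (simp add: mult_ac)
    also have "\<dots> = (\<Sum>T\<in>small_sets n k. s * c T * (\<Sum>x\<in>S. chi T x * b x))"
      by (subst sum.swap) (simp add: sum_distrib_left)
    also have "\<dots> = 0" using b(3) by simp
    finally show ?thesis .
  qed
  have neg: "g x * multilin n k c x \<le> 0" if "x \<in> S" for x
    using c[OF that] by (auto simp: sign_def mult_le_0_iff split: if_splits)
  have "g x0 * multilin n k c x0 < 0" using c[OF b(1)] g by (auto simp: sign_def mult_less_0_iff split: if_splits)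
  then have "(\<Sum>x\<in>S. g x * multilin n k c x) < (\<Sum>x\<in>S. 0)"
    using neg b(1) finS by (intro sum_strict_mono_ex1) auto
  then show False using orth by simp
qed

lemma card_ptf_trace:
  assumes "Q \<subseteq> cube n"
  shows "card (ptf_trace n k Q) \<le> binom_le (card Q) (binom_le n k)"
proof -
  have finQ: "finite Q" using assms finite_cube by (rule finite_subset)
  have "card (ptf_trace n k Q) \<le> card {S. S \<subseteq> Q \<and> shatters (ptf_trace n k Q) S}"
    using finQ by (intro pajor) (auto simp: ptf_trace_def)
  also have "\<dots> \<le> card {S. S \<subseteq> Q \<and> card S \<le> binom_le n k}"
    using ptf_trace_shatters[OF assms] finQ
    by (intro card_mono) (auto intro: finite_subset[of _ "Pow Q"])
  also have "\<dots> = binom_le (card Q) (binom_le n k)" using finQ by (rule card_subsets_le)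
  finally show ?thesis .
qed

section \<open>Random functions and random points\<close>

text \<open>Exchanging the sum over \<open>F\<close> with the expectation. It is applied to the
  placement of the points and to the choice of the function, each of which must suit most draws of
  the weights at once.\<close>

lemma averaging:
  fixes P :: "'u pmf" and \<delta> :: real
  assumes "finite F" "F \<noteq> {}"
    "\<And>u. u \<in> set_pmf P \<Longrightarrow> real (card {f\<in>F. bad f u}) \<le> \<delta> * real (card F)"
  shows "\<exists>f\<in>F. measure_pmf.prob P {u. bad f u} \<le> \<delta>"
proof (rule ccontr)
  assume "\<not> ?thesis"
  then have "\<And>f. f \<in> F \<Longrightarrow> \<delta> < measure_pmf.prob P {u. bad f u}" by (simp add: not_le)
  then have "(\<Sum>f\<in>F. \<delta>) < (\<Sum>f\<in>F. measure_pmf.prob P {u. bad f u})"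
    using assms(1,2) by (intro sum_strict_mono) auto
  also have "\<dots> = (\<Sum>f\<in>F. measure_pmf.expectation P (indicator {u. bad f u}))" by simp
  also have "\<dots> = measure_pmf.expectation P (\<lambda>u. \<Sum>f\<in>F. indicator {u. bad f u} u)"
    by (subst Bochner_Integration.integral_sum)
      (auto intro!: measure_pmf.integrable_const_bound[where B = 1])
  also have "\<dots> \<le> \<delta> * card F"
  proof (intro measure_pmf.integral_le_const AE_pmfI)
    show "integrable P (\<lambda>u. \<Sum>f\<in>F. indicator {u. bad f u} u :: real)"
      by (intro Bochner_Integration.integrable_sum measure_pmf.integrable_const_bound[where B = 1]) auto
    fix u assume "u \<in> set_pmf P"
    moreover have "(\<Sum>f\<in>F. indicator {u. bad f u} u :: real) = card {f\<in>F. bad f u}"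
      using assms(1) by (simp add: indicator_def sum.If_cases Int_def)
    ultimately show "(\<Sum>f\<in>F. indicator {u. bad f u} u :: real) \<le> \<delta> * card F" using assms(3) by simp
  qed
  finally show False by (simp add: mult.commute)
qed

text \<open>The binomial expansion cut at \<open>r\<close>, with each \<open>x ^ i\<close> bounded
  below by \<open>x ^ r\<close>. The choice \<open>x = 1 / 8\<close> serves the counting of
  functions, \<open>x = k / n\<close> the upper bound on \<open>binom_le n k\<close>.\<close>

lemma binom_le_power_le:
  fixes x :: real
  assumes "0 \<le> x" "x \<le> 1"
  shows "binom_le M r * x ^ r \<le> (1 + x) ^ M"
proof -
  have "binom_le M r * x ^ r = (\<Sum>i\<le>r. real (M choose i) * x ^ r)"
    by (simp add: binom_le_def sum_distrib_right)
  also have "\<dots> \<le> (\<Sum>i\<le>r. real (M choose i) * x ^ i)"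
    using assms by (intro sum_mono mult_left_mono power_decreasing) auto
  also have "\<dots> = (\<Sum>i\<in>{..r} \<inter> {..M}. real (M choose i) * x ^ i)"
    by (intro sum.mono_neutral_right) (auto simp: not_le)
  also have "\<dots> \<le> (\<Sum>i\<le>M. real (M choose i) * x ^ i)"
    using assms by (intro sum_mono2) auto
  also have "\<dots> = (1 + x) ^ M"
    using binomial_ring[of x 1 M] by (simp add: add.commute)
  finally show ?thesis .
qed

definition sign_fun :: "nat \<Rightarrow> (nat \<Rightarrow> real) set \<Rightarrow> (nat \<Rightarrow> real) \<Rightarrow> real" where
  "sign_fun n Z = (\<lambda>x\<in>cube n. if x \<in> Z then 1 else -1)"

lemma sign_fun_two_valued: "sign_fun n Z \<in> two_valued (cube n)"
  by (auto simp: sign_fun_def two_valued_def)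

text \<open>Inside \<open>Q\<close>, the set \<open>Z\<close> is the symmetric difference of the
  trace of \<open>h\<close> and the set of disagreements; outside \<open>Q\<close> it is arbitrary.
  Hence the three factors.\<close>

lemma card_close_le:
  assumes "Q \<subseteq> cube n"
  shows "card {Z \<in> Pow (cube n). \<exists>h\<in>PTF n k. card {x\<in>Q. sign_fun n Z x \<noteq> h x} \<le> r} \<le>
    binom_le (card Q) (binom_le n k) * binom_le (card Q) r * 2 ^ (2 ^ n - card Q)"
proof -
  have finQ: "finite Q" using assms finite_cube by (rule finite_subset)
  let ?G = "\<lambda>(X, Y, R). (X - Y) \<union> (Y - X) \<union> R"
  let ?S = "ptf_trace n k Q \<times> {Y. Y \<subseteq> Q \<and> card Y \<le> r} \<times> Pow (cube n - Q)"
  have finT: "finite (ptf_trace n k Q)"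
    by (rule finite_subset[of _ "Pow Q"]) (auto simp: ptf_trace_def finQ)
  have finS: "finite ?S"
    using finT finQ by (auto intro: finite_subset[of _ "Pow Q"])
  have "{Z \<in> Pow (cube n). \<exists>h\<in>PTF n k. card {x\<in>Q. sign_fun n Z x \<noteq> h x} \<le> r} \<subseteq> ?G ` ?S"
  proof
    fix Z assume "Z \<in> {Z \<in> Pow (cube n). \<exists>h\<in>PTF n k. card {x\<in>Q. sign_fun n Z x \<noteq> h x} \<le> r}"
    then obtain h where h: "Z \<subseteq> cube n" "h \<in> PTF n k" "card {x\<in>Q. sign_fun n Z x \<noteq> h x} \<le> r" by auto
    have hx: "h x = -1 \<or> h x = 1" if "x \<in> cube n" for x
      using h(2) that by (auto simp: PTF_def sign_def)
    define X Y where "X = {x\<in>Q. h x = 1}" and "Y = {x\<in>Q. sign_fun n Z x \<noteq> h x}"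
    have "Z = ?G (X, Y, Z - Q)"
    proof (rule set_eqI)
      fix x
      show "x \<in> Z \<longleftrightarrow> x \<in> ?G (X, Y, Z - Q)"
      proof (cases "x \<in> Q")
        case True
        then have "x \<in> cube n" using assms by blast
        then show ?thesis using True hx[of x] by (auto simp: X_def Y_def sign_fun_def)
      qed (auto simp: X_def Y_def)
    qed
    moreover have "(X, Y, Z - Q) \<in> ?S"
      using h by (auto simp: X_def Y_def ptf_trace_def)
    ultimately show "Z \<in> ?G ` ?S" by blast
  qed
  then have "card {Z \<in> Pow (cube n). \<exists>h\<in>PTF n k. card {x\<in>Q. sign_fun n Z x \<noteq> h x} \<le> r} \<le> card ?S"
    using finS by (meson surj_card_le)
  also have "\<dots> = card (ptf_trace n k Q) * binom_le (card Q) r * 2 ^ (2 ^ n - card Q)"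
    using finQ assms by (simp add: card_cartesian_product card_subsets_le card_Pow card_Diff_subset card_cube)
  also have "\<dots> \<le> binom_le (card Q) (binom_le n k) * binom_le (card Q) r * 2 ^ (2 ^ n - card Q)"
    using card_ptf_trace[OF assms, of k] by simp
  finally show ?thesis .
qed

lemma card_close_le_fraction:
  assumes "Q \<subseteq> cube n" "20 * binom_le n k \<le> card Q" "20 * r \<le> card Q" "20 \<le> card Q"
  shows "real (card {Z \<in> Pow (cube n). \<exists>h\<in>PTF n k. card {x\<in>Q. sign_fun n Z x \<noteq> h x} \<le> r}) \<le>
    1 / 64 * real (card (Pow (cube n)))"
proof -
  define M where "M = card Q"
  define V where "V = binom_le n k"
  have M: "M \<le> 2 ^ n" using card_mono[OF finite_cube assms(1)] by (simp add: card_cube M_def)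
  \<comment> \<open>From \<open>x = 1 / 8\<close> and \<open>(9 / 8) ^ 5 \<le> 2\<close>. With
    \<open>M\<close> at least 20 times \<open>V\<close> and \<open>r\<close>, the exponents add up
    to at most \<open>7 * M / 10\<close> against the \<open>M\<close> bits of freedom on
    \<open>Q\<close>; the gain \<open>3 * M / 10\<close> is at least 6, whence 1/64.\<close>
  have bl: "real (binom_le M s) \<le> 2 powr (real M / 5 + real (3 * s))" for s
  proof -
    have "real (binom_le M s) = (binom_le M s * (1 / 8) ^ s) * 8 ^ s"
      by (simp add: power_divide)
    also have "\<dots> \<le> (9 / 8) ^ M * 8 ^ s"
      using binom_le_power_le[of "1/8" M s] by (intro mult_right_mono) auto
    also have "(9 / 8 :: real) ^ M \<le> (2 powr (1 / 5)) ^ M"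
    proof (rule power_mono)
      have "(9 / 8 :: real) powr 5 \<le> 2" by (simp add: power_numeral_reduce)
      then have "((9 / 8 :: real) powr 5) powr (1 / 5) \<le> 2 powr (1 / 5)"
        by (intro powr_mono2) auto
      then show "(9 / 8 :: real) \<le> 2 powr (1 / 5)" by (subst (asm) powr_powr) simp
    qed simp
    also have "(2 powr (1 / 5)) ^ M = (2 :: real) powr (M / 5)"
      by (simp add: powr_realpow[symmetric] powr_powr)
    also have "(8 :: real) ^ s = 2 powr real (3 * s)"
      by (subst powr_realpow) (simp_all add: power_mult)
    finally show ?thesis by (simp add: powr_add)
  qed
  have "real (binom_le M V * binom_le M r * 2 ^ (2 ^ n - M)) =
      real (binom_le M V) * real (binom_le M r) * 2 powr (real (2 ^ n) - real M)"
    using M by (simp add: powr_realpow[symmetric] of_nat_diff)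
  also have "\<dots> \<le> 2 powr (real M / 5 + real (3 * V)) * 2 powr (real M / 5 + real (3 * r)) * 2 powr (real (2 ^ n) - real M)"
    using bl by (intro mult_right_mono mult_mono) auto
  also have "\<dots> = 2 powr (real M / 5 + real (3 * V) + (real M / 5 + real (3 * r)) + (real (2 ^ n) - real M))"
    by (simp only: powr_add)
  also have "\<dots> \<le> 2 powr (real (2 ^ n) - 6)"
  proof (rule powr_mono)
    have "20 * real V \<le> M" "20 * real r \<le> M" "20 \<le> real M"
      using assms unfolding M_def V_def by linarith+
    then show "real M / 5 + real (3 * V) + (real M / 5 + real (3 * r)) + (real (2 ^ n) - real M)
        \<le> real (2 ^ n) - 6" by simp
  qed simp
  also have "\<dots> = 1 / 64 * 2 ^ (2 ^ n)"
    using powr_realpow[of 2 "2 ^ n"] by (simp add: powr_diff)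
  finally have "real (binom_le M V * binom_le M r * 2 ^ (2 ^ n - M)) \<le> 1 / 64 * 2 ^ (2 ^ n)" .
  moreover have "real (card {Z \<in> Pow (cube n). \<exists>h\<in>PTF n k. card {x\<in>Q. sign_fun n Z x \<noteq> h x} \<le> r}) \<le>
      real (binom_le M V * binom_le M r * 2 ^ (2 ^ n - M))"
    unfolding M_def V_def of_nat_le_iff by (rule card_close_le[OF assms(1)])
  ultimately show ?thesis by (simp add: card_Pow card_cube)
qed

section \<open>Random points are generic\<close>

text \<open>Counting form of conditioning on all coordinates but \<open>i\<close>: since the target
  \<open>Z y\<close> ignores coordinate \<open>i\<close>, a uniform \<open>y i\<close> hits it with
  probability at most \<open>z / card C\<close>.\<close>

lemma card_PiE_member:
  assumes "finite J" "i \<in> J" "finite C"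
    "\<And>y v. Z (y(i := v)) = Z y" "\<And>y. y \<in> J \<rightarrow>\<^sub>E C \<Longrightarrow> card (Z y \<inter> C) \<le> z"
  shows "card {y \<in> J \<rightarrow>\<^sub>E C. y i \<in> Z y} * card C \<le> z * card (J \<rightarrow>\<^sub>E C)"
proof -
  define J' where "J' = J - {i}"
  have J: "J = insert i J'" "i \<notin> J'" "finite J'" using assms by (auto simp: J'_def)
  show ?thesis
  proof (cases "C = {}")
    case False
    then obtain v0 where v0: "v0 \<in> C" by blast
    have "{y \<in> J \<rightarrow>\<^sub>E C. y i \<in> Z y} \<subseteq> (\<lambda>(g, v). g(i := v)) ` (SIGMA g : J' \<rightarrow>\<^sub>E C. Z g \<inter> C)"
    proof
      fix y assume y: "y \<in> {y \<in> J \<rightarrow>\<^sub>E C. y i \<in> Z y}"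
      then obtain v g where vg: "y = g(i := v)" "v \<in> C" "g \<in> J' \<rightarrow>\<^sub>E C"
        unfolding J(1) PiE_insert_eq by auto
      then have "v \<in> Z g" using y assms(4) by simp
      then show "y \<in> (\<lambda>(g, v). g(i := v)) ` (SIGMA g : J' \<rightarrow>\<^sub>E C. Z g \<inter> C)"
        using vg by (intro image_eqI[of _ _ "(g, v)"]) auto
    qed
    moreover have fin: "finite (J' \<rightarrow>\<^sub>E C)" using J assms by (intro finite_PiE) auto
    ultimately have "card {y \<in> J \<rightarrow>\<^sub>E C. y i \<in> Z y} \<le> card (SIGMA g : J' \<rightarrow>\<^sub>E C. Z g \<inter> C)"
      using assms(3) by (intro surj_card_le) auto
    also have "\<dots> = (\<Sum>g\<in>J' \<rightarrow>\<^sub>E C. card (Z g \<inter> C))"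
      using fin assms(3) by (intro card_SigmaI) auto
    also have "\<dots> \<le> (\<Sum>g\<in>J' \<rightarrow>\<^sub>E C. z)"
    proof (rule sum_mono)
      fix g assume "g \<in> J' \<rightarrow>\<^sub>E C"
      then have "g(i := v0) \<in> J \<rightarrow>\<^sub>E C" using v0 unfolding J(1) PiE_insert_eq by (intro image_eqI[of _ _ "(v0, g)"]) auto
      then show "card (Z g \<inter> C) \<le> z" using assms(4,5) by metis
    qed
    finally have "card {y \<in> J \<rightarrow>\<^sub>E C. y i \<in> Z y} \<le> z * card (J' \<rightarrow>\<^sub>E C)" by (simp add: mult.commute)
    moreover have "card (J \<rightarrow>\<^sub>E C) = card C * card (J' \<rightarrow>\<^sub>E C)"
      using J by (simp add: card_PiE)
    ultimately show ?thesis by (simp add: mult_ac)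
  qed simp
qed

text \<open>For fixed \<open>u\<close> and uniformly random \<open>y\<close>, there are at most
  \<open>(N + 1)^2\<close> possible collisions of probability \<open>1 / 2 ^ n\<close>, and at most
  \<open>binom_le r k\<close> possible dependencies of probability \<open>2 ^ r / 2 ^ n\<close>.
  Averaging then fixes a single \<open>y\<close> for most \<open>u\<close>.\<close>

lemma exists_generic_points:
  fixes P :: "'u pmf" and I :: "'u \<Rightarrow> nat set" and \<delta> :: real
  assumes "\<And>u. u \<in> set_pmf P \<Longrightarrow> I u \<subseteq> {..N}" "\<delta> < 1"
    "((real N + 1)\<^sup>2 + binom_le r k * 2 ^ r) / 2 ^ n \<le> \<delta>"
  shows "\<exists>y. y ` {..N} \<subseteq> cube n \<and> inj_on y {..N} \<and>
    measure_pmf.prob P {u. card (I u) \<le> binom_le r k \<and>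
      (\<exists>i\<in>I u. y i \<in> deg_closure n k (y ` {l\<in>I u. l < i}))} \<le> \<delta>"
proof -
  let ?F = "{..N} \<rightarrow>\<^sub>E cube n"
  define dep where "dep y u \<longleftrightarrow> card (I u) \<le> binom_le r k \<and>
      (\<exists>i\<in>I u. y i \<in> deg_closure n k (y ` {l\<in>I u. l < i}))" for y u
  have finF: "finite ?F" by (intro finite_PiE) auto
  have "real (card {y\<in>?F. \<not> inj_on y {..N} \<or> dep y u}) \<le> \<delta> * card ?F" if u: "u \<in> set_pmf P" for u
  proof -
    have Iu: "I u \<subseteq> {..N}" "finite (I u)" using assms(1)[OF u] finite_subset by auto
    define A where "A i j = {y\<in>?F. y i \<in> {y j}}" for i j
    define B where "B i = {y\<in>?F. y i \<in> deg_closure n k (y ` {l\<in>I u. l < i})}" for i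
    have fin: "finite (A i j)" "finite (B i)" for i j
      using finF by (auto simp: A_def B_def)
    have cardA: "card (A i j) * 2 ^ n \<le> 1 * card ?F" if "i \<le> N" "j \<noteq> i" for i j
    proof -
      have "card ({y j} \<inter> cube n) \<le> 1" for y :: "nat \<Rightarrow> nat \<Rightarrow> real"
        using card_mono[of "{y j}" "{y j} \<inter> cube n"] by simp
      then show ?thesis
        unfolding A_def card_cube[of n, symmetric] using that by (intro card_PiE_member) auto
    qed
    have cardB: "card (B i) * 2 ^ n \<le> 2 ^ r * card ?F" if i: "i \<in> I u" "card (I u) \<le> binom_le r k" for i
      unfolding B_def card_cube[of n, symmetric]
    proof (rule card_PiE_member[where Z = "\<lambda>y. deg_closure n k (y ` {l \<in> I u. l < i})"])
      show "i \<in> {..N}" using i Iu by auto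
      fix y :: "nat \<Rightarrow> nat \<Rightarrow> real"
      show "deg_closure n k ((y(i := v)) ` {l \<in> I u. l < i}) = deg_closure n k (y ` {l \<in> I u. l < i})" for v
        by (rule arg_cong[of _ _ "deg_closure n k"]) auto
      have "card (y ` {l \<in> I u. l < i}) \<le> card {l \<in> I u. l < i}" using Iu by (intro card_image_le) auto
      \<comment> \<open>\<open>i\<close> is not among its predecessors; the closure bound needs this
        strict inequality.\<close>
      also have "\<dots> < card (I u)" using i Iu by (intro psubset_card_mono) auto
      finally have "card (deg_closure n k (y ` {l \<in> I u. l < i})) < 2 ^ r"
        using i Iu by (intro card_deg_closure_less) auto
      moreover have "deg_closure n k (y ` {l \<in> I u. l < i}) \<inter> cube n = deg_closure n k (y ` {l \<in> I u. l < i})"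
        by (auto simp: deg_closure_def)
      ultimately show "card (deg_closure n k (y ` {l \<in> I u. l < i}) \<inter> cube n) \<le> 2 ^ r" by simp
    qed auto
    define pairs where "pairs = {(i, j). i \<le> N \<and> j \<le> N \<and> j \<noteq> i}"
    \<comment> \<open>Supports that are too large cause no bad event, so the union bound never runs
      over more than \<open>binom_le r k\<close> indices.\<close>
    define Iu' where "Iu' = (if card (I u) \<le> binom_le r k then I u else {})"
    have fin': "finite pairs" "finite Iu'"
      using Iu by (auto simp: pairs_def Iu'_def intro: finite_subset[of _ "{..N} \<times> {..N}"])
    have "card pairs \<le> card ({..N} \<times> {..N})" by (intro card_mono) (auto simp: pairs_def)
    then have cp: "card pairs \<le> (N + 1)\<^sup>2" by (simp add: power2_eq_square)
    have cI: "card Iu' \<le> binom_le r k" by (simp add: Iu'_def)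
    have "{y\<in>?F. \<not> inj_on y {..N} \<or> dep y u} \<subseteq> (\<Union>(i, j)\<in>pairs. A i j) \<union> (\<Union>i\<in>Iu'. B i)"
      unfolding dep_def inj_on_def A_def B_def pairs_def Iu'_def by fastforce
    then have "card {y\<in>?F. \<not> inj_on y {..N} \<or> dep y u} \<le> card ((\<Union>(i, j)\<in>pairs. A i j) \<union> (\<Union>i\<in>Iu'. B i))"
      using fin fin' by (intro card_mono) auto
    also have "\<dots> \<le> card (\<Union>(i, j)\<in>pairs. A i j) + card (\<Union>i\<in>Iu'. B i)" by (rule card_Un_le)
    also have "\<dots> \<le> (\<Sum>(i, j)\<in>pairs. card (A i j)) + (\<Sum>i\<in>Iu'. card (B i))"
      using fin' card_UN_le[of pairs "\<lambda>(i, j). A i j"] card_UN_le[of Iu' B]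
      by (simp add: case_prod_unfold)
    finally have "card {y\<in>?F. \<not> inj_on y {..N} \<or> dep y u} * 2 ^ n \<le>
        (\<Sum>(i, j)\<in>pairs. card (A i j) * 2 ^ n) + (\<Sum>i\<in>Iu'. card (B i) * 2 ^ n)"
      by (simp add: sum_distrib_right[symmetric] case_prod_unfold add_mult_distrib[symmetric])
    also have "\<dots> \<le> (\<Sum>(i, j)\<in>pairs. card ?F) + (\<Sum>i\<in>Iu'. 2 ^ r * card ?F)"
    proof (intro add_mono sum_mono)
      fix p assume "p \<in> pairs"
      then show "(case p of (i, j) \<Rightarrow> card (A i j) * 2 ^ n) \<le> (case p of (i, j) \<Rightarrow> card ?F)"
        using cardA by (auto simp: pairs_def)
    next
      fix i assume "i \<in> Iu'"
      then show "card (B i) * 2 ^ n \<le> 2 ^ r * card ?F"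
        using cardB by (auto simp: Iu'_def split: if_splits)
    qed
    also have "\<dots> = (card pairs + card Iu' * 2 ^ r) * card ?F"
      by (simp add: algebra_simps)
    also have "\<dots> \<le> ((N + 1)\<^sup>2 + binom_le r k * 2 ^ r) * card ?F"
      using cp cI by (intro mult_right_mono add_mono) auto
    finally have "real (card {y\<in>?F. \<not> inj_on y {..N} \<or> dep y u} * 2 ^ n) \<le>
        real (((N + 1)\<^sup>2 + binom_le r k * 2 ^ r) * card ?F)"
      by (rule of_nat_mono)
    then have "real (card {y\<in>?F. \<not> inj_on y {..N} \<or> dep y u}) * 2 ^ n \<le>
        ((real N + 1)\<^sup>2 + binom_le r k * 2 ^ r) * card ?F"
      by (simp only: of_nat_mult of_nat_add of_nat_power of_nat_numeral of_nat_1)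
    then have "real (card {y\<in>?F. \<not> inj_on y {..N} \<or> dep y u}) \<le>
        ((real N + 1)\<^sup>2 + binom_le r k * 2 ^ r) / 2 ^ n * card ?F"
      by (simp add: field_simps)
    also have "\<dots> \<le> \<delta> * card ?F" using assms(3) by (intro mult_right_mono) auto
    finally show ?thesis .
  qed
  moreover have "?F \<noteq> {}"
  proof -
    have "cube n \<noteq> {}" using card_cube[of n] by auto
    then show ?thesis by (simp add: PiE_eq_empty_iff)
  qed
  ultimately obtain y where y: "y \<in> ?F" "measure_pmf.prob P {u. \<not> inj_on y {..N} \<or> dep y u} \<le> \<delta>"
    using averaging[OF finF, of P "\<lambda>y u. \<not> inj_on y {..N} \<or> dep y u" \<delta>] by blast
  \<comment> \<open>A collision does not depend on \<open>u\<close>, so it would be bad with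
    probability 1, which exceeds \<delta>.\<close>
  have inj: "inj_on y {..N}"
  proof (rule ccontr)
    assume "\<not> ?thesis"
    then have "measure_pmf.prob P {u. \<not> inj_on y {..N} \<or> dep y u} = 1" by simp
    then show False using y(2) assms(2) by simp
  qed
  then have "measure_pmf.prob P {u. dep y u} \<le> \<delta>" using y(2) by simp
  then show ?thesis using y(1) inj unfolding dep_def by (intro exI[of _ y]) auto
qed

section \<open>Indistinguishability by moment matching\<close>

text \<open>For a probability vector \<open>e\<close> this is the mean of \<open>g\<close> over
  \<open>m\<close> independent indices. Allowing arbitrary reals \<open>e\<close> makes it a
  polynomial in the entries of \<open>e\<close>.\<close>

primrec acceptance :: "nat \<Rightarrow> nat \<Rightarrow> (nat list \<Rightarrow> real) \<Rightarrow> (nat \<Rightarrow> real) \<Rightarrow> real" where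
  "acceptance N 0 g e = g []"
| "acceptance N (Suc m) g e = (\<Sum>i\<le>N. e i * acceptance N m (\<lambda>l. g (i # l)) e)"

text \<open>The parameter \<open>t\<close> moves mass from \<open>b\<close> to \<open>a\<close>.
  Each further sample adds to the \<open>e\<close>-average of the previous coefficients a shifted
  difference of two of them, so the bounds obey Pascal's rule with a factor 2 per degree.\<close>

lemma acceptance_polynomial:
  assumes "\<And>i. i \<le> N \<Longrightarrow> 0 \<le> e i" "(\<Sum>i\<le>N. e i) = 1" "\<And>l. \<bar>g l\<bar> \<le> 1" "a \<le> N" "b \<le> N"
  shows "\<exists>c. (\<forall>i. \<bar>c i\<bar> \<le> real (m choose i) * 2 ^ i) \<and>
    (\<forall>t. acceptance N m g (\<lambda>i. e i + t * (of_bool (i = a) - of_bool (i = b))) = (\<Sum>i\<le>m. c i * t ^ i))"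
  using assms(3)
proof (induction m arbitrary: g)
  case 0
  then show ?case by (intro exI[of _ "\<lambda>i. if i = 0 then g [] else 0"]) auto
next
  case (Suc m)
  define e' where "e' t i = e i + t * (of_bool (i = a) - of_bool (i = b))" for t i
  have "\<exists>c. (\<forall>i. \<bar>c i\<bar> \<le> real (m choose i) * 2 ^ i) \<and>
      (\<forall>t. acceptance N m (\<lambda>l. g (x # l)) (e' t) = (\<Sum>i\<le>m. c i * t ^ i))" for x
    unfolding e'_def using Suc.prems by (intro Suc.IH) auto
  then obtain C where C: "\<And>x i. \<bar>C x i\<bar> \<le> real (m choose i) * 2 ^ i"
    "\<And>x t. acceptance N m (\<lambda>l. g (x # l)) (e' t) = (\<Sum>i\<le>m. C x i * t ^ i)" by metis
  define c where "c i = (\<Sum>x\<le>N. e x * C x i) + (case i of 0 \<Rightarrow> 0 | Suc j \<Rightarrow> C a j - C b j)" for i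
  have avg: "\<bar>\<Sum>x\<le>N. e x * C x i\<bar> \<le> real (m choose i) * 2 ^ i" for i
  proof -
    have "\<bar>\<Sum>x\<le>N. e x * C x i\<bar> \<le> (\<Sum>x\<le>N. e x * (real (m choose i) * 2 ^ i))"
      using C(1) assms(1) by (intro order.trans[OF sum_abs] sum_mono) (auto simp: abs_mult intro!: mult_left_mono)
    also have "\<dots> = real (m choose i) * 2 ^ i"
      using assms(2) by (simp add: sum_distrib_right[symmetric])
    finally show ?thesis .
  qed
  have "\<bar>c i\<bar> \<le> real (Suc m choose i) * 2 ^ i" for i
  proof (cases i)
    case 0
    then show ?thesis using avg[of 0] by (simp add: c_def)
  next
    case (Suc j)
    have "\<bar>c i\<bar> \<le> real (m choose i) * 2 ^ i + (real (m choose j) * 2 ^ j + real (m choose j) * 2 ^ j)"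
      using avg[of i] C(1)[of a j] C(1)[of b j] by (simp add: c_def Suc)
    also have "\<dots> = real (Suc m choose i) * 2 ^ i" by (simp add: Suc algebra_simps)
    finally show ?thesis .
  qed
  moreover have "acceptance N (Suc m) g (e' t) = (\<Sum>i\<le>Suc m. c i * t ^ i)" for t
  proof -
    define P where "P x = (\<Sum>i\<le>m. C x i * t ^ i)" for x
    have C0: "C x (Suc m) = 0" for x using C(1)[of x "Suc m"] by (simp add: binomial_eq_0)
    have "acceptance N (Suc m) g (e' t) = (\<Sum>x\<le>N. e' t x * P x)" by (simp add: C(2) P_def)
    also have "\<dots> = (\<Sum>x\<le>N. e x * P x + (t * (of_bool (x = a) * P x) - t * (of_bool (x = b) * P x)))"
      by (intro sum.cong refl) (simp add: e'_def algebra_simps)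
    also have "\<dots> = (\<Sum>x\<le>N. e x * P x) + (t * (\<Sum>x\<le>N. of_bool (x = a) * P x)
        - t * (\<Sum>x\<le>N. of_bool (x = b) * P x))"
      by (simp only: sum.distrib sum_subtractf sum_distrib_left)
    also have "(\<Sum>x\<le>N. of_bool (x = a) * P x) = P a"
      using assms(4) by simp
    also have "(\<Sum>x\<le>N. of_bool (x = b) * P x) = P b"
      using assms(5) by simp
    also have "(\<Sum>x\<le>N. e x * P x) = (\<Sum>i\<le>m. (\<Sum>x\<le>N. e x * C x i) * t ^ i)"
      unfolding P_def sum_distrib_left sum_distrib_right
      by (subst sum.swap) (simp add: mult_ac)
    also have "\<dots> = (\<Sum>i\<le>Suc m. (\<Sum>x\<le>N. e x * C x i) * t ^ i)" by (simp add: C0)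
    also have "t * P a = (\<Sum>i\<le>Suc m. (case i of 0 \<Rightarrow> 0 | Suc j \<Rightarrow> C a j) * t ^ i)"
      unfolding P_def by (subst sum.atMost_Suc_shift) (simp add: sum_distrib_left mult_ac)
    also have "t * P b = (\<Sum>i\<le>Suc m. (case i of 0 \<Rightarrow> 0 | Suc j \<Rightarrow> C b j) * t ^ i)"
      unfolding P_def by (subst sum.atMost_Suc_shift) (simp add: sum_distrib_left mult_ac)
    also have "(\<Sum>i\<le>Suc m. (\<Sum>x\<le>N. e x * C x i) * t ^ i)
        + ((\<Sum>i\<le>Suc m. (case i of 0 \<Rightarrow> 0 | Suc j \<Rightarrow> C a j) * t ^ i)
        - (\<Sum>i\<le>Suc m. (case i of 0 \<Rightarrow> 0 | Suc j \<Rightarrow> C b j) * t ^ i)) = (\<Sum>i\<le>Suc m. c i * t ^ i)"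
      unfolding sum.distrib[symmetric] sum_subtractf[symmetric]
      by (intro sum.cong refl) (auto simp: c_def algebra_simps split: nat.split)
    finally show ?thesis .
  qed
  ultimately show ?case unfolding e'_def by blast
qed

lemma pmf_bind_replicate_eq_acceptance:
  assumes "set_pmf E \<subseteq> {..N}"
  shows "pmf (bind_pmf (replicate_pmf m E) R) True = acceptance N m (\<lambda>l. pmf (R l) True) (pmf E)"
proof (induction m arbitrary: R)
  case (Suc m)
  have "pmf (bind_pmf (replicate_pmf (Suc m) E) R) True =
      pmf (bind_pmf E (\<lambda>i. bind_pmf (replicate_pmf m E) (\<lambda>l. R (i # l)))) True"
    by (simp add: bind_assoc_pmf bind_return_pmf)
  also have "\<dots> = (\<Sum>i\<le>N. pmf (bind_pmf (replicate_pmf m E) (\<lambda>l. R (i # l))) True * pmf E i)"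
    unfolding pmf_bind[of E] using assms by (intro integral_measure_pmf_real) auto
  also have "\<dots> = acceptance N (Suc m) (\<lambda>l. pmf (R l) True) (pmf E)"
    by (simp add: Suc.IH mult.commute)
  finally show ?case .
qed (simp add: bind_return_pmf)

text \<open>Index 0 is the extra point that absorbs the mass left over by the weights. Invalid weights give
  the point mass there, which keeps the support within that of \<open>u\<close>.\<close>

definition weight_pmf :: "nat \<Rightarrow> real \<Rightarrow> (nat \<Rightarrow> real) \<Rightarrow> nat pmf" where
  "weight_pmf N W u =
    (if (\<forall>i\<in>{1..N}. 0 \<le> u i) \<and> (\<Sum>i\<in>{1..N}. u i) \<le> W
     then embed_pmf (\<lambda>i. if i = 0 then 1 - (\<Sum>i\<in>{1..N}. u i) / W else if i \<le> N then u i / W else 0)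
     else return_pmf 0)"

lemma pmf_weight_pmf:
  assumes "\<And>i. i \<in> {1..N} \<Longrightarrow> 0 \<le> u i" "(\<Sum>i\<in>{1..N}. u i) \<le> W" "0 < W"
  shows "pmf (weight_pmf N W u) i =
    (if i = 0 then 1 - (\<Sum>i\<in>{1..N}. u i) / W else if i \<le> N then u i / W else 0)"
proof -
  let ?f = "\<lambda>i. if i = 0 then 1 - (\<Sum>i\<in>{1..N}. u i) / W else if i \<le> N then u i / W else 0"
  have nonneg: "0 \<le> ?f i" for i using assms by auto
  have "(\<integral>\<^sup>+ i. ennreal (?f i) \<partial>count_space UNIV) = (\<Sum>i\<le>N. ennreal (?f i))"
    by (intro nn_integral_count_space'[of "{..N}"]) auto
  also have "\<dots> = ennreal (\<Sum>i\<le>N. ?f i)"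
    using nonneg by (intro sum_ennreal) auto
  also have "(\<Sum>i\<le>N. ?f i) = ?f 0 + (\<Sum>i\<in>{1..N}. ?f i)"
  proof -
    have "{..N} = insert 0 {1..N}" by auto
    then show ?thesis by simp
  qed
  also have "(\<Sum>i\<in>{1..N}. ?f i) = (\<Sum>i\<in>{1..N}. u i / W)" by (intro sum.cong) auto
  also have "?f 0 + \<dots> = 1" by (simp add: sum_divide_distrib)
  finally have "pmf (embed_pmf ?f) i = ?f i" using nonneg by (intro pmf_embed_pmf) auto
  then show ?thesis using assms unfolding weight_pmf_def by auto
qed

lemma set_weight_pmf:
  assumes "0 < W"
  shows "set_pmf (weight_pmf N W u) \<subseteq> insert 0 {i\<in>{1..N}. u i \<noteq> 0}"
proof (cases "(\<forall>i\<in>{1..N}. 0 \<le> u i) \<and> (\<Sum>i\<in>{1..N}. u i) \<le> W")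
  case True
  show ?thesis
  proof
    fix i assume "i \<in> set_pmf (weight_pmf N W u)"
    then have "pmf (weight_pmf N W u) i \<noteq> 0" by (simp add: set_pmf_iff)
    then show "i \<in> insert 0 {i\<in>{1..N}. u i \<noteq> 0}"
      using True pmf_weight_pmf[of N u W i] assms by (auto split: if_splits)
  qed
next
  case False
  then have "weight_pmf N W u = return_pmf 0" by (auto simp: weight_pmf_def)
  then show ?thesis by simp
qed

text \<open>Passing from \<rho> to \<open>4 * \<rho>\<close> gains \<open>1 / 4 ^ L\<close> in every
  term beyond \<open>L\<close>, while the full exponential series grows only to
  \<open>exp (L / 2)\<close>, at most \<open>2 ^ L\<close>.\<close>

lemma sum_exp_tail_le:
  fixes \<rho> :: real
  assumes "0 \<le> \<rho>" "8 * \<rho> \<le> real L"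
  shows "(\<Sum>i\<in>{L<..m}. \<rho> ^ i / fact i) \<le> 1 / 2 ^ L"
proof -
  have "(\<Sum>i\<in>{L<..m}. \<rho> ^ i / fact i) \<le> (\<Sum>i\<in>{L<..m}. (4 * \<rho>) ^ i / fact i * (1 / 4 ^ L))"
  proof (rule sum_mono)
    fix i assume "i \<in> {L<..m}"
    then have "(4 :: real) ^ L \<le> 4 ^ i" by (intro power_increasing) auto
    then have "\<rho> ^ i * 4 ^ L \<le> \<rho> ^ i * 4 ^ i" using assms by (intro mult_left_mono) auto
    then show "\<rho> ^ i / fact i \<le> (4 * \<rho>) ^ i / fact i * (1 / 4 ^ L)"
      by (simp add: field_simps power_mult_distrib)
  qed
  also have "\<dots> = (\<Sum>i\<in>{L<..m}. (4 * \<rho>) ^ i / fact i) * (1 / 4 ^ L)"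
    by (rule sum_distrib_right[symmetric])
  also have "\<dots> \<le> exp (4 * \<rho>) * (1 / 4 ^ L)"
  proof (rule mult_right_mono)
    have "(\<Sum>i\<in>{L<..m}. (4 * \<rho>) ^ i /\<^sub>R fact i) \<le> exp (4 * \<rho>)"
      unfolding exp_def using assms by (intro sum_le_suminf summable_exp_generic) auto
    then show "(\<Sum>i\<in>{L<..m}. (4 * \<rho>) ^ i / fact i) \<le> exp (4 * \<rho>)"
      by (simp add: divide_inverse mult.commute)
  qed simp
  also have "\<dots> \<le> 2 ^ L * (1 / 4 ^ L)"
  proof (rule mult_right_mono)
    have "exp (4 * \<rho>) \<le> exp (L * (1 / 2))" using assms by simp
    also have "\<dots> = exp (1 / 2) ^ L" by (rule exp_of_nat_mult)
    also have "\<dots> \<le> 2 ^ L" using exp_half_le2 by (intro power_mono) auto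
    finally show "exp (4 * \<rho>) \<le> 2 ^ L" .
  qed simp
  also have "2 ^ L * (1 / 4 ^ L) = (1 / 2 ^ L :: real)"
    by (simp add: power_mult_distrib[symmetric] field_simps)
  finally show ?thesis .
qed

text \<open>The mean bound 8 is the one achieved by the laws constructed below.\<close>

definition bounded_law :: "real \<Rightarrow> real pmf \<Rightarrow> bool" where
  "bounded_law wmax p \<longleftrightarrow> finite (set_pmf p) \<and> set_pmf p \<subseteq> {0..wmax} \<and> measure_pmf.expectation p (\<lambda>x. x) \<le> 8"

lemma bounded_law_integrable: "bounded_law wmax p \<Longrightarrow> integrable (measure_pmf p) (f :: real \<Rightarrow> real)"
  by (auto simp: bounded_law_def intro: integrable_measure_pmf_finite)

text \<open>Degrees up to \<open>L\<close> cancel. Beyond, the coefficient is at most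
  \<open>(2 * m) ^ i / fact i\<close> and the moments lie between 0 and \<open>wmax ^ i\<close>, so
  an exponential tail at \<open>2 * m * wmax / W\<close> remains; the last hypothesis says that 8
  times this number is at most \<open>L\<close>.\<close>

lemma expectation_polynomial_diff:
  fixes c :: "nat \<Rightarrow> real"
  assumes "bounded_law wmax \<alpha>" "bounded_law wmax \<beta>" "0 < W" "0 \<le> wmax"
    "\<And>i. i \<le> L \<Longrightarrow> measure_pmf.expectation \<alpha> (\<lambda>x. x ^ i) = measure_pmf.expectation \<beta> (\<lambda>x. x ^ i)"
    "\<And>i. \<bar>c i\<bar> \<le> real (m choose i) * 2 ^ i" "16 * real m * wmax \<le> real L * W"
  shows "\<bar>measure_pmf.expectation \<alpha> (\<lambda>x. \<Sum>i\<le>m. c i * (x / W) ^ i) -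
    measure_pmf.expectation \<beta> (\<lambda>x. \<Sum>i\<le>m. c i * (x / W) ^ i)\<bar> \<le> 1 / 2 ^ L"
proof -
  define M where "M p i = measure_pmf.expectation p (\<lambda>x. x ^ i)" for p :: "real pmf" and i
  have ex: "measure_pmf.expectation p (\<lambda>x. \<Sum>i\<le>m. c i * (x / W) ^ i) = (\<Sum>i\<le>m. c i / W ^ i * M p i)"
    if "bounded_law wmax p" for p
    unfolding M_def using bounded_law_integrable[OF that]
    by (subst Bochner_Integration.integral_sum) (auto simp: power_divide)
  have bound: "0 \<le> M p i \<and> M p i \<le> wmax ^ i" if "bounded_law wmax p" for p i
    unfolding M_def
  proof
    have s: "set_pmf p \<subseteq> {0..wmax}" using that by (simp add: bounded_law_def)
    then show "0 \<le> measure_pmf.expectation p (\<lambda>x. x ^ i)"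
      by (intro Bochner_Integration.integral_nonneg_AE AE_pmfI) auto
    show "measure_pmf.expectation p (\<lambda>x. x ^ i) \<le> wmax ^ i"
      using s by (intro measure_pmf.integral_le_const bounded_law_integrable[OF that] AE_pmfI)
        (auto intro!: power_mono simp: subset_iff)
  qed
  have "\<bar>(\<Sum>i\<le>m. c i / W ^ i * M \<alpha> i) - (\<Sum>i\<le>m. c i / W ^ i * M \<beta> i)\<bar> =
      \<bar>\<Sum>i\<le>m. c i / W ^ i * (M \<alpha> i - M \<beta> i)\<bar>"
    by (simp add: sum_subtractf algebra_simps)
  also have "(\<Sum>i\<le>m. c i / W ^ i * (M \<alpha> i - M \<beta> i)) = (\<Sum>i\<in>{L<..m}. c i / W ^ i * (M \<alpha> i - M \<beta> i))"
    using assms(5) by (intro sum.mono_neutral_right) (auto simp: M_def not_less)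
  also have "\<bar>\<dots>\<bar> \<le> (\<Sum>i\<in>{L<..m}. (2 * m * wmax / W) ^ i / fact i)"
  proof (intro order.trans[OF sum_abs] sum_mono)
    fix i
    have d: "\<bar>M \<alpha> i - M \<beta> i\<bar> \<le> wmax ^ i"
      using bound[OF assms(1), of i] bound[OF assms(2), of i] by (simp add: abs_le_iff)
    have "real (m choose i) * fact i \<le> real m ^ i"
      using binomial_fact_pow[of m i] of_nat_mono[where 'a = real] by fastforce
    then have ch: "real (m choose i) \<le> real m ^ i / fact i" by (simp add: field_simps)
    have "\<bar>c i / W ^ i * (M \<alpha> i - M \<beta> i)\<bar> = \<bar>c i\<bar> / W ^ i * \<bar>M \<alpha> i - M \<beta> i\<bar>"
      using assms(3) by (simp add: abs_mult)
    also have "\<dots> \<le> (real m ^ i / fact i * 2 ^ i) / W ^ i * wmax ^ i"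
    proof (intro mult_mono divide_right_mono d)
      show "\<bar>c i\<bar> \<le> real m ^ i / fact i * 2 ^ i"
        using assms(6)[of i] ch by (meson mult_right_mono order.trans zero_le_numeral zero_le_power)
    qed (use assms(3) in auto)
    also have "\<dots> = (2 * m * wmax / W) ^ i / fact i"
      by (simp add: power_mult_distrib power_divide mult_ac)
    finally show "\<bar>c i / W ^ i * (M \<alpha> i - M \<beta> i)\<bar> \<le> (2 * m * wmax / W) ^ i / fact i" .
  qed
  also have "\<dots> \<le> 1 / 2 ^ L"
    using assms(3,4,7) by (intro sum_exp_tail_le) (auto simp: field_simps)
  finally show ?thesis using ex assms(1,2) by simp
qed

text \<open>Exponential Markov inequality at scale \<open>1 / wmax\<close>. On the unit interval
  \<open>exp x \<le> 1 + 2 * x\<close>, so a mean of at most 8 costs 16 per coordinate.\<close>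

lemma prob_sum_large:
  fixes J :: "'a set" and T :: real
  assumes "finite J" "\<And>i. i \<in> J \<Longrightarrow> bounded_law wmax (p i)" "0 < wmax"
  shows "measure_pmf.prob (Pi_pmf J 0 p) {u. T < (\<Sum>i\<in>J. u i)} \<le> exp ((16 * real (card J) - T) / wmax)"
proof -
  let ?P = "Pi_pmf J 0 p"
  have int: "integrable ?P (\<lambda>u. \<Prod>i\<in>J. exp (u i / wmax))"
    using assms bounded_law_integrable by (intro integrable_prod_Pi_pmf[where f = "\<lambda>_ x. exp (x / wmax)"]) blast+
  have "measure_pmf.prob ?P {u. T < (\<Sum>i\<in>J. u i)} =
      measure_pmf.expectation ?P (indicator {u. T < (\<Sum>i\<in>J. u i)})" by simp
  also have "\<dots> \<le> measure_pmf.expectation ?P (\<lambda>u. exp (- T / wmax) * (\<Prod>i\<in>J. exp (u i / wmax)))"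
  proof (rule Bochner_Integration.integral_mono)
    show "integrable ?P (indicator {u :: 'a \<Rightarrow> real. T < (\<Sum>i\<in>J. u i)} :: ('a \<Rightarrow> real) \<Rightarrow> real)"
      by (intro measure_pmf.integrable_const_bound[where B = 1]) auto
    show "integrable ?P (\<lambda>u. exp (- T / wmax) * (\<Prod>i\<in>J. exp (u i / wmax)))"
      using int by (intro integrable_mult_right)
    fix u
    have "exp (- T / wmax) * (\<Prod>i\<in>J. exp (u i / wmax)) = exp (((\<Sum>i\<in>J. u i) - T) / wmax)"
      using assms(1) by (simp add: exp_sum[symmetric] exp_add[symmetric] diff_divide_distrib sum_divide_distrib)
    then show "indicator {u. T < (\<Sum>i\<in>J. u i)} u \<le> exp (- T / wmax) * (\<Prod>i\<in>J. exp (u i / wmax))"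
      using assms(3) by (auto simp: indicator_def)
  qed
  also have "\<dots> = exp (- T / wmax) * measure_pmf.expectation ?P (\<lambda>u. \<Prod>i\<in>J. exp (u i / wmax))" by simp
  also have "measure_pmf.expectation ?P (\<lambda>u. \<Prod>i\<in>J. exp (u i / wmax)) =
      (\<Prod>i\<in>J. measure_pmf.expectation (p i) (\<lambda>x. exp (x / wmax)))"
    using assms bounded_law_integrable
    by (intro expectation_prod_Pi_pmf[where f = "\<lambda>_ x. exp (x / wmax)"]) auto
  also have "\<dots> \<le> (\<Prod>i\<in>J. exp (16 / wmax))"
  proof (rule prod_mono)
    fix i assume i: "i \<in> J"
    have s: "set_pmf (p i) \<subseteq> {0..wmax}" using assms(2)[OF i] by (simp add: bounded_law_def)
    have "measure_pmf.expectation (p i) (\<lambda>x. exp (x / wmax)) \<le> measure_pmf.expectation (p i) (\<lambda>x. 1 + 2 / wmax * x)"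
    proof (intro integral_mono_AE bounded_law_integrable[OF assms(2)[OF i]] AE_pmfI)
      fix x assume "x \<in> set_pmf (p i)"
      then have x: "0 \<le> x / wmax" "x / wmax \<le> 1" using s assms(3) by auto
      then have "exp (x / wmax) \<le> 1 + x / wmax + (x / wmax)\<^sup>2" by (rule exp_bound)
      also have "(x / wmax)\<^sup>2 \<le> x / wmax" 
      proof -
        have "x / wmax * (x / wmax) \<le> x / wmax" using x by (intro mult_left_le)
        then show ?thesis by (simp only: power2_eq_square)
      qed
      finally show "exp (x / wmax) \<le> 1 + 2 / wmax * x" by simp
    qed
    also have "\<dots> = 1 + 2 / wmax * measure_pmf.expectation (p i) (\<lambda>x. x)"
      using bounded_law_integrable[OF assms(2)[OF i]] by (subst Bochner_Integration.integral_add) auto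
    also have "\<dots> \<le> 1 + 2 / wmax * 8"
      using assms(2)[OF i] assms(3) by (intro add_left_mono mult_left_mono) (auto simp: bounded_law_def)
    also have "\<dots> \<le> exp (16 / wmax)" using exp_ge_add_one_self[of "16 / wmax"] by simp
    finally show "0 \<le> measure_pmf.expectation (p i) (\<lambda>x. exp (x / wmax)) \<and>
        measure_pmf.expectation (p i) (\<lambda>x. exp (x / wmax)) \<le> exp (16 / wmax)"
      by (simp add: Bochner_Integration.integral_nonneg)
  qed
  also have "(\<Prod>i\<in>J. exp (16 / wmax)) = exp (card J * (16 / wmax))"
    by (subst exp_of_nat_mult) simp
  also have "exp (- T / wmax) * exp (card J * (16 / wmax)) = exp ((16 * real (card J) - T) / wmax)"
    by (simp add: exp_add[symmetric] diff_divide_distrib)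
  finally show ?thesis by (simp add: mult_left_mono)
qed

text \<open>The exponential term bounds the probability that the other weights leave no room for weight \<open>j\<close>.\<close>

lemma hybrid_step:
  fixes R :: "nat list \<Rightarrow> bool pmf" and W :: real and m N :: nat and p q :: "nat \<Rightarrow> real pmf"
  defines "K \<equiv> \<lambda>u. bind_pmf (replicate_pmf m (weight_pmf N W u)) R"
  assumes j: "j \<in> {1..N}" and pq: "\<And>i. i \<noteq> j \<Longrightarrow> p i = q i"
    and laws: "\<And>i. bounded_law wmax (p i)" "\<And>i. bounded_law wmax (q i)" and pos: "0 < wmax" "0 < W"
    and mom: "\<And>i. i \<le> L \<Longrightarrow>
      measure_pmf.expectation (p j) (\<lambda>x. x ^ i) = measure_pmf.expectation (q j) (\<lambda>x. x ^ i)"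
    and m: "16 * real m * wmax \<le> real L * W"
  shows "\<bar>pmf (bind_pmf (Pi_pmf {1..N} 0 p) K) True - pmf (bind_pmf (Pi_pmf {1..N} 0 q) K) True\<bar> \<le>
    1 / 2 ^ L + exp ((16 * real N - (W - wmax)) / wmax)"
proof -
  define J where "J = {1..N} - {j}"
  have J: "{1..N} = insert j J" "finite J" "j \<notin> J" using j by (auto simp: J_def)
  define V where "V = Pi_pmf J 0 p"
  have V: "V = Pi_pmf J 0 q" unfolding V_def
    by (intro Pi_pmf_cong refl J(2) pq) (use J(3) in blast)
  have split: "pmf (bind_pmf (Pi_pmf {1..N} 0 r) K) True =
      measure_pmf.expectation V (\<lambda>v. measure_pmf.expectation (r j) (\<lambda>x. pmf (K (v(j := x))) True))"
    if "V = Pi_pmf J 0 r" for r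
  proof -
    have "bind_pmf (Pi_pmf {1..N} 0 r) K = bind_pmf (r j) (\<lambda>x. bind_pmf V (\<lambda>v. K (v(j := x))))"
      unfolding J(1) that Pi_pmf_insert'[OF J(2,3)] by (simp add: bind_assoc_pmf bind_return_pmf)
    also have "\<dots> = bind_pmf V (\<lambda>v. bind_pmf (r j) (\<lambda>x. K (v(j := x))))"
      by (rule bind_commute_pmf)
    finally show ?thesis by (simp add: pmf_bind)
  qed
  define F where "F r v = measure_pmf.expectation (r j) (\<lambda>x. pmf (K (v(j := x))) True)"
    for r :: "nat \<Rightarrow> real pmf" and v
  have F: "F r v = pmf (bind_pmf (r j) (\<lambda>x. K (v(j := x)))) True" for r v
    by (simp add: F_def pmf_bind)
  have F01: "0 \<le> F r v" "F r v \<le> 1" for r v by (simp_all add: F pmf_nonneg pmf_le_1)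
  have intF: "integrable V (F r)" for r
    using F01 by (intro measure_pmf.integrable_const_bound[where B = 1]) auto
  have close: "\<bar>F p v - F q v\<bar> \<le> 1 / 2 ^ L + indicator {v. W - wmax < (\<Sum>i\<in>J. v i)} v"
    if v: "v \<in> set_pmf V" for v
  proof (cases "W - wmax < (\<Sum>i\<in>J. v i)")
    \<comment> \<open>Here \<open>weight_pmf\<close> may fall back to the point mass and
      polynomiality is lost; only the trivial bound 1 is used.\<close>
    case True
    have "\<bar>F p v - F q v\<bar> \<le> 1" using F01[of p v] F01[of q v] by (simp add: abs_le_iff)
    then show ?thesis using True by (simp add: add_increasing)
  next
    case False
    have v0: "0 \<le> v i" if "i \<in> J" for i
      using v that laws(1)[of i] J(2)
      by (force simp: V_def set_Pi_pmf PiE_dflt_def bounded_law_def)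
    have sum_upd: "(\<Sum>i\<in>{1..N}. (v(j := x)) i) = x + (\<Sum>i\<in>J. v i)" for x
    proof -
      have "(\<Sum>i\<in>{1..N}. (v(j := x)) i) = (v(j := x)) j + (\<Sum>i\<in>J. (v(j := x)) i)"
        unfolding J(1) using J(2,3) by (rule sum.insert)
      also have "(\<Sum>i\<in>J. (v(j := x)) i) = (\<Sum>i\<in>J. v i)"
        using J(3) by (intro sum.cong) auto
      finally show ?thesis by simp
    qed
    have pm: "pmf (weight_pmf N W (v(j := x))) i =
        (if i = 0 then 1 - (x + (\<Sum>i\<in>J. v i)) / W else if i \<le> N then (v(j := x)) i / W else 0)"
      if "0 \<le> x" "x \<le> wmax" for x i
      unfolding sum_upd[symmetric]
    proof (rule pmf_weight_pmf)
      show "0 \<le> (v(j := x)) i" if "i \<in> {1..N}" for i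
        using that v0 \<open>0 \<le> x\<close> by (cases "i = j") (auto simp: J_def)
      show "(\<Sum>i\<in>{1..N}. (v(j := x)) i) \<le> W"
        using False that unfolding sum_upd by simp
    qed (rule pos)
    \<comment> \<open>The reference distribution has weight 0 at \<open>j\<close>; weight
      \<open>x\<close> then means that mass \<open>x / W\<close> has moved from the extra index 0 to
      \<open>j\<close>.\<close>
    define e where "e = pmf (weight_pmf N W (v(j := 0)))"
    have sub: "set_pmf (weight_pmf N W u) \<subseteq> {..N}" for u
      using set_weight_pmf[OF pos(2), of N u] by auto
    have e: "(\<Sum>i\<le>N. e i) = 1" unfolding e_def using sub by (intro sum_pmf_eq_1) auto
    have "\<exists>c. (\<forall>i. \<bar>c i\<bar> \<le> real (m choose i) * 2 ^ i) \<and>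
        (\<forall>t. acceptance N m (\<lambda>l. pmf (R l) True) (\<lambda>i. e i + t * (of_bool (i = j) - of_bool (i = 0))) =
          (\<Sum>i\<le>m. c i * t ^ i))"
      by (rule acceptance_polynomial[OF _ e]) (use j in \<open>auto simp: e_def pmf_nonneg pmf_le_1\<close>)
    then obtain c where c: "\<And>i. \<bar>c i\<bar> \<le> real (m choose i) * 2 ^ i"
      "\<And>t. acceptance N m (\<lambda>l. pmf (R l) True) (\<lambda>i. e i + t * (of_bool (i = j) - of_bool (i = 0))) =
        (\<Sum>i\<le>m. c i * t ^ i)"
      by blast
    have K: "pmf (K (v(j := x))) True = (\<Sum>i\<le>m. c i * (x / W) ^ i)" if x: "0 \<le> x" "x \<le> wmax" for x
    proof -
      have "pmf (weight_pmf N W (v(j := x))) i = e i + x / W * (of_bool (i = j) - of_bool (i = 0))" for i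
        unfolding e_def using j x pos by (subst (1 2) pm) (auto simp: add_divide_distrib)
      then have "pmf (weight_pmf N W (v(j := x))) = (\<lambda>i. e i + x / W * (of_bool (i = j) - of_bool (i = 0)))"
        by (rule ext)
      then show ?thesis
        unfolding K_def c(2)[symmetric] by (simp only: pmf_bind_replicate_eq_acceptance[OF sub])
    qed
    have "F r v = measure_pmf.expectation (r j) (\<lambda>x. \<Sum>i\<le>m. c i * (x / W) ^ i)"
      if "bounded_law wmax (r j)" for r
      unfolding F_def using that K
      by (intro integral_cong_AE AE_pmfI) (auto simp: bounded_law_def)
    then have "\<bar>F p v - F q v\<bar> \<le> 1 / 2 ^ L"
      using expectation_polynomial_diff[OF laws(1)[of j] laws(2)[of j] pos(2) less_imp_le[OF pos(1)] mom c(1) m]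
        laws by simp
    then show ?thesis using False by simp
  qed
  have "\<bar>measure_pmf.expectation V (F p) - measure_pmf.expectation V (F q)\<bar> =
      \<bar>measure_pmf.expectation V (\<lambda>v. F p v - F q v)\<bar>"
    using intF by simp
  also have "\<dots> \<le> measure_pmf.expectation V (\<lambda>v. \<bar>F p v - F q v\<bar>)"
    by (rule integral_abs_bound)
  also have "\<dots> \<le> measure_pmf.expectation V (\<lambda>v. 1 / 2 ^ L + indicator {v. W - wmax < (\<Sum>i\<in>J. v i)} v)"
  proof (intro integral_mono_AE AE_pmfI close)
    show "integrable V (\<lambda>v. \<bar>F p v - F q v\<bar>)" using intF by auto
    show "integrable V (\<lambda>v. 1 / 2 ^ L + indicator {v. W - wmax < (\<Sum>i\<in>J. v i)} v :: real)"
      by (intro Bochner_Integration.integrable_add measure_pmf.integrable_const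
          measure_pmf.integrable_const_bound[where B = 1]) auto
  qed auto
  also have "\<dots> = 1 / 2 ^ L + measure_pmf.prob V {v. W - wmax < (\<Sum>i\<in>J. v i)}"
    by (subst Bochner_Integration.integral_add)
      (auto intro!: measure_pmf.integrable_const_bound[where B = 1])
  also have "measure_pmf.prob V {v. W - wmax < (\<Sum>i\<in>J. v i)} \<le> exp ((16 * real (card J) - (W - wmax)) / wmax)"
    unfolding V_def using J laws pos by (intro prob_sum_large) auto
  also have "\<dots> \<le> exp ((16 * real N - (W - wmax)) / wmax)"
  proof -
    have "card J \<le> N" using card_mono[of "{1..N}" J] by (simp add: J_def)
    then show ?thesis using pos by (simp add: divide_right_mono)
  qed
  finally show ?thesis using split[OF V_def] split[OF V] unfolding F_def by simp
qed

lemma hybrid: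
  fixes R :: "nat list \<Rightarrow> bool pmf" and W :: real and m N :: nat and \<alpha> \<beta> :: "real pmf"
  defines "K \<equiv> \<lambda>u. bind_pmf (replicate_pmf m (weight_pmf N W u)) R"
  assumes "bounded_law wmax \<alpha>" "bounded_law wmax \<beta>" "0 < wmax" "0 < W"
    "\<And>i. i \<le> L \<Longrightarrow> measure_pmf.expectation \<alpha> (\<lambda>x. x ^ i) = measure_pmf.expectation \<beta> (\<lambda>x. x ^ i)"
    "16 * real m * wmax \<le> real L * W"
  shows "\<bar>pmf (bind_pmf (Pi_pmf {1..N} 0 (\<lambda>_. \<alpha>)) K) True
      - pmf (bind_pmf (Pi_pmf {1..N} 0 (\<lambda>_. \<beta>)) K) True\<bar> \<le>
    real N * (1 / 2 ^ L + exp ((16 * real N - (W - wmax)) / wmax))"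
proof -
  define h where "h s = pmf (bind_pmf (Pi_pmf {1..N} 0 (\<lambda>i. if i \<le> s then \<beta> else \<alpha>)) K) True" for s
  define \<eta> where "\<eta> = 1 / 2 ^ L + exp ((16 * real N - (W - wmax)) / wmax)"
  have "\<bar>h s - h 0\<bar> \<le> real s * \<eta>" if "s \<le> N" for s
    using that
  proof (induction s)
    case (Suc s)
    have "\<bar>h s - h (Suc s)\<bar> \<le> \<eta>"
      unfolding h_def K_def \<eta>_def using assms Suc.prems
      by (intro hybrid_step[where j = "Suc s"]) auto
    moreover have "\<bar>h s - h 0\<bar> \<le> real s * \<eta>" using Suc by simp
    moreover have "real (Suc s) * \<eta> = real s * \<eta> + \<eta>" by (simp add: algebra_simps)
    ultimately show ?case by linarith
  qed simp
  from this[of N] have "\<bar>h N - h 0\<bar> \<le> real N * \<eta>" by simp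
  moreover have "Pi_pmf {1..N} 0 (\<lambda>i. if i \<le> 0 then \<beta> else \<alpha>) = Pi_pmf {1..N} 0 (\<lambda>_. \<alpha>)"
    by (intro Pi_pmf_cong) auto
  moreover have "Pi_pmf {1..N} 0 (\<lambda>i. if i \<le> N then \<beta> else \<alpha>) = Pi_pmf {1..N} 0 (\<lambda>_. \<beta>)"
    by (intro Pi_pmf_cong) auto
  ultimately show ?thesis unfolding h_def \<eta>_def by (simp add: abs_minus_commute)
qed

section \<open>Two laws with equal moments\<close>

text \<open>The barycentric weights of Lagrange interpolation. Summing
  \<open>f x * node_weight X x\<close> over \<open>X\<close> gives the divided difference of
  \<open>f\<close>, which annihilates polynomials of degree below \<open>card X - 1\<close>.\<close>

definition node_weight :: "real set \<Rightarrow> real \<Rightarrow> real" where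
  "node_weight X x = 1 / (\<Prod>y\<in>X - {x}. x - y)"

lemma sum_node_weight_mult:
  assumes "finite X" "z \<in> X"
  shows "(\<Sum>x\<in>X. g x * (x - z) * node_weight X x) = (\<Sum>x\<in>X - {z}. g x * node_weight (X - {z}) x)"
proof -
  have "(\<Sum>x\<in>X. g x * (x - z) * node_weight X x) =
      (\<Sum>x\<in>X - {z}. g x * (x - z) * node_weight X x)"
    using assms by (subst sum.remove[of X z]) auto
  also have "\<dots> = (\<Sum>x\<in>X - {z}. g x * node_weight (X - {z}) x)"
  proof (rule sum.cong[OF refl])
    fix x assume x: "x \<in> X - {z}"
    have "(\<Prod>y\<in>X - {x}. x - y) = (x - z) * (\<Prod>y\<in>X - {x} - {z}. x - y)"
      using assms x by (intro prod.remove) auto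
    moreover have "X - {x} - {z} = X - {z} - {x}" by auto
    ultimately show "g x * (x - z) * node_weight X x = g x * node_weight (X - {z}) x"
      using x by (simp add: node_weight_def)
  qed
  finally show ?thesis .
qed

text \<open>Divided differences: the recursion is \<open>x = z + (x - z)\<close>.\<close>

lemma node_weight_step:
  assumes "finite X" "z \<in> X"
  shows "(\<Sum>x\<in>X. x ^ Suc i * node_weight X x) =
    z * (\<Sum>x\<in>X. x ^ i * node_weight X x) + (\<Sum>x\<in>X - {z}. x ^ i * node_weight (X - {z}) x)"
proof -
  have "(\<Sum>x\<in>X. x ^ Suc i * node_weight X x) - z * (\<Sum>x\<in>X. x ^ i * node_weight X x) =
      (\<Sum>x\<in>X. x ^ i * (x - z) * node_weight X x)"
    by (simp add: sum_distrib_left sum_subtractf[symmetric] algebra_simps)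
  then show ?thesis using sum_node_weight_mult[OF assms, of "\<lambda>x. x ^ i"] by simp
qed

lemma node_weight_moments:
  assumes "finite X" "i + 2 \<le> card X"
  shows "(\<Sum>x\<in>X. x ^ i * node_weight X x) = 0"
  using assms
proof (induction "card X" arbitrary: X i rule: less_induct)
  case less
  \<comment> \<open>Removing either of two distinct nodes \<open>z\<close>, \<open>z'\<close> leaves
    the same sum (1 for two nodes, 0 by induction for more), so the two instances of the recursion
    differ by \<open>(z - z')\<close> times the wanted sum.\<close>
  have zero: "(\<Sum>x\<in>X. node_weight X x) = 0"
  proof -
    obtain z z' where z: "z \<in> X" "z' \<in> X" "z \<noteq> z'"
      using less.prems by (metis (no_types, opaque_lifting) add_leE card_le_Suc0_iff_eq not_less_eq_eq numeral_2_eq_2)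
    have sing: "(\<Sum>x\<in>{a}. node_weight {a} x) = 1" for a by (simp add: node_weight_def)
    have "(\<Sum>x\<in>X - {z}. node_weight (X - {z}) x) = (\<Sum>x\<in>X - {z'}. node_weight (X - {z'}) x)"
    proof (cases "card X = 2")
      case True
      then have "X = {z, z'}" using z less.prems(1)
        by (metis card_2_iff doubleton_eq_iff insert_absorb insert_iff singletonD)
      then have "X - {z} = {z'}" "X - {z'} = {z}" using z by auto
      then show ?thesis using sing by metis
    next
      case False
      have "(\<Sum>x\<in>X - {a}. x ^ 0 * node_weight (X - {a}) x) = 0" if "a \<in> X" for a
        using False that less.prems by (intro less.hyps) (auto simp: card_Diff_singleton)
      then show ?thesis using z by simp
    qed
    then have "(z - z') * (\<Sum>x\<in>X. node_weight X x) = 0"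
      using node_weight_step[OF less.prems(1) z(1), of 0] node_weight_step[OF less.prems(1) z(2), of 0]
      by (simp add: algebra_simps)
    then show ?thesis using z by simp
  qed
  show ?case
    using less.prems(2)
  proof (induction i)
    case 0
    then show ?case using zero by simp
  next
    case (Suc i)
    then have "X \<noteq> {}" by auto
    then obtain z where z: "z \<in> X" by blast
    have "(\<Sum>x\<in>X - {z}. x ^ i * node_weight (X - {z}) x) = 0"
      using Suc.prems z less.prems(1) by (intro less.hyps) (auto simp: card_Diff_singleton)
    then show ?case using node_weight_step[OF less.prems(1) z, of i] Suc by simp
  qed
qed

section \<open>Estimates for square-spaced nodes\<close>

text \<open>Factoring each difference of squares gives \<open>(j - 1)! (L - j)!\<close> from the
  differences and \<open>(L + j)! / (j! * 2 j)\<close> from the sums.\<close>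

lemma prod_dist_squares:
  assumes "1 \<le> j" "j \<le> L"
  shows "(\<Prod>i\<in>{1..L} - {j}. \<bar>(real i)\<^sup>2 - (real j)\<^sup>2\<bar>) * (2 * (real j)\<^sup>2) = fact (L - j) * fact (L + j)"
proof -
  have 1: "(\<Prod>i\<in>{1..<j}. \<bar>real i - real j\<bar>) = fact (j - 1)"
  proof -
    have "(\<Prod>i\<in>{1..<j}. \<bar>real i - real j\<bar>) = (\<Prod>i\<in>{1..<j}. \<bar>real (j + 1 - Suc i) - real j\<bar>)"
      by (rule prod.atLeastLessThan_rev)
    also have "\<dots> = (\<Prod>i\<in>{1..<j}. real i)" by (intro prod.cong) (auto simp: of_nat_diff)
    also have "\<dots> = fact (j - 1)"
    proof -
      have "{1..<j} = {1..j - 1}" using assms by auto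
      then show ?thesis by (simp add: fact_prod)
    qed
    finally show ?thesis .
  qed
  have 2: "(\<Prod>i\<in>{1..L} - {j}. \<bar>real i - real j\<bar>) = fact (j - 1) * fact (L - j)"
    using assms(2)
  proof (induction rule: dec_induct)
    case base
    have "{1..j} - {j} = {1..<j}" by auto
    then show ?case using 1 by simp
  next
    case (step l)
    have "{1..Suc l} - {j} = insert (Suc l) ({1..l} - {j})" using step.hyps by auto
    then have "(\<Prod>i\<in>{1..Suc l} - {j}. \<bar>real i - real j\<bar>) =
        \<bar>real (Suc l) - real j\<bar> * (fact (j - 1) * fact (l - j))"
      using step.IH by simp
    moreover have "Suc l - j = Suc (l - j)" using step.hyps by auto
    moreover have "\<bar>real (Suc l) - real j\<bar> = real (Suc (l - j))" using step.hyps by (simp add: of_nat_diff)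
    ultimately show ?case by (simp only: fact_Suc) (simp add: mult_ac)
  qed
  have 3: "(\<Prod>i\<in>{1..l}. real i + real j) * fact j = fact (l + j)" for l
  proof (induction l)
    case (Suc l)
    have "(\<Prod>i\<in>{1..Suc l}. real i + real j) * fact j =
        (real (Suc l) + real j) * ((\<Prod>i\<in>{1..l}. real i + real j) * fact j)" by simp
    also have "\<dots> = fact (Suc l + j)" unfolding Suc.IH by simp
    finally show ?case .
  qed simp
  have 4: "(\<Prod>i\<in>{1..L}. real i + real j) = (real j + real j) * (\<Prod>i\<in>{1..L} - {j}. real i + real j)"
    using assms by (intro prod.remove) auto
  have 5: "fact j = real j * fact (j - 1)" using assms by (simp add: fact_reduce)
  have "(\<Prod>i\<in>{1..L} - {j}. \<bar>(real i)\<^sup>2 - (real j)\<^sup>2\<bar>) =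
      (\<Prod>i\<in>{1..L} - {j}. \<bar>real i - real j\<bar> * (real i + real j))"
  proof (rule prod.cong[OF refl])
    fix i
    have "(real i)\<^sup>2 - (real j)\<^sup>2 = (real i - real j) * (real i + real j)"
      by (simp add: power2_eq_square algebra_simps)
    then show "\<bar>(real i)\<^sup>2 - (real j)\<^sup>2\<bar> = \<bar>real i - real j\<bar> * (real i + real j)"
      by (simp add: abs_mult)
  qed
  also have "\<dots> = fact (j - 1) * fact (L - j) * (\<Prod>i\<in>{1..L} - {j}. real i + real j)"
    by (simp only: prod.distrib 2)
  finally have "(\<Prod>i\<in>{1..L} - {j}. \<bar>(real i)\<^sup>2 - (real j)\<^sup>2\<bar>) * (2 * (real j)\<^sup>2) =
      fact (L - j) * ((2 * real j * (\<Prod>i\<in>{1..L} - {j}. real i + real j)) * (real j * fact (j - 1)))"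
    by (simp add: power2_eq_square mult_ac)
  also have "\<dots> = fact (L - j) * ((\<Prod>i\<in>{1..L}. real i + real j) * fact j)"
    unfolding 4 5 by simp
  finally show ?thesis using 3[of L] by simp
qed

lemma fact_square_le:
  assumes "j \<le> L"
  shows "(fact L :: real)\<^sup>2 \<le> fact (L - j) * fact (L + j)"
  using assms
proof (induction j)
  case (Suc j)
  have "(fact L :: real)\<^sup>2 \<le> fact (L - j) * fact (L + j)" using Suc by simp
  also have "\<dots> = fact (L - Suc j) * (real (L - j) * fact (L + j))"
    using Suc.prems by (simp add: fact_reduce[of "L - j"])
  also have "\<dots> \<le> fact (L - Suc j) * (real (Suc (L + j)) * fact (L + j))"
    by (intro mult_left_mono mult_right_mono) auto
  also have "\<dots> = fact (L - Suc j) * fact (L + Suc j)" by simp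
  finally show ?case .
qed (simp add: power2_eq_square)

text \<open>The product equals \<open>2 (L!)^2 / ((L - j)! (L + j)!)\<close>. The bound is uniform
  in \<open>L\<close>, whereas equally spaced nodes would produce the binomial coefficient
  \<open>L choose j\<close>.\<close>

lemma prod_square_ratio_le:
  assumes "1 \<le> j" "j \<le> L"
  shows "(\<Prod>i\<in>{1..L} - {j}. (real i)\<^sup>2 / \<bar>(real i)\<^sup>2 - (real j)\<^sup>2\<bar>) \<le> 2"
proof -
  define P where "P = (\<Prod>i\<in>{1..L} - {j}. \<bar>(real i)\<^sup>2 - (real j)\<^sup>2\<bar>)"
  have P: "0 < P"
    unfolding P_def by (intro prod_pos) auto
  have "(fact L :: real)\<^sup>2 = (\<Prod>i\<in>{1..L}. (real i)\<^sup>2)"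
    by (simp add: fact_prod prod_power_distrib)
  also have "\<dots> = (real j)\<^sup>2 * (\<Prod>i\<in>{1..L} - {j}. (real i)\<^sup>2)"
    using assms by (intro prod.remove) auto
  finally have "(real j)\<^sup>2 * (\<Prod>i\<in>{1..L} - {j}. (real i)\<^sup>2) \<le> P * (2 * (real j)\<^sup>2)"
    using prod_dist_squares[OF assms] fact_square_le[OF assms(2)] unfolding P_def by simp
  then have "(real j)\<^sup>2 * (\<Prod>i\<in>{1..L} - {j}. (real i)\<^sup>2) \<le> (real j)\<^sup>2 * (2 * P)" by (simp add: mult_ac)
  then have "(\<Prod>i\<in>{1..L} - {j}. (real i)\<^sup>2) \<le> 2 * P"
    using assms by (subst (asm) mult_le_cancel_left_pos) auto
  then show ?thesis using P unfolding prod_dividef P_def[symmetric] by (simp add: divide_le_eq)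
qed

text \<open>The constant 1/2 does not reproduce itself in an induction on \<open>L\<close>; a bound
  decreasing to 1/2 does. The limit of the product is 2/\<pi>, by Wallis.\<close>

lemma prod_half_le: "1 / 2 \<le> (\<Prod>j\<in>{1..L}. 1 - 1 / (4 * (real j)\<^sup>2))"
proof -
  have "(real L + 2) / (2 * (real L + 1)) \<le> (\<Prod>j\<in>{1..L}. 1 - 1 / (4 * (real j)\<^sup>2))"
  proof (induction L)
    case (Suc L)
    define l where "l = real L + 1"
    have l: "1 \<le> l" by (simp add: l_def)
    have l2: "1 \<le> l\<^sup>2" using l by simp
    have "2 * l + 1 \<le> 3 * l\<^sup>2"
    proof -
      have "l * 1 \<le> l * l" using l by (intro mult_left_mono) auto
      then show ?thesis using l unfolding power2_eq_square by linarith
    qed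
    then have "4 * l ^ 3 * (l + 2) \<le> (l + 1)\<^sup>2 * (4 * l\<^sup>2 - 1)"
      by (simp add: power2_eq_square power3_eq_cube algebra_simps)
    then have "(l + 2) / (2 * (l + 1)) \<le> (l + 1) / (2 * l) * (1 - 1 / (4 * l\<^sup>2))"
      using l by (simp add: field_simps power2_eq_square power3_eq_cube)
    also have "\<dots> \<le> (\<Prod>j\<in>{1..L}. 1 - 1 / (4 * (real j)\<^sup>2)) * (1 - 1 / (4 * l\<^sup>2))"
    proof (rule mult_right_mono)
      show "(l + 1) / (2 * l) \<le> (\<Prod>j\<in>{1..L}. 1 - 1 / (4 * (real j)\<^sup>2))"
        using Suc by (simp add: l_def add.assoc)
      show "0 \<le> 1 - 1 / (4 * l\<^sup>2)" using l2 by (simp add: divide_le_eq)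
    qed
    also have "\<dots> = (\<Prod>j\<in>{1..Suc L}. 1 - 1 / (4 * (real j)\<^sup>2))"
      by (simp add: l_def add.commute)
    finally show ?case by (simp add: l_def algebra_simps)
  qed simp
  moreover have "1 / 2 \<le> (real L + 2) / (2 * (real L + 1))" by (simp add: field_simps)
  ultimately show ?thesis by linarith
qed

lemma sum_inverse_squares_le: "(\<Sum>j\<in>{1..L}. 1 / (real j)\<^sup>2) \<le> 2"
proof -
  have "(\<Sum>j\<in>{1..L}. 1 / (real j)\<^sup>2) \<le> 2 - 1 / real L"
  proof (induction L)
    case (Suc L)
    show ?case
    proof (cases "L = 0")
      case False
      have "1 / (real L + 1)\<^sup>2 \<le> 1 / real L - 1 / (real L + 1)"
      proof -
        have "1 / (real L + 1)\<^sup>2 \<le> 1 / (real L * (real L + 1))"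
          using False by (intro divide_left_mono) (auto simp: power2_eq_square)
        also have "\<dots> = 1 / real L - 1 / (real L + 1)" using False by (simp add: field_simps)
        finally show ?thesis .
      qed
      then show ?thesis using Suc by (simp add: add.commute)
    qed simp
  qed simp
  then show ?thesis by (smt (verit) divide_nonneg_nonneg of_nat_0_le_iff)
qed

text \<open>Dividing by the weight at 0 gives the nodes 0 and 1 opposite signs: the positive part,
  the future \<alpha>, avoids 1, and the negative part, the future \<beta>, avoids 0. The last
  formula measures what leaks to the larger nodes.\<close>

lemma node_weight_ratio:
  assumes "finite Y" "\<forall>y\<in>Y. 1 < y"
  defines "X \<equiv> insert 0 (insert 1 Y)"
  shows "node_weight X 0 \<noteq> 0"
    "node_weight X 1 / node_weight X 0 < 0"
    "z \<in> Y \<Longrightarrow> \<bar>node_weight X z / node_weight X 0\<bar> = 1 / (z - 1) * (\<Prod>y\<in>Y - {z}. y / \<bar>y - z\<bar>)"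
proof -
  have notin: "0 \<notin> Y" "1 \<notin> Y" using assms(2) by force+
  have X0: "X - {0} = insert 1 Y" and X1: "X - {1} = insert 0 Y" using notin by (auto simp: X_def)
  have w0: "node_weight X 0 = 1 / (- (\<Prod>y\<in>Y. - y))"
    unfolding node_weight_def X0 using assms(1) notin by simp
  have w1: "node_weight X 1 = 1 / (\<Prod>y\<in>Y. 1 - y)"
    unfolding node_weight_def X1 using assms(1) notin by simp
  have nz: "(\<Prod>y\<in>Y. - y) \<noteq> 0" using assms(1) notin by simp
  show "node_weight X 0 \<noteq> 0" using nz by (simp add: w0)
  have "node_weight X 1 / node_weight X 0 = - (\<Prod>y\<in>Y. (- y) / (1 - y))"
    unfolding prod_dividef using nz by (simp add: w0 w1)
  moreover have "0 < (\<Prod>y\<in>Y. (- y) / (1 - y))"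
    by (intro prod_pos) (use assms(2) in \<open>auto simp: zero_less_divide_iff divide_less_0_iff\<close>)
  ultimately show "node_weight X 1 / node_weight X 0 < 0" by simp
  assume z: "z \<in> Y"
  have Xz: "X - {z} = insert 0 (insert 1 (Y - {z}))" using notin z by (auto simp: X_def)
  have wz: "node_weight X z = 1 / (z * ((z - 1) * (\<Prod>y\<in>Y - {z}. z - y)))"
    unfolding node_weight_def Xz using assms(1) notin by simp
  have p: "(\<Prod>y\<in>Y. - y) = - z * (\<Prod>y\<in>Y - {z}. - y)"
    using assms(1) z by (rule prod.remove)
  have z1: "1 < z" using assms(2) z by blast
  have "node_weight X z / node_weight X 0 = 1 / (z - 1) * (\<Prod>y\<in>Y - {z}. (- y) / (z - y))"
    unfolding w0 wz p prod_dividef using z1 by simp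
  also have "\<bar>\<dots>\<bar> = 1 / (z - 1) * (\<Prod>y\<in>Y - {z}. y / \<bar>y - z\<bar>)"
  proof -
    have "\<bar>(- y) / (z - y)\<bar> = y / \<bar>y - z\<bar>" if "y \<in> Y - {z}" for y
      using assms(2) that by (auto simp: abs_minus_commute)
    then have "(\<Prod>y\<in>Y - {z}. \<bar>(- y) / (z - y)\<bar>) = (\<Prod>y\<in>Y - {z}. y / \<bar>y - z\<bar>)"
      by (rule prod.cong[OF refl])
    then show ?thesis using z1 by (simp only: abs_mult abs_prod) simp
  qed
  finally show "\<bar>node_weight X z / node_weight X 0\<bar> = 1 / (z - 1) * (\<Prod>y\<in>Y - {z}. y / \<bar>y - z\<bar>)" .
qed

text \<open>The nodes are 0, 1, \<open>B\<close> and \<open>4 B j\<^sup>2\<close> for \<open>1 \<le> j \<le> L\<close>. The square spacing keeps the largest node of order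
  \<open>B L\<^sup>2\<close>, and the node \<open>B\<close> makes the weights decay fast enough for a bounded mean.\<close>

lemma exists_signed_measure:
  fixes B :: real
  assumes "4 \<le> B" "1 \<le> L"
  shows "\<exists>X v. finite X \<and> X \<subseteq> {0..4 * B * (real L)\<^sup>2} \<and> 0 \<in> X \<and> 1 \<in> X \<and> v 0 = 1 \<and> v 1 < 0 \<and>
    (\<forall>i\<le>L. (\<Sum>x\<in>X. x ^ i * v x) = 0) \<and>
    (\<Sum>x\<in>X - {0, 1}. \<bar>v x\<bar>) \<le> 4 / B \<and> (\<Sum>x\<in>X - {0, 1}. x * \<bar>v x\<bar>) \<le> 7"
proof -
  define sq where "sq j = 4 * B * (real j)\<^sup>2" for j :: nat
  have sqB: "4 * B \<le> sq j" if "1 \<le> j" for j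
    using that assms(1) by (simp add: sq_def)
  have inj: "inj_on sq {1..L}"
    using assms(1) by (intro inj_onI) (auto simp: sq_def)
  define Y where "Y = insert B (sq ` {1..L})"
  have Bn: "B \<notin> sq ` {1..L}" using sqB assms(1) by fastforce
  have Y: "finite Y" "\<forall>y\<in>Y. 1 < y"
    using sqB assms(1) by (fastforce simp: Y_def)+
  define X where "X = insert 0 (insert 1 Y)"
  define v where "v x = node_weight X x / node_weight X 0" for x
  note ratio = node_weight_ratio[OF Y, folded X_def, folded v_def]
  have notin: "0 \<notin> Y" "1 \<notin> Y" using Y(2) by force+
  have XY: "X - {0, 1} = Y" using notin by (auto simp: X_def)
  have "card (sq ` {1..L}) = L" unfolding card_image[OF inj] by simp
  then have cardX: "card X = L + 3" using Y(1) notin Bn by (simp add: X_def Y_def)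
  have L2: "1 \<le> (real L)\<^sup>2" using assms(2) by simp
  have sub: "X \<subseteq> {0..4 * B * (real L)\<^sup>2}"
  proof
    have BL: "4 * B \<le> 4 * B * (real L)\<^sup>2" using L2 assms(1) by simp
    fix x assume "x \<in> X"
    then consider "x \<in> {0, 1, B}" | j where "x = sq j" "j \<in> {1..L}" by (auto simp: X_def Y_def)
    then show "x \<in> {0..4 * B * (real L)\<^sup>2}"
    proof cases
      case 1
      moreover have "0 \<le> B" "1 \<le> 4 * B * (real L)\<^sup>2" "B \<le> 4 * B * (real L)\<^sup>2"
        using BL assms(1) by linarith+
      ultimately show ?thesis by auto
    next
      case 2
      then show ?thesis using assms(1) by (auto simp: sq_def intro!: mult_left_mono power_mono)
    qed
  qed
  have mom: "(\<Sum>x\<in>X. x ^ i * v x) = 0" if "i \<le> L" for i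
    using node_weight_moments[of X i] that cardX Y(1)
    by (simp add: v_def X_def sum_divide_distrib[symmetric])
  have vB: "\<bar>v B\<bar> \<le> 2 / (B - 1)"
  proof -
    have YB: "Y - {B} = sq ` {1..L}" using Bn by (auto simp: Y_def)
    have "B \<in> Y" by (simp add: Y_def)
    from ratio(3)[OF this] have "\<bar>v B\<bar> = 1 / (B - 1) * (\<Prod>j\<in>{1..L}. sq j / \<bar>sq j - B\<bar>)"
      unfolding YB prod.reindex[OF inj] o_def .
    \<comment> \<open>Scaling the nodes by \<open>B\<close> makes these factors independent of
      \<open>B\<close>, and the 4 in \<open>sq\<close> keeps them summably close to 1.\<close>
    also have "(\<Prod>j\<in>{1..L}. sq j / \<bar>sq j - B\<bar>) = (\<Prod>j\<in>{1..L}. inverse (1 - 1 / (4 * (real j)\<^sup>2)))"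
    proof (rule prod.cong[OF refl])
      fix j assume j: "j \<in> {1..L}"
      have "B < sq j" using sqB[of j] j assms(1) by simp
      then show "sq j / \<bar>sq j - B\<bar> = inverse (1 - 1 / (4 * (real j)\<^sup>2))"
        using j assms(1) by (simp add: sq_def field_simps)
    qed
    also have "\<dots> = inverse (\<Prod>j\<in>{1..L}. 1 - 1 / (4 * (real j)\<^sup>2))" 
      using prod_inversef[of "\<lambda>j. 1 - 1 / (4 * (real j)\<^sup>2)" "{1..L}"] by (simp only: o_def)
    also have "1 / (B - 1) * \<dots> \<le> 1 / (B - 1) * 2"
      using prod_half_le[of L] assms(1) le_imp_inverse_le[OF prod_half_le[of L]]
      by (intro mult_left_mono) auto
    finally show ?thesis by simp
  qed
  \<comment> \<open>The node \<open>B\<close> contributes the factor \<open>B / (sq j - B)\<close>.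
    Without it the decay would be \<open>1 / sq j\<close>, and the mean would pick up a bounded
    amount from each of the \<open>L\<close> nodes.\<close>
  have vsq: "\<bar>v (sq j)\<bar> \<le> 8 * B / (sq j)\<^sup>2" if j: "j \<in> {1..L}" for j
  proof -
    have YJ: "Y - {sq j} = insert B (sq ` ({1..L} - {j}))"
    proof -
      have "Y - {sq j} = insert B (sq ` {1..L} - sq ` {j})" using Bn j unfolding Y_def by blast
      also have "sq ` {1..L} - sq ` {j} = sq ` ({1..L} - {j})"
        using j by (intro inj_on_image_set_diff[OF inj, symmetric]) auto
      finally show ?thesis .
    qed
    have inj': "inj_on sq ({1..L} - {j})" using inj by (rule inj_on_subset) auto
    have s: "4 * B \<le> sq j" using sqB j by simp
    have "sq j \<in> Y" using j by (simp add: Y_def)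
    from ratio(3)[OF this] have "\<bar>v (sq j)\<bar> =
        1 / (sq j - 1) * (B / (sq j - B) * (\<Prod>i\<in>{1..L} - {j}. sq i / \<bar>sq i - sq j\<bar>))"
    proof -
      have "(\<Prod>y\<in>insert B (sq ` ({1..L} - {j})). y / \<bar>y - sq j\<bar>) =
          B / \<bar>B - sq j\<bar> * (\<Prod>y\<in>sq ` ({1..L} - {j}). y / \<bar>y - sq j\<bar>)"
        using Bn by (intro prod.insert) auto
      also have "(\<Prod>y\<in>sq ` ({1..L} - {j}). y / \<bar>y - sq j\<bar>) =
          (\<Prod>i\<in>{1..L} - {j}. sq i / \<bar>sq i - sq j\<bar>)"
        unfolding prod.reindex[OF inj'] o_def ..
      also have "\<bar>B - sq j\<bar> = sq j - B" using s assms(1) by simp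
      finally show "\<bar>v (sq j)\<bar> = 1 / (sq j - 1) * (\<Prod>y\<in>Y - {sq j}. y / \<bar>y - sq j\<bar>) \<Longrightarrow> ?thesis"
        unfolding YJ by simp
    qed
    also have "(\<Prod>i\<in>{1..L} - {j}. sq i / \<bar>sq i - sq j\<bar>) =
        (\<Prod>i\<in>{1..L} - {j}. (real i)\<^sup>2 / \<bar>(real i)\<^sup>2 - (real j)\<^sup>2\<bar>)"
    proof (rule prod.cong[OF refl])
      fix i
      have "\<bar>sq i - sq j\<bar> = 4 * B * \<bar>(real i)\<^sup>2 - (real j)\<^sup>2\<bar>"
        using assms(1) by (simp add: sq_def right_diff_distrib[symmetric] abs_mult)
      then show "sq i / \<bar>sq i - sq j\<bar> = (real i)\<^sup>2 / \<bar>(real i)\<^sup>2 - (real j)\<^sup>2\<bar>"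
        using assms(1) by (simp add: sq_def)
    qed
    \<comment> \<open>Both 1 and \<open>B\<close> are at most half of \<open>sq j\<close>.\<close>
    also have "1 / (sq j - 1) * (B / (sq j - B) * \<dots>) \<le> 1 / (sq j / 2) * (B / (sq j / 2) * 2)"
    proof (rule mult_mono)
      have p0: "0 \<le> (\<Prod>i\<in>{1..L} - {j}. (real i)\<^sup>2 / \<bar>(real i)\<^sup>2 - (real j)\<^sup>2\<bar>)"
        by (intro prod_nonneg) auto
      show "1 / (sq j - 1) \<le> 1 / (sq j / 2)" using s assms(1) by (intro divide_left_mono) auto
      show "B / (sq j - B) * (\<Prod>i\<in>{1..L} - {j}. (real i)\<^sup>2 / \<bar>(real i)\<^sup>2 - (real j)\<^sup>2\<bar>) \<le>
          B / (sq j / 2) * 2"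
        using s assms(1) j p0 prod_square_ratio_le[of j L]
        by (intro mult_mono divide_left_mono) auto
      show "0 \<le> B / (sq j - B) * (\<Prod>i\<in>{1..L} - {j}. (real i)\<^sup>2 / \<bar>(real i)\<^sup>2 - (real j)\<^sup>2\<bar>)"
        using s assms(1) p0 by (intro mult_nonneg_nonneg) auto
    qed (use s assms(1) in auto)
    also have "\<dots> = 8 * B / (sq j)\<^sup>2" by (simp add: power2_eq_square)
    finally show ?thesis .
  qed
  have sumY: "(\<Sum>x\<in>Y. g x) = g B + (\<Sum>j\<in>{1..L}. g (sq j))" for g :: "real \<Rightarrow> real"
  proof -
    have "(\<Sum>x\<in>Y. g x) = g B + (\<Sum>x\<in>sq ` {1..L}. g x)"
      unfolding Y_def using Bn by (intro sum.insert) auto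
    then show ?thesis unfolding sum.reindex[OF inj] o_def .
  qed
  have B1: "2 / (B - 1) \<le> 3 / B" using assms(1) by (simp add: field_simps)
  have "(\<Sum>x\<in>Y. \<bar>v x\<bar>) \<le> 3 / B + (\<Sum>j\<in>{1..L}. 1 / (2 * B) * (1 / (real j)\<^sup>2))"
    unfolding sumY
  proof (intro add_mono sum_mono)
    show "\<bar>v B\<bar> \<le> 3 / B" using vB B1 by simp
    fix j assume j: "j \<in> {1..L}"
    have "\<bar>v (sq j)\<bar> \<le> 8 * B / (sq j)\<^sup>2" by (rule vsq[OF j])
    also have "\<dots> = 1 / (2 * B) * (1 / (real j)\<^sup>2) * (1 / (real j)\<^sup>2)"
      using j assms(1) by (simp add: sq_def power2_eq_square)
    also have "\<dots> \<le> 1 / (2 * B) * (1 / (real j)\<^sup>2) * 1"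
      using j assms(1) by (intro mult_left_mono) auto
    finally show "\<bar>v (sq j)\<bar> \<le> 1 / (2 * B) * (1 / (real j)\<^sup>2)" by simp
  qed
  also have "\<dots> = 3 / B + 1 / (2 * B) * (\<Sum>j\<in>{1..L}. 1 / (real j)\<^sup>2)"
    by (simp only: sum_distrib_left)
  also have "\<dots> \<le> 3 / B + 1 / (2 * B) * 2"
    using assms(1) sum_inverse_squares_le by (intro add_left_mono mult_left_mono) auto
  also have "\<dots> = 4 / B" using assms(1) by (simp add: field_simps)
  finally have R: "(\<Sum>x\<in>Y. \<bar>v x\<bar>) \<le> 4 / B" .
  have "(\<Sum>x\<in>Y. x * \<bar>v x\<bar>) \<le> 3 + (\<Sum>j\<in>{1..L}. 2 * (1 / (real j)\<^sup>2))"
    unfolding sumY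
  proof (intro add_mono sum_mono)
    have "B * \<bar>v B\<bar> \<le> B * (3 / B)" using vB B1 assms(1) by (intro mult_left_mono) auto
    then show "B * \<bar>v B\<bar> \<le> 3" using assms(1) by simp
    fix j assume j: "j \<in> {1..L}"
    have "sq j * \<bar>v (sq j)\<bar> \<le> sq j * (8 * B / (sq j)\<^sup>2)"
      using vsq[OF j] sqB[of j] j assms(1) by (intro mult_left_mono) auto
    also have "\<dots> = 2 * (1 / (real j)\<^sup>2)"
      using j assms(1) by (simp add: sq_def power2_eq_square)
    finally show "sq j * \<bar>v (sq j)\<bar> \<le> 2 * (1 / (real j)\<^sup>2)" .
  qed
  also have "\<dots> = 3 + 2 * (\<Sum>j\<in>{1..L}. 1 / (real j)\<^sup>2)"
    by (simp only: sum_distrib_left)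
  also have "\<dots> \<le> 7" using sum_inverse_squares_le[of L] by simp
  finally have M: "(\<Sum>x\<in>Y. x * \<bar>v x\<bar>) \<le> 7" .
  have "v 0 = 1" using ratio(1) by (simp add: v_def)
  moreover have "finite X" "0 \<in> X" "1 \<in> X" using Y by (auto simp: X_def)
  ultimately show ?thesis
    using sub ratio(2) mom R M XY by (intro exI[of _ X] exI[of _ v]) auto
qed

text \<open>\<alpha> and \<beta> are the positive and negative parts of the signed measure, of equal
  mass by the zeroth moment. This mass is at least \<open>v 0 = 1\<close>, so normalising does not
  increase the leaked mass or the mean.\<close>

lemma exists_matching_laws:
  fixes B :: real
  assumes "4 \<le> B" "1 \<le> L"
  shows "\<exists>\<alpha> \<beta>. bounded_law (4 * B * (real L)\<^sup>2) \<alpha> \<and> bounded_law (4 * B * (real L)\<^sup>2) \<beta> \<and>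
    (\<forall>i\<le>L. measure_pmf.expectation \<alpha> (\<lambda>x. x ^ i) = measure_pmf.expectation \<beta> (\<lambda>x. x ^ i)) \<and>
    measure_pmf.prob \<alpha> {x. x \<noteq> 0} \<le> 4 / B \<and> measure_pmf.prob \<beta> {x. x \<noteq> 1} \<le> 4 / B"
proof -
  obtain X v where X: "finite X" "X \<subseteq> {0..4 * B * (real L)\<^sup>2}" "0 \<in> X" "1 \<in> X"
    and v: "v 0 = 1" "v 1 < 0" "\<forall>i\<le>L. (\<Sum>x\<in>X. x ^ i * v x) = 0"
      "(\<Sum>x\<in>X - {0, 1}. \<bar>v x\<bar>) \<le> 4 / B" "(\<Sum>x\<in>X - {0, 1}. x * \<bar>v x\<bar>) \<le> 7"
    using exists_signed_measure[OF assms] by (elim exE conjE) (rule that)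
  define P where "P x = max 0 (v x)" for x
  define Q where "Q x = max 0 (- v x)" for x
  have PQ: "P x - Q x = v x" "0 \<le> P x" "0 \<le> Q x" "P x \<le> \<bar>v x\<bar>" "Q x \<le> \<bar>v x\<bar>" for x
    by (auto simp: P_def Q_def)
  have momPQ: "(\<Sum>x\<in>X. x ^ i * P x) = (\<Sum>x\<in>X. x ^ i * Q x)" if "i \<le> L" for i
  proof -
    have "(\<Sum>x\<in>X. x ^ i * P x) - (\<Sum>x\<in>X. x ^ i * Q x) = (\<Sum>x\<in>X. x ^ i * v x)"
      by (simp add: sum_subtractf[symmetric] right_diff_distrib[symmetric] PQ(1))
    then show ?thesis using v(3) that by simp
  qed
  define Z where "Z = (\<Sum>x\<in>X. P x)"
  have ZQ: "Z = (\<Sum>x\<in>X. Q x)" using momPQ[of 0] by (simp add: Z_def)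
  have Z1: "1 \<le> Z"
    using member_le_sum[of 0 X P] X PQ v(1) by (simp add: Z_def P_def)
  define mk where "mk g = embed_pmf (\<lambda>x. if x \<in> X then g x / Z else 0)" for g
  have mk: "pmf (mk g) x = (if x \<in> X then g x / Z else 0)"
    if g: "\<And>x. 0 \<le> g x" "(\<Sum>x\<in>X. g x) = Z" for g x
  proof -
    let ?f = "\<lambda>x. if x \<in> X then g x / Z else 0"
    have nonneg: "0 \<le> ?f x" for x using g(1) Z1 by auto
    have "(\<integral>\<^sup>+ x. ennreal (?f x) \<partial>count_space UNIV) = (\<Sum>x\<in>X. ennreal (?f x))"
      using X(1) by (intro nn_integral_count_space'[of X]) auto
    also have "\<dots> = ennreal (\<Sum>x\<in>X. ?f x)" using nonneg by (intro sum_ennreal)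
    also have "(\<Sum>x\<in>X. ?f x) = 1"
      using g(2) Z1 by (simp add: sum_divide_distrib[symmetric])
    finally show ?thesis unfolding mk_def using nonneg by (intro pmf_embed_pmf) auto
  qed
  have set_mk: "set_pmf (mk g) \<subseteq> X" if "\<And>x. 0 \<le> g x" "(\<Sum>x\<in>X. g x) = Z" for g
    using mk[OF that] by (auto simp: set_pmf_iff split: if_splits)
  have ex: "measure_pmf.expectation (mk g) h = (\<Sum>x\<in>X. h x * g x) / Z"
    if "\<And>x. 0 \<le> g x" "(\<Sum>x\<in>X. g x) = Z" for g and h :: "real \<Rightarrow> real"
  proof -
    have "measure_pmf.expectation (mk g) h = (\<Sum>x\<in>X. h x * pmf (mk g) x)"
      using set_mk[OF that] X(1) by (intro integral_measure_pmf_real) auto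
    then show ?thesis using mk[OF that] by (simp add: sum_divide_distrib)
  qed
  have pr: "measure_pmf.prob (mk g) {x. x \<noteq> a} \<le> 4 / B"
    if g: "\<And>x. 0 \<le> g x" "(\<Sum>x\<in>X. g x) = Z" "\<And>x. g x \<le> \<bar>v x\<bar>" and a: "g (1 - a) = 0" "a \<in> {0, 1}" for g a
  proof -
    have "measure_pmf.prob (mk g) {x. x \<noteq> a} = measure_pmf.expectation (mk g) (indicator {x. x \<noteq> a})" by simp
    also have "\<dots> = (\<Sum>x\<in>X. indicator {x. x \<noteq> a} x * g x) / Z" by (rule ex[OF g(1,2)])
    also have "(\<Sum>x\<in>X. indicator {x. x \<noteq> a} x * g x) = (\<Sum>x\<in>X - {0, 1}. g x)"
      using X(1) a by (intro sum.mono_neutral_cong_right) (auto simp: indicator_def)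
    also have "\<dots> / Z \<le> (\<Sum>x\<in>X - {0, 1}. g x) / 1"
      using Z1 g(1) by (intro divide_left_mono sum_nonneg) auto
    also have "\<dots> \<le> (\<Sum>x\<in>X - {0, 1}. \<bar>v x\<bar>)" using g(3) by (simp add: sum_mono)
    finally show ?thesis using v(4) by simp
  qed
  \<comment> \<open>This serves both laws, since \<open>1 \<le> L\<close> makes the first moments
    agree.\<close>
  have mean: "(\<Sum>x\<in>X. x * P x) / Z \<le> 8"
  proof -
    have "(\<Sum>x\<in>X. x * P x) = (\<Sum>x\<in>X - {0, 1}. x * P x)"
      using X(1) v(2) by (intro sum.mono_neutral_right) (auto simp: P_def)
    also have "\<dots> \<le> (\<Sum>x\<in>X - {0, 1}. x * \<bar>v x\<bar>)"
      using X(2) PQ(4) by (intro sum_mono mult_left_mono) auto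
    also have "\<dots> \<le> 8 * Z" using v(5) Z1 by simp
    finally show ?thesis using Z1 by (simp add: divide_le_eq)
  qed
  have P: "\<And>x. 0 \<le> P x" "(\<Sum>x\<in>X. P x) = Z" and Q: "\<And>x. 0 \<le> Q x" "(\<Sum>x\<in>X. Q x) = Z"
    using PQ ZQ by (auto simp: Z_def)
  have "bounded_law (4 * B * (real L)\<^sup>2) (mk P)"
    unfolding bounded_law_def using set_mk[OF P] X mean ex[OF P, of "\<lambda>x. x"]
    by (auto intro: finite_subset)
  moreover have "bounded_law (4 * B * (real L)\<^sup>2) (mk Q)"
    unfolding bounded_law_def using set_mk[OF Q] X mean ex[OF Q, of "\<lambda>x. x"] momPQ[of 1] assms(2)
    by (auto intro: finite_subset)
  moreover have "measure_pmf.expectation (mk P) (\<lambda>x. x ^ i) = measure_pmf.expectation (mk Q) (\<lambda>x. x ^ i)"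
    if "i \<le> L" for i
    using ex[OF P] ex[OF Q] momPQ[OF that] by simp
  moreover have "measure_pmf.prob (mk P) {x. x \<noteq> 0} \<le> 4 / B"
    using PQ v(2) by (intro pr P) (auto simp: P_def)
  moreover have "measure_pmf.prob (mk Q) {x. x \<noteq> 1} \<le> 4 / B"
    using PQ v(1) by (intro pr Q) (auto simp: Q_def)
  ultimately show ?thesis by blast
qed

section \<open>Choice of parameters\<close>

text \<open>Up to a third of \<open>n\<close> consecutive binomial coefficients at least double, so
  the last one dominates the sum.\<close>

lemma binom_le_le_double:
  assumes "3 * k \<le> n"
  shows "binom_le n k \<le> 2 * (n choose k)"
  using assms
proof (induction k)
  case (Suc k)
  have "2 * (n choose k) * Suc k \<le> (n choose k) * (n - k)"
  proof -
    have "2 * Suc k \<le> n - k" using Suc.prems by simp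
    then have "(n choose k) * (2 * Suc k) \<le> (n choose k) * (n - k)" by (rule mult_le_mono2)
    then show ?thesis by (simp only: mult_ac)
  qed
  also have "\<dots> = (n choose Suc k) * Suc k"
    using binomial_absorb_comp[of n k] binomial_absorption[of k n] by (simp only: mult.commute)
  finally have "2 * (n choose k) \<le> (n choose Suc k)" by (simp only: mult_le_cancel2)
  then show ?case using Suc by (simp add: binom_le_def)
qed (simp add: binom_le_def)

lemma binom_le_mono:
  assumes "r \<le> n"
  shows "binom_le r k \<le> binom_le n k"
proof -
  have "r choose i \<le> n choose i" for i
    using assms
  proof (induction rule: dec_induct)
    case (step m)
    have "m choose i \<le> Suc m choose i" by (cases i) auto
    then show ?case using step.IH by linarith
  qed simp
  then show ?thesis unfolding binom_le_def by (intro sum_mono)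
qed

lemma binom_le_upper:
  assumes "0 < k" "k \<le> n"
  shows "real (binom_le n k) \<le> (exp 1 * (real n / real k)) ^ k"
proof -
  define x where "x = real k / real n"
  have x: "0 < x" "x \<le> 1" using assms by (auto simp: x_def)
  have "real (binom_le n k) * x ^ k \<le> (1 + x) ^ n"
    using x by (intro binom_le_power_le) auto
  also have "\<dots> \<le> exp x ^ n" using x by (intro power_mono exp_ge_add_one_self) auto
  also have "\<dots> = exp 1 ^ k"
    using assms by (simp add: exp_of_nat_mult[symmetric] x_def)
  finally have "real (binom_le n k) \<le> exp 1 ^ k / x ^ k" using x by (simp add: le_divide_eq)
  also have "\<dots> = (exp 1 * (real n / real k)) ^ k"
    by (simp add: x_def power_mult_distrib power_divide)
  finally show ?thesis .
qed

lemma parameter_bounds: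
  "\<exists>C>1. \<forall>n k. 0 < k \<longrightarrow> real k < real n / C \<longrightarrow>
    (let V = binom_le n k; r = nat \<lfloor>real n - log 2 (real (n choose k)) - 6\<rfloor>; d = binom_le r k;
         L = nat \<lceil>log 2 (4000 * real V)\<rceil> in
      d \<le> V \<and> ((real (40 * V) + 1)\<^sup>2 + real d * 2 ^ r) / 2 ^ n \<le> 1 / 16 \<and>
      (real n / (2 * real k)) ^ k \<le> real d \<and> real V \<le> (exp 1 * (real n / real k)) ^ k \<and>
      0 < log 2 (real V) \<and> log 2 (real V) \<le> 2 * (real k * log 2 (real n / real k)) \<and>
      real L \<le> 3 * log 2 (real V) \<and> 100 * real L ^ 3 \<le> real d)"
proof -
  have "\<forall>\<^sub>F y in at_top. 16 + 2 * log 2 (exp 1 * y) \<le> (y :: real)" by real_asymp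
  then obtain C1 where C1: "\<And>y. C1 \<le> y \<Longrightarrow> 16 + 2 * log 2 (exp 1 * y) \<le> (y :: real)"
    by (auto simp: eventually_at_top_linorder)
  have "\<forall>\<^sub>F x in at_top. 172800 * (log 2 x) ^ 3 \<le> (x :: real)" by real_asymp
  then obtain C2 where C2: "\<And>x. C2 \<le> x \<Longrightarrow> 172800 * (log 2 x) ^ 3 \<le> (x :: real)"
    by (auto simp: eventually_at_top_linorder)
  define C where "C = Max {C1, 2 * C2, 128}"
  have C: "C1 \<le> C" "2 * C2 \<le> C" "128 \<le> C" by (auto simp: C_def)
  show ?thesis
  proof (intro exI[of _ C] conjI allI impI)
    show "1 < C" using C by simp
    fix n k :: nat
    assume k: "0 < k" and kn: "real k < real n / C"
    define y where "y = real n / real k"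
    have n: "real n = real k * y" using k by (simp add: y_def)
    have yC: "C \<le> y" using kn k C by (simp add: y_def field_simps)
    have y: "128 \<le> y" "C1 \<le> y" "C2 \<le> y / 2" using yC C by linarith+
    have k1: "1 \<le> real k" using k by simp
    have "128 * real k \<le> y * real k" using y(1) by (intro mult_right_mono) auto
    then have kn3: "128 * k \<le> n" using n by (simp add: mult.commute flip: of_nat_le_iff[where 'a = real])
    then have "128 \<le> n" using k by simp
    define V where "V = binom_le n k"
    define x where "x = real n - log 2 (real (n choose k)) - 6"
    define r where "r = nat \<lfloor>x\<rfloor>"
    define d where "d = binom_le r k"
    define L where "L = nat \<lceil>log 2 (4000 * real V)\<rceil>"
    have ch: "0 < n choose k" using kn3 by simp
    have chV: "n choose k \<le> V" unfolding V_def binom_le_def by (rule member_le_sum) auto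
    have nV: "n \<le> V"
    proof -
      have "n choose 1 \<le> V" unfolding V_def binom_le_def using k by (intro member_le_sum) auto
      then show ?thesis by simp
    qed
    have V0: "0 < real V" "128 \<le> real V" using nV \<open>128 \<le> n\<close> by auto
    have Vup: "real V \<le> (exp 1 * y) ^ k"
      unfolding V_def y_def using k kn3 by (intro binom_le_upper) auto
    have ey: "1 < exp 1 * y"
    proof -
      have "1 * 1 < exp 1 * y" using y by (intro mult_strict_mono) auto
      then show ?thesis by simp
    qed
    have logV: "log 2 (real V) \<le> real k * log 2 (exp 1 * y)"
    proof -
      have "log 2 (real V) \<le> log 2 ((exp 1 * y) ^ k)" using V0 Vup by simp
      also have "\<dots> = real k * log 2 (exp 1 * y)" using ey by (simp add: log_nat_power)
      finally show ?thesis .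
    qed
    \<comment> \<open>\<open>C1\<close> is chosen for this: its inequality times \<open>k\<close>
      has \<open>n = k * y\<close> on the right. It yields both \<open>r \<ge> n / 2\<close> and the
      bound on collisions among \<open>40 * V + 1\<close> points.\<close>
    have key: "16 + 2 * log 2 (real V) \<le> real n"
    proof -
      have "16 * 1 \<le> 16 * real k" using k1 by simp
      then have "16 + 2 * log 2 (real V) \<le> real k * (16 + 2 * log 2 (exp 1 * y))"
        using logV by (simp add: algebra_simps)
      also have "\<dots> \<le> real k * y" using C1[OF y(2)] by (intro mult_left_mono) auto
      finally show ?thesis using n by simp
    qed
    have logch: "log 2 (real (n choose k)) \<le> log 2 (real V)" "0 \<le> log 2 (real (n choose k))"
      using ch chV V0 by (simp_all add: Suc_le_eq)
    have x: "real n / 2 + 1 \<le> x" "x \<le> real n" using key logch by (auto simp: x_def)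
    have r: "real n / 2 \<le> real r" "real r \<le> x" "r \<le> n" using x by (auto simp: r_def) linarith+
    have "d \<le> V" unfolding d_def V_def using r by (intro binom_le_mono)
    \<comment> \<open>The 6 in \<open>r\<close> is this factor 64. As
      \<open>d \<le> V \<le> 2 * (n choose k)\<close>, a factor 32 remains for the dependencies; the
      collisions get another 1/32.\<close>
    have "2 ^ r * (real (n choose k) * 64) \<le> 2 ^ n"
    proof -
      have "2 ^ r * (real (n choose k) * 64) = 2 powr (real r + (log 2 (real (n choose k)) + 6))"
        using ch by (simp add: powr_add powr_realpow)
      also have "\<dots> \<le> 2 powr real n" using r(2) by (intro powr_mono) (auto simp: x_def)
      finally show ?thesis by (simp add: powr_realpow)
    qed
    moreover have "real d \<le> 2 * real (n choose k)"
      using \<open>d \<le> V\<close> binom_le_le_double[of k n] kn3 unfolding V_def by simp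
    ultimately have d2: "real d * 2 ^ r * 32 \<le> 2 ^ n"
    proof -
      assume a: "2 ^ r * (real (n choose k) * 64) \<le> 2 ^ n" and b: "real d \<le> 2 * real (n choose k)"
      have "real d * (2 ^ r * 32) \<le> 2 * real (n choose k) * (2 ^ r * 32)"
        using b by (intro mult_right_mono) auto
      also have "\<dots> = 2 ^ r * (real (n choose k) * 64)" by simp
      finally show ?thesis using a unfolding mult.assoc by linarith
    qed
    have N2: "(real (40 * V) + 1)\<^sup>2 * 32 \<le> 2 ^ n"
    proof -
      have "(real (40 * V) + 1)\<^sup>2 * 32 \<le> (41 * real V)\<^sup>2 * 32"
        using V0 by (intro mult_right_mono power_mono) auto
      also have "\<dots> \<le> 2 ^ 16 * (real V)\<^sup>2" by (simp add: power_mult_distrib)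
      also have "\<dots> = 2 powr (16 + 2 * log 2 (real V))"
      proof -
        have "2 powr (16 + 2 * log 2 (real V)) = 2 powr 16 * (2 powr log 2 (real V) * 2 powr log 2 (real V))"
          by (simp only: powr_add mult_2)
        moreover have "2 powr log 2 (real V) = real V" using V0 by simp
        moreover have "2 powr 16 = (2 ^ 16 :: real)" by (simp add: powr_numeral)
        ultimately show ?thesis by (simp only: power2_eq_square)
      qed
      also have "\<dots> \<le> 2 powr real n" using key by (intro powr_mono) auto
      finally show ?thesis by (simp add: powr_realpow)
    qed
    have sum16: "((real (40 * V) + 1)\<^sup>2 + real d * 2 ^ r) / 2 ^ n \<le> 1 / 16"
      using N2 d2 by (simp add: divide_le_eq)
    have dlow: "(real n / (2 * real k)) ^ k \<le> real d"
    proof -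
      have kr: "k \<le> r" using r(1) kn3 by linarith
      have "(real n / (2 * real k)) ^ k \<le> (real r / real k) ^ k"
        using r(1) k by (intro power_mono) (auto simp: field_simps)
      also have "\<dots> \<le> real (r choose k)" using kr by (rule binomial_ge_n_over_k_pow_k)
      also have "\<dots> \<le> real d"
        unfolding d_def binom_le_def of_nat_le_iff by (rule member_le_sum) auto
      finally show ?thesis .
    qed
    have logV7: "7 \<le> log 2 (real V)"
      using V0 by (subst le_log_iff) (auto simp: powr_numeral)
    have logy: "0 \<le> log 2 y" using y by simp
    have logV2: "log 2 (real V) \<le> 2 * (real k * log 2 y)"
    proof -
      have "exp 1 \<le> y" using y exp_le by linarith
      then have "log 2 (exp 1 * y) \<le> log 2 (y * y)" using y by (simp add: mult_right_mono)
      also have "\<dots> = 2 * log 2 y" using y by (simp add: log_mult)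
      finally have "real k * log 2 (exp 1 * y) \<le> real k * (2 * log 2 y)" by (intro mult_left_mono) auto
      then show ?thesis using logV by (simp add: mult_ac)
    qed
    \<comment> \<open>The constant 4000 and the rounding add at most 13, which is below twice
      \<open>log 2 V\<close>.\<close>
    have L3: "real L \<le> 3 * log 2 (real V)"
    proof -
      have "log 2 4000 \<le> (12 :: real)" by (subst log_le_iff) (auto simp: powr_numeral)
      moreover have "log 2 (4000 * real V) = log 2 4000 + log 2 (real V)"
        using V0 by (simp add: log_mult)
      moreover have "0 \<le> log 2 (4000 * real V)" using V0 by simp
      then have "real L \<le> log 2 (4000 * real V) + 1" by (simp add: L_def)
      ultimately show ?thesis using logV7 by linarith
    qed
    \<comment> \<open>With \<open>z = (y / 2) ^ k \<le> d\<close> one has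
      \<open>L \<le> 12 * log 2 z\<close>; the threshold \<open>C2\<close> is set for
      \<open>172800 = 100 * 12 ^ 3\<close>.\<close>
    have Ld: "100 * real L ^ 3 \<le> real d"
    proof -
      define z where "z = (y / 2) ^ k"
      have yz: "y / 2 \<le> z"
        unfolding z_def using y k by (intro self_le_power) auto
      have "log 2 y \<le> 2 * log 2 (y / 2)"
      proof -
        have "log 2 4 \<le> log 2 y" using y by simp
        moreover have "log 2 (4 :: real) = 2"
          using log_nat_power[of 2 2 2] by simp
        ultimately show ?thesis using y by (simp add: log_divide)
      qed
      then have "2 * (real k * log 2 y) \<le> 4 * (real k * log 2 (y / 2))"
        using k1 by (simp add: mult_left_mono)
      also have "real k * log 2 (y / 2) = log 2 z"
        unfolding z_def using y by (simp add: log_nat_power)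
      finally have "real L \<le> 12 * log 2 z" using L3 logV2 by linarith
      then have "real L ^ 3 \<le> (12 * log 2 z) ^ 3" by (intro power_mono) auto
      then have "100 * real L ^ 3 \<le> 172800 * (log 2 z) ^ 3" by (simp add: power_mult_distrib)
      also have "\<dots> \<le> z" using y yz by (intro C2) linarith
      also have "z \<le> real d" using dlow by (simp add: z_def y_def mult.commute)
      finally show ?thesis .
    qed
    show "let V = binom_le n k; r = nat \<lfloor>real n - log 2 (real (n choose k)) - 6\<rfloor>; d = binom_le r k;
         L = nat \<lceil>log 2 (4000 * real V)\<rceil> in
      d \<le> V \<and> ((real (40 * V) + 1)\<^sup>2 + real d * 2 ^ r) / 2 ^ n \<le> 1 / 16 \<and>
      (real n / (2 * real k)) ^ k \<le> real d \<and> real V \<le> (exp 1 * (real n / real k)) ^ k \<and>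
      0 < log 2 (real V) \<and> log 2 (real V) \<le> 2 * (real k * log 2 (real n / real k)) \<and>
      real L \<le> 3 * log 2 (real V) \<and> 100 * real L ^ 3 \<le> real d"
      using \<open>d \<le> V\<close> sum16 dlow Vup logV7 logV2 L3 Ld
      unfolding Let_def x_def V_def r_def d_def L_def y_def by simp
  qed
qed

section \<open>The lower bound\<close>

text \<open>A tester run on a distribution supported in the points \<open>y i\<close>, with the function fixed, is a random
  function of the sampled indices; queries become part of \<open>R\<close>.\<close>

definition index_tester ::
  "nat \<Rightarrow> nat \<Rightarrow> real \<Rightarrow> nat \<Rightarrow> nat \<Rightarrow> (nat \<Rightarrow> nat \<Rightarrow> real) \<Rightarrow> ((nat \<Rightarrow> real) \<Rightarrow> real) \<Rightarrow> (nat list \<Rightarrow> bool pmf) \<Rightarrow> bool" where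
  "index_tester n k \<epsilon> m N y f R \<longleftrightarrow> (\<forall>E. set_pmf E \<subseteq> {..N} \<longrightarrow>
     ((\<exists>h\<in>PTF n k. \<forall>i\<in>set_pmf E. h (y i) = f (y i)) \<longrightarrow> 2 / 3 \<le> pmf (bind_pmf (replicate_pmf m E) R) True) \<and>
     (\<epsilon> \<le> dist_class (map_pmf y E) f (PTF n k) \<longrightarrow> pmf (bind_pmf (replicate_pmf m E) R) True \<le> 1 / 3))"

section \<open>Reduction of both access models to sampled indices\<close>

lemma PTF_two_valued: "PTF n k \<subseteq> two_valued (cube n)"
  by (auto simp: PTF_def two_valued_def sign_def split: if_splits)

lemma PTF_nonempty: "PTF n k \<noteq> {}"
  unfolding PTF_eq by blast

lemma replicate_pmf_map: "replicate_pmf m (map_pmf y E) = map_pmf (map y) (replicate_pmf m E)"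
  by (induction m) (simp_all add: map_pmf_def bind_assoc_pmf bind_return_pmf)

text \<open>A sample tester need only accept members of the class, and \<open>f\<close> itself may
  not be one. A member \<open>h\<close> that agrees with \<open>f\<close> on the support produces
  the same samples, so its acceptance carries over to \<open>f\<close>.\<close>

lemma sample_tester_index_tester:
  assumes "is_sample_tester (cube n) (PTF n k) \<epsilon> m T" "y ` {..N} \<subseteq> cube n" "f \<in> two_valued (cube n)"
  shows "\<exists>R. index_tester n k \<epsilon> m N y f R"
proof -
  define R where "R l = T (map (\<lambda>i. (y i, f (y i))) l)" for l
  have run: "sample_run T m (map_pmf y E) f = bind_pmf (replicate_pmf m E) R" for E
    unfolding sample_run_def replicate_pmf_map bind_map_pmf R_def by (simp add: o_def)
  have "index_tester n k \<epsilon> m N y f R"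
    unfolding index_tester_def
  proof (intro allI impI conjI)
    fix E :: "nat pmf" assume E: "set_pmf E \<subseteq> {..N}"
    then have D: "set_pmf (map_pmf y E) \<subseteq> cube n" using assms(2) by auto
    {
      assume "\<exists>h\<in>PTF n k. \<forall>i\<in>set_pmf E. h (y i) = f (y i)"
      then obtain h where h: "h \<in> PTF n k" "\<forall>i\<in>set_pmf E. h (y i) = f (y i)" by blast
      have "sample_run T m (map_pmf y E) h = sample_run T m (map_pmf y E) f"
        unfolding sample_run_def
      proof (rule bind_pmf_cong[OF refl])
        fix xs assume "xs \<in> set_pmf (replicate_pmf m (map_pmf y E))"
        then have "\<forall>x\<in>set xs. h x = f x" using h(2) by (auto simp: set_replicate_pmf)
        then have "map (\<lambda>x. (x, h x)) xs = map (\<lambda>x. (x, f x)) xs" by simp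
        then show "T (map (\<lambda>x. (x, h x)) xs) = T (map (\<lambda>x. (x, f x)) xs)" by (rule arg_cong)
      qed
      moreover have "2 / 3 \<le> pmf (sample_run T m (map_pmf y E) h) True"
        using assms(1) D h(1) PTF_two_valued[of n k] unfolding is_sample_tester_def by blast
      ultimately show "2 / 3 \<le> pmf (bind_pmf (replicate_pmf m E) R) True" using run by simp
    next
      assume "\<epsilon> \<le> dist_class (map_pmf y E) f (PTF n k)"
      then have "2 / 3 \<le> pmf (sample_run T m (map_pmf y E) f) False"
        using assms(1,3) D unfolding is_sample_tester_def by blast
      then show "pmf (bind_pmf (replicate_pmf m E) R) True \<le> 1 / 3"
        using run by (simp add: pmf_False_conv_True)
    }
  qed
  then show ?thesis by blast
qed

text \<open>Once \<open>f\<close> is fixed, answers to queries are known constants. A query still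
  uses up one of the \<open>q\<close> samples, which is discarded, so that every branch reads the
  same number of them.\<close>

lemma dtree_run_eq_bind:
  assumes "accesses_le t (cube n) q" "y ` {..N} \<subseteq> cube n" "f \<in> two_valued (cube n)"
  shows "\<exists>R. \<forall>E. set_pmf E \<subseteq> {..N} \<longrightarrow> dtree_run t (map_pmf y E) f = bind_pmf (replicate_pmf q E) R"
  using assms(1)
proof (induction t arbitrary: q)
  case (Output b)
  show ?case by (intro exI[of _ "\<lambda>_. return_pmf b"]) simp
next
  case (Query x t)
  then have q: "x \<in> cube n" "0 < q" "\<forall>v\<in>{-1, 1}. accesses_le (t v) (cube n) (q - 1)" by auto
  have "f x \<in> {-1, 1}" using q(1) assms(3) by (auto simp: two_valued_def PiE_iff)
  then obtain R where R: "\<And>E. set_pmf E \<subseteq> {..N} \<Longrightarrow>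
      dtree_run (t (f x)) (map_pmf y E) f = bind_pmf (replicate_pmf (q - 1) E) R"
    using Query.IH[of "t (f x)" "q - 1"] q by blast
  obtain q' where "q = Suc q'" using q(2) by (cases q) auto
  then show ?case
    using R by (intro exI[of _ "\<lambda>l. R (tl l)"]) (simp add: bind_assoc_pmf bind_return_pmf)
next
  case (Sample t)
  then have q: "0 < q" "\<forall>x\<in>cube n. \<forall>v\<in>{-1, 1}. accesses_le (t x v) (cube n) (q - 1)" by auto
  have "\<exists>R. \<forall>E. set_pmf E \<subseteq> {..N} \<longrightarrow>
      dtree_run (t (y i) (f (y i))) (map_pmf y E) f = bind_pmf (replicate_pmf (q - 1) E) R"
    if "i \<le> N" for i
  proof (rule Sample.IH)
    show "t (y i) \<in> range t" "t (y i) (f (y i)) \<in> range (t (y i))" by auto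
    have "y i \<in> cube n" using assms(2) that by auto
    moreover from this have "f (y i) \<in> {-1, 1}" using assms(3) by (auto simp: two_valued_def PiE_iff)
    ultimately show "accesses_le (t (y i) (f (y i))) (cube n) (q - 1)" using q(2) by blast
  qed
  then obtain R where R: "\<And>i E. i \<le> N \<Longrightarrow> set_pmf E \<subseteq> {..N} \<Longrightarrow>
      dtree_run (t (y i) (f (y i))) (map_pmf y E) f = bind_pmf (replicate_pmf (q - 1) E) (R i)"
    by metis
  obtain q' where q': "q = Suc q'" using q(1) by (cases q) auto
  have "dtree_run (Sample t) (map_pmf y E) f = bind_pmf (replicate_pmf q E) (\<lambda>l. R (hd l) (tl l))"
    if E: "set_pmf E \<subseteq> {..N}" for E
  proof -
    have "dtree_run (Sample t) (map_pmf y E) f =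
        bind_pmf E (\<lambda>i. dtree_run (t (y i) (f (y i))) (map_pmf y E) f)"
      by (simp add: bind_map_pmf)
    also have "\<dots> = bind_pmf E (\<lambda>i. bind_pmf (replicate_pmf q' E) (R i))"
      using R E q' by (intro bind_pmf_cong) auto
    also have "\<dots> = bind_pmf (replicate_pmf q E) (\<lambda>l. R (hd l) (tl l))"
      by (simp add: q' bind_assoc_pmf bind_return_pmf)
    finally show ?thesis .
  qed
  then show ?case by blast
qed

text \<open>Queries off the support could tell \<open>f\<close> from a consistent member
  \<open>h\<close>, so \<open>h\<close> cannot replace \<open>f\<close> here. Instead consistency
  gives distance 0, on which a query tester must accept.\<close>

lemma query_tester_index_tester:
  assumes "is_query_tester (cube n) (PTF n k) \<epsilon> q T" "y ` {..N} \<subseteq> cube n" "f \<in> two_valued (cube n)"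
  shows "\<exists>R. index_tester n k \<epsilon> q N y f R"
proof -
  have "\<forall>t\<in>set_pmf T. \<exists>R. \<forall>E. set_pmf E \<subseteq> {..N} \<longrightarrow>
      dtree_run t (map_pmf y E) f = bind_pmf (replicate_pmf q E) R"
    using assms dtree_run_eq_bind unfolding is_query_tester_def by blast
  then obtain S where S: "\<And>t E. t \<in> set_pmf T \<Longrightarrow> set_pmf E \<subseteq> {..N} \<Longrightarrow>
      dtree_run t (map_pmf y E) f = bind_pmf (replicate_pmf q E) (S t)" by metis
  define R where "R l = bind_pmf T (\<lambda>t. S t l)" for l
  have run: "query_run T (map_pmf y E) f = bind_pmf (replicate_pmf q E) R" if "set_pmf E \<subseteq> {..N}" for E
  proof -
    have "query_run T (map_pmf y E) f = bind_pmf T (\<lambda>t. bind_pmf (replicate_pmf q E) (S t))"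
      unfolding query_run_def using S that by (intro bind_pmf_cong) auto
    also have "\<dots> = bind_pmf (replicate_pmf q E) R"
      unfolding R_def by (rule bind_commute_pmf)
    finally show ?thesis .
  qed
  have "index_tester n k \<epsilon> q N y f R"
    unfolding index_tester_def
  proof (intro allI impI conjI)
    fix E :: "nat pmf" assume E: "set_pmf E \<subseteq> {..N}"
    then have D: "set_pmf (map_pmf y E) \<subseteq> cube n" using assms(2) by auto
    {
      assume "\<exists>h\<in>PTF n k. \<forall>i\<in>set_pmf E. h (y i) = f (y i)"
      then obtain h where h: "h \<in> PTF n k" "\<forall>i\<in>set_pmf E. h (y i) = f (y i)" by blast
      have bdd: "bdd_below ((\<lambda>h. dist_fun (map_pmf y E) f h) ` PTF n k)"
        by (intro bdd_belowI[of _ 0]) (auto simp: dist_fun_def)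
      have "dist_fun (map_pmf y E) f h = 0"
        using h(2) by (auto simp: dist_fun_def measure_pmf_zero_iff)
      then have "dist_class (map_pmf y E) f (PTF n k) \<le> 0"
        unfolding dist_class_def using cINF_lower[OF bdd h(1)] by simp
      moreover have "0 \<le> dist_class (map_pmf y E) f (PTF n k)"
        unfolding dist_class_def by (intro cINF_greatest PTF_nonempty) (simp add: dist_fun_def)
      ultimately have "dist_class (map_pmf y E) f (PTF n k) = 0" by simp
      then have "2 / 3 \<le> pmf (query_run T (map_pmf y E) f) True"
        using assms(1,3) D unfolding is_query_tester_def by blast
      then show "2 / 3 \<le> pmf (bind_pmf (replicate_pmf q E) R) True" using run[OF E] by simp
    next
      assume "\<epsilon> \<le> dist_class (map_pmf y E) f (PTF n k)"
      then have "2 / 3 \<le> pmf (query_run T (map_pmf y E) f) False"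
        using assms(1,3) D unfolding is_query_tester_def by blast
      then show "pmf (bind_pmf (replicate_pmf q E) R) True \<le> 1 / 3"
        using run[OF E] by (simp add: pmf_False_conv_True)
    }
  qed
  then show ?thesis by blast
qed

lemma prob_count_ge:
  fixes p :: "real pmf"
  assumes "0 < t"
  shows "measure_pmf.prob (Pi_pmf {1..N} 0 (\<lambda>_. p)) {u. t \<le> real (card {i\<in>{1..N}. u i \<in> A})} \<le>
    real N * measure_pmf.prob p A / t"
proof -
  let ?P = "Pi_pmf {1..N} 0 (\<lambda>_. p)"
  have int: "integrable ?P (\<lambda>u. indicator A (u i) / t)" for i
    using assms by (intro measure_pmf.integrable_const_bound[where B = "1 / t"])
      (auto simp: indicator_def divide_le_cancel)
  have "measure_pmf.prob ?P {u. t \<le> real (card {i\<in>{1..N}. u i \<in> A})} =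
      measure_pmf.expectation ?P (indicator {u. t \<le> real (card {i\<in>{1..N}. u i \<in> A})})" by simp
  also have "\<dots> \<le> measure_pmf.expectation ?P (\<lambda>u. \<Sum>i\<in>{1..N}. indicator A (u i) / t)"
  proof (rule Bochner_Integration.integral_mono)
    show "integrable ?P (indicator {u. t \<le> real (card {i\<in>{1..N}. u i \<in> A})} :: (nat \<Rightarrow> real) \<Rightarrow> real)"
      by (intro measure_pmf.integrable_const_bound[where B = 1]) auto
    show "integrable ?P (\<lambda>u. \<Sum>i\<in>{1..N}. indicator A (u i) / t)"
      using int by (intro Bochner_Integration.integrable_sum)
    fix u :: "nat \<Rightarrow> real"
    have "(\<Sum>i\<in>{1..N}. indicator A (u i) / t) = real (card {i\<in>{1..N}. u i \<in> A}) / t"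
      by (simp add: indicator_def sum_divide_distrib[symmetric] sum.If_cases Int_def)
    then show "indicator {u. t \<le> real (card {i\<in>{1..N}. u i \<in> A})} u \<le> (\<Sum>i\<in>{1..N}. indicator A (u i) / t)"
      using assms by (auto simp: indicator_def)
  qed
  also have "\<dots> = (\<Sum>i\<in>{1..N}. measure_pmf.expectation ?P (\<lambda>u. indicator A (u i) / t))"
    using int by (intro Bochner_Integration.integral_sum)
  also have "\<dots> = (\<Sum>i\<in>{1..N}. measure_pmf.prob p A / t)"
  proof (rule sum.cong[OF refl])
    fix i assume i: "i \<in> {1..N}"
    have "measure_pmf.expectation ?P (\<lambda>u. indicator A (u i) / t) =
        measure_pmf.expectation (map_pmf (\<lambda>u. u i) ?P) (\<lambda>x. indicator A x / t)"
      by (simp only: integral_map_pmf)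
    also have "map_pmf (\<lambda>u. u i) ?P = p" using i by (subst Pi_pmf_component) auto
    finally show "measure_pmf.expectation ?P (\<lambda>u. indicator A (u i) / t) = measure_pmf.prob p A / t" by simp
  qed
  finally show ?thesis by simp
qed

lemma pmf_bind_True_ge:
  assumes "\<And>u. u \<in> set_pmf P \<Longrightarrow> u \<notin> A \<Longrightarrow> 2 / 3 \<le> pmf (K u) True"
  shows "2 / 3 * (1 - measure_pmf.prob P A) \<le> pmf (bind_pmf P K) True"
proof -
  have "2 / 3 * (1 - measure_pmf.prob P A) = 2 / 3 * measure_pmf.prob P (- A)"
    using measure_pmf.prob_compl[of A P] by (simp add: Compl_eq_Diff_UNIV)
  also have "\<dots> = measure_pmf.expectation P (\<lambda>u. 2 / 3 * indicator (- A) u)" by simp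
  also have "\<dots> \<le> measure_pmf.expectation P (\<lambda>u. pmf (K u) True)"
  proof (intro integral_mono_AE AE_pmfI)
    show "integrable P (\<lambda>u. 2 / 3 * indicator (- A) u :: real)"
      by (intro measure_pmf.integrable_const_bound[where B = 1]) (auto simp: indicator_def)
    show "integrable P (\<lambda>u. pmf (K u) True)"
      by (intro measure_pmf.integrable_const_bound[where B = 1]) (auto simp: pmf_le_1)
    fix u assume "u \<in> set_pmf P"
    then show "2 / 3 * indicator (- A) u \<le> pmf (K u) True"
      using assms[of u] by (auto simp: indicator_def pmf_nonneg)
  qed
  finally show ?thesis by (simp add: pmf_bind)
qed

lemma pmf_bind_True_le:
  assumes "\<And>u. u \<in> set_pmf P \<Longrightarrow> u \<notin> A \<Longrightarrow> pmf (K u) True \<le> 1 / 3"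
  shows "pmf (bind_pmf P K) True \<le> 1 / 3 + measure_pmf.prob P A"
proof -
  have "measure_pmf.expectation P (\<lambda>u. pmf (K u) True) \<le>
      measure_pmf.expectation P (\<lambda>u. 1 / 3 + indicator A u)"
  proof (intro integral_mono_AE AE_pmfI)
    show "integrable P (\<lambda>u. 1 / 3 + indicator A u :: real)"
      by (intro measure_pmf.integrable_const_bound[where B = 2]) (auto simp: indicator_def)
    show "integrable P (\<lambda>u. pmf (K u) True)"
      by (intro measure_pmf.integrable_const_bound[where B = 1]) (auto simp: pmf_le_1)
    fix u assume "u \<in> set_pmf P"
    then show "pmf (K u) True \<le> 1 / 3 + indicator A u"
      using assms[of u] pmf_le_1[of "K u" True] by (cases "u \<in> A") (auto simp: indicator_def)
  qed
  also have "\<dots> = 1 / 3 + measure_pmf.prob P A"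
    by (subst Bochner_Integration.integral_add)
      (auto intro!: measure_pmf.integrable_const_bound[where B = 1])
  finally show ?thesis by (simp add: pmf_bind)
qed

text \<open>Every point of weight 1 has mass \<open>1 / W\<close>, so each disagreement on such a
  point contributes that much to the distance.\<close>

lemma dist_class_weight_pmf_ge:
  fixes u :: "nat \<Rightarrow> real"
  assumes y: "inj_on y {..N}" and u: "\<And>i. i \<in> {1..N} \<Longrightarrow> 0 \<le> u i" "(\<Sum>i\<in>{1..N}. u i) \<le> W" "0 < W"
    and far: "\<And>h. h \<in> PTF n k \<Longrightarrow> t \<le> card {x \<in> y ` {i\<in>{1..N}. u i = 1}. f x \<noteq> h x}"
  shows "real t / W \<le> dist_class (map_pmf y (weight_pmf N W u)) f (PTF n k)"
  unfolding dist_class_def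
proof (intro cINF_greatest PTF_nonempty)
  fix h assume h: "h \<in> PTF n k"
  let ?E = "weight_pmf N W u"
  define J where "J = {i\<in>{1..N}. u i = 1 \<and> f (y i) \<noteq> h (y i)}"
  have J: "finite J" "J \<subseteq> {i. f (y i) \<noteq> h (y i)}" by (auto simp: J_def)
  have "{x \<in> y ` {i\<in>{1..N}. u i = 1}. f x \<noteq> h x} = y ` J" by (auto simp: J_def)
  then have "t \<le> card (y ` J)" using far[OF h] by simp
  also have "\<dots> = card J" using y by (intro card_image inj_on_subset[OF y]) (auto simp: J_def)
  finally have "real t / W \<le> real (card J) / W" using u(3) by (simp add: divide_right_mono)
  also have "\<dots> = (\<Sum>i\<in>J. pmf ?E i)"
  proof -
    have "pmf ?E i = 1 / W" if "i \<in> J" for i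
      using that pmf_weight_pmf[OF u, of i] by (auto simp: J_def)
    then show ?thesis by simp
  qed
  also have "\<dots> = measure_pmf.prob ?E J" using J(1) by (simp add: measure_measure_pmf_finite)
  also have "\<dots> \<le> measure_pmf.prob ?E {i. f (y i) \<noteq> h (y i)}"
    using J(2) by (intro measure_pmf.finite_measure_mono) auto
  also have "\<dots> = dist_fun (map_pmf y ?E) f h"
    by (simp add: dist_fun_def vimage_def)
  finally show "real t / W \<le> dist_fun (map_pmf y ?E) f h" .
qed

lemma binom_le_pos: "0 < binom_le n k"
proof -
  have "binom_le n 0 \<le> binom_le n k" unfolding binom_le_def by (intro sum_mono2) auto
  then show ?thesis by (simp add: binom_le_def)
qed

lemma index_tester_lower_bound:
  fixes n k r m :: nat
  defines "V \<equiv> binom_le n k"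
  defines "d \<equiv> binom_le r k" and "L \<equiv> nat \<lceil>log 2 (4000 * real V)\<rceil>"
  assumes dV: "d \<le> V" and sparse: "((real (40 * V) + 1)\<^sup>2 + real d * 2 ^ r) / 2 ^ n \<le> 1 / 16"
    and Ld: "100 * real L ^ 3 \<le> real d"
    and tester: "\<And>y f. y ` {..40 * V} \<subseteq> cube n \<Longrightarrow> f \<in> two_valued (cube n) \<Longrightarrow>
      \<exists>R. index_tester n k \<epsilon> m (40 * V) y f R"
    and eps: "\<epsilon> \<le> 1 / 1280"
  shows "real d / (400 * real L) \<le> real m"
proof (rule ccontr)
  assume few: "\<not> ?thesis"
  \<comment> \<open>Half of the \<open>N\<close> points are \<open>20 * V\<close>, as the counting
    of close functions requires. \<open>W\<close> is twice the \<open>16 * N\<close> of the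
    exponential bound, and \<open>B\<close> makes the expected number of nonzero weights under
    \<alpha> at most \<open>d / 50\<close>. Then \<open>V / W = 1 / 1280\<close>.\<close>
  define N where "N = 40 * V"
  define W where "W = 32 * real N"
  define B where "B = 200 * real N / real d"
  define wmax where "wmax = 4 * B * (real L)\<^sup>2"
  have V1: "1 \<le> V" using binom_le_pos[of n k] by (simp add: V_def)
  then have N: "40 \<le> real N" by (simp add: N_def)
  have L2: "100 * real N \<le> 2 ^ L"
  proof -
    have "log 2 (4000 * real V) \<le> real L" unfolding L_def by linarith
    then have "4000 * real V \<le> 2 powr real L" using V1 by (simp add: log_le_iff)
    then show ?thesis by (simp add: N_def powr_realpow)
  qed
  have L1: "1 \<le> L" using L2 N by (cases L) auto
  have d0: "0 < real d" using Ld L1 by (smt (verit) of_nat_1 of_nat_mono one_le_power)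
  have B: "200 \<le> B" using dV d0 V1 unfolding B_def N_def by (simp add: le_divide_eq)
  have W: "0 < W" using N by (simp add: W_def)
  have wmax: "0 < wmax" using B L1 by (simp add: wmax_def)
  have B4: "real N * (4 / B) = real d / 50" using d0 N by (simp add: B_def)
  \<comment> \<open>Here the assumed upper bound on \<open>m\<close> enters; after cancellation the
    claim is \<open>400 * m * L \<le> d\<close>.\<close>
  have m: "16 * real m * wmax \<le> real L * W"
  proof -
    have "real m * (400 * real L) \<le> real d"
      using few L1 by (simp add: not_le divide_le_eq le_divide_eq less_divide_eq)
    then have "real m * (400 * real L) * (32 * real N * real L / real d) \<le> real d * (32 * real N * real L / real d)"
      by (intro mult_right_mono) auto
    then show ?thesis
      using d0 by (simp add: wmax_def W_def B_def power2_eq_square mult_ac)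
  qed
  \<comment> \<open>The bound on the probability that the total weight exceeds \<open>W\<close>. Its
    exponent is \<open>d / (50 * L^2)\<close>, at least \<open>2 * L\<close> by the hypothesis on
    \<open>L ^ 3\<close>, so that it survives multiplication by the \<open>N\<close> hybrid
    steps.\<close>
  define s where "s = exp (- (16 * real N / wmax))"
  have s: "s \<le> 1 / (100 * real N)\<^sup>2"
  proof -
    have "16 * real N / wmax = real d / (50 * (real L)\<^sup>2)"
      using d0 N L1 by (simp add: wmax_def B_def)
    also have "2 * real L \<le> \<dots>"
      using Ld L1 by (simp add: le_divide_eq power2_eq_square power3_eq_cube)
    finally have "s \<le> exp (- (2 * real L))" by (simp add: s_def)
    also have "\<dots> = 1 / (exp (real L))\<^sup>2"
      by (simp add: exp_minus inverse_eq_divide power2_eq_square exp_add[symmetric])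
    also have "\<dots> \<le> 1 / (100 * real N)\<^sup>2"
    proof (intro divide_left_mono power_mono mult_pos_pos)
      have "(2 :: real) \<le> exp 1" using exp_ge_add_one_self[of 1] by simp
      then have "(2 :: real) ^ L \<le> exp 1 ^ L" by (intro power_mono) auto
      then show "100 * real N \<le> exp (real L)" using L2 by (simp add: exp_of_nat_mult[symmetric])
    qed (use N in auto)
    finally show ?thesis .
  qed
  have sN: "real N * (exp 1 * s) \<le> 1 / 100" "s \<le> 1 / 100"
  proof -
    have "real N * (exp 1 * s) \<le> real N * (3 * (1 / (100 * real N)\<^sup>2))"
      using s exp_le by (intro mult_left_mono mult_mono) (auto simp: s_def)
    also have "\<dots> \<le> 1 / 100" using N by (simp add: power2_eq_square field_simps)
    finally show "real N * (exp 1 * s) \<le> 1 / 100" .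
    have "1 / (100 * real N)\<^sup>2 \<le> 1 / 100"
    proof (intro divide_left_mono)
      have "100 * 1 \<le> (100 * real N) * (100 * real N)" using N by (intro mult_mono) auto
      then show "100 \<le> (100 * real N)\<^sup>2" by (simp only: power2_eq_square mult_1_right)
    qed (use N in auto)
    then show "s \<le> 1 / 100" using s by linarith
  qed
  obtain \<alpha> \<beta> where \<alpha>: "bounded_law wmax \<alpha>" "measure_pmf.prob \<alpha> {x. x \<noteq> 0} \<le> 4 / B"
    and \<beta>: "bounded_law wmax \<beta>" "measure_pmf.prob \<beta> {x. x \<noteq> 1} \<le> 4 / B"
    and mom: "\<And>i. i \<le> L \<Longrightarrow> measure_pmf.expectation \<alpha> (\<lambda>x. x ^ i) = measure_pmf.expectation \<beta> (\<lambda>x. x ^ i)"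
    using exists_matching_laws[of B L] B L1 unfolding wmax_def by auto
  define PA where "PA = Pi_pmf {1..N} (0 :: real) (\<lambda>_. \<alpha>)"
  define PB where "PB = Pi_pmf {1..N} (0 :: real) (\<lambda>_. \<beta>)"
  define I where "I u = insert 0 {i\<in>{1..N}. u i \<noteq> 0}" for u :: "nat \<Rightarrow> real"
  obtain y where y: "y ` {..N} \<subseteq> cube n" "inj_on y {..N}"
    and dep: "measure_pmf.prob PA {u. card (I u) \<le> d \<and>
      (\<exists>i\<in>I u. y i \<in> deg_closure n k (y ` {l\<in>I u. l < i}))} \<le> 1 / 16"
    using exists_generic_points[of PA I N "1 / 16" r k n] sparse unfolding N_def d_def I_def by auto
  define ones where "ones u = {i\<in>{1..N}. u i = 1}" for u :: "nat \<Rightarrow> real"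
  \<comment> \<open>The size condition makes the counting bound apply for every \<open>u\<close>;
    draws with too few weights equal to 1 are excluded separately in \<open>badB\<close>.\<close>
  define close where "close Z u \<longleftrightarrow> 20 * V \<le> card (ones u) \<and>
    (\<exists>h\<in>PTF n k. card {x \<in> y ` ones u. sign_fun n Z x \<noteq> h x} \<le> V)" for Z u
  have "\<exists>Z\<in>Pow (cube n). measure_pmf.prob PB {u. close Z u} \<le> 1 / 64"
  proof (rule averaging)
    fix u
    show "real (card {Z \<in> Pow (cube n). close Z u}) \<le> 1 / 64 * real (card (Pow (cube n)))"
    proof (cases "20 * V \<le> card (ones u)")
      case True
      have o: "ones u \<subseteq> {..N}" by (auto simp: ones_def)
      have "card (y ` ones u) = card (ones u)"
        using inj_on_subset[OF y(2) o] by (rule card_image)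
      moreover have "y ` ones u \<subseteq> cube n" using o y(1) by blast
      ultimately show ?thesis
        using True V1 card_close_le_fraction[of "y ` ones u" n k V] by (simp add: close_def V_def)
    qed (simp add: close_def)
  qed auto
  then obtain Z where Z: "measure_pmf.prob PB {u. close Z u} \<le> 1 / 64" by blast
  define f where "f = sign_fun n Z"
  have f: "f \<in> two_valued (cube n)" unfolding f_def by (rule sign_fun_two_valued)
  \<comment> \<open>\<open>y\<close> and \<open>f\<close> were fixed from the two laws alone, so the
    same \<open>R\<close> faces both random distributions.\<close>
  obtain R where R: "index_tester n k \<epsilon> m N y f R" using tester[OF _ f] y(1) unfolding N_def by blast
  define K where "K u = bind_pmf (replicate_pmf m (weight_pmf N W u)) R" for u
  have set_E: "set_pmf (weight_pmf N W u) \<subseteq> I u" for u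
    unfolding I_def by (rule set_weight_pmf[OF W])
  have IN: "I u \<subseteq> {..N}" for u by (auto simp: I_def)
  define badA where "badA = {u. card (I u) \<le> d \<and> (\<exists>i\<in>I u. y i \<in> deg_closure n k (y ` {l\<in>I u. l < i}))} \<union>
    {u. real d \<le> real (card {i\<in>{1..N}. u i \<in> {x. x \<noteq> 0}})}"
  have "2 / 3 * (1 - measure_pmf.prob PA badA) \<le> pmf (bind_pmf PA K) True"
  proof (rule pmf_bind_True_ge)
    fix u assume "u \<notin> badA"
    then have "card {i\<in>{1..N}. u i \<noteq> 0} < d" and ndep: "card (I u) \<le> d \<Longrightarrow>
        \<forall>i\<in>I u. y i \<notin> deg_closure n k (y ` {l\<in>I u. l < i})" by (auto simp: badA_def)
    \<comment> \<open>Fewer than \<open>d\<close> nonzero weights leave room for the extra index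
      0.\<close>
    then have cI: "card (I u) \<le> d" by (simp add: I_def)
    have "\<exists>h\<in>PTF n k. \<forall>i\<in>I u. h (y i) = f (y i)"
      using ndep[OF cI] y(1) IN[of u] f
      by (intro PTF_shatters_generic) (auto simp: I_def)
    then show "2 / 3 \<le> pmf (K u) True"
      using R set_E[of u] IN[of u] unfolding index_tester_def K_def by blast
  qed
  moreover have "measure_pmf.prob PA badA \<le> 1 / 16 + 1 / 50"
  proof -
    have "measure_pmf.prob PA {u. real d \<le> real (card {i\<in>{1..N}. u i \<in> {x. x \<noteq> 0}})} \<le>
        real N * measure_pmf.prob \<alpha> {x. x \<noteq> 0} / real d"
      unfolding PA_def by (rule prob_count_ge[OF d0])
    also have "\<dots> \<le> real N * (4 / B) / real d"
      using \<alpha>(2) by (intro divide_right_mono mult_left_mono) auto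
    also have "\<dots> = 1 / 50" unfolding B4 using d0 by simp
    finally show ?thesis
      unfolding badA_def using dep by (intro order.trans[OF measure_Un_le]) auto
  qed
  ultimately have accA: "3 / 5 \<le> pmf (bind_pmf PA K) True" by argo
  define badB where "badB = {u. close Z u} \<union> {u. W < (\<Sum>i\<in>{1..N}. u i)} \<union>
    {u. real N / 2 \<le> real (card {i\<in>{1..N}. u i \<in> {x. x \<noteq> 1}})}"
  have "pmf (bind_pmf PB K) True \<le> 1 / 3 + measure_pmf.prob PB badB"
  proof (rule pmf_bind_True_le)
    fix u assume u: "u \<in> set_pmf PB" and "u \<notin> badB"
    then have good: "\<not> close Z u" "(\<Sum>i\<in>{1..N}. u i) \<le> W"
      "real (card {i\<in>{1..N}. u i \<noteq> 1}) < real N / 2" by (auto simp: badB_def)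
    have "{1..N} = ones u \<union> {i\<in>{1..N}. u i \<noteq> 1}" by (auto simp: ones_def)
    then have "card {1..N} = card (ones u) + card {i\<in>{1..N}. u i \<noteq> 1}"
      by (subst \<open>{1..N} = _\<close>, intro card_Un_disjoint) (auto simp: ones_def)
    then have "20 * V \<le> card (ones u)" using good(3) by (simp add: N_def)
    then have far: "V \<le> card {x \<in> y ` {i\<in>{1..N}. u i = 1}. f x \<noteq> h x}" if "h \<in> PTF n k" for h
      using good(1) that unfolding close_def f_def ones_def by force
    have "0 \<le> u i" if "i \<in> {1..N}" for i
      using u that \<beta>(1) by (force simp: PB_def set_Pi_pmf PiE_dflt_def bounded_law_def)
    then have "real V / W \<le> dist_class (map_pmf y (weight_pmf N W u)) f (PTF n k)"
      using y(2) good(2) W far by (intro dist_class_weight_pmf_ge) auto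
    moreover have "real V / W = 1 / 1280" using V1 by (simp add: W_def N_def)
    ultimately have "\<epsilon> \<le> dist_class (map_pmf y (weight_pmf N W u)) f (PTF n k)"
      using eps by linarith
    then show "pmf (K u) True \<le> 1 / 3"
      using R set_E[of u] IN[of u] unfolding index_tester_def K_def by blast
  qed
  moreover have "measure_pmf.prob PB badB \<le> 1 / 64 + 1 / 100 + 1 / 25"
  proof -
    have "measure_pmf.prob PB {u. W < (\<Sum>i\<in>{1..N}. u i)} \<le> exp ((16 * real (card {1..N}) - W) / wmax)"
      unfolding PB_def using \<beta>(1) wmax by (intro prob_sum_large) auto
    also have "\<dots> = s" by (simp add: s_def W_def)
    finally have 1: "measure_pmf.prob PB {u. W < (\<Sum>i\<in>{1..N}. u i)} \<le> 1 / 100" using sN by simp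
    have "measure_pmf.prob PB {u. real N / 2 \<le> real (card {i\<in>{1..N}. u i \<in> {x. x \<noteq> 1}})} \<le>
        real N * measure_pmf.prob \<beta> {x. x \<noteq> 1} / (real N / 2)"
      unfolding PB_def using N by (intro prob_count_ge) auto
    also have "\<dots> \<le> real N * (4 / 200) / (real N / 2)"
    proof (intro divide_right_mono mult_left_mono)
      have "4 / B \<le> 4 / 200" using B by (intro divide_left_mono) auto
      then show "measure_pmf.prob \<beta> {x. x \<noteq> 1} \<le> 4 / 200" using \<beta>(2) by linarith
    qed auto
    also have "\<dots> = 1 / 25" using N by simp
    finally have 2: "measure_pmf.prob PB {u. real N / 2 \<le> real (card {i\<in>{1..N}. u i \<in> {x. x \<noteq> 1}})} \<le> 1 / 25" .
    have "measure_pmf.prob PB ({u. close Z u} \<union> {u. W < (\<Sum>i\<in>{1..N}. u i)}) \<le> 1 / 64 + 1 / 100"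
      using Z 1 by (intro order.trans[OF measure_Un_le]) auto
    then show ?thesis
      unfolding badB_def using 2 by (intro order.trans[OF measure_Un_le]) auto
  qed
  ultimately have accB: "pmf (bind_pmf PB K) True \<le> 2 / 5" by linarith
  \<comment> \<open>Acceptance drops from at least 3/5 to at most 2/5, while the hybrid argument
    allows a change of at most 1/50.\<close>
  have "\<bar>pmf (bind_pmf PA K) True - pmf (bind_pmf PB K) True\<bar> \<le>
      real N * (1 / 2 ^ L + exp ((16 * real N - (W - wmax)) / wmax))"
    unfolding PA_def PB_def K_def using \<alpha>(1) \<beta>(1) wmax W mom m by (intro hybrid) auto
  also have "\<dots> = real N * (1 / 2 ^ L) + real N * (exp 1 * s)"
  proof -
    have "(16 * real N - (W - wmax)) / wmax = 1 + - (16 * real N / wmax)"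
      using wmax by (simp add: W_def field_simps)
    then show ?thesis by (simp add: s_def exp_add[symmetric] distrib_left)
  qed
  also have "real N * (1 / 2 ^ L) \<le> 1 / 100" using L2 by (simp add: divide_le_eq)
  finally show False using accA accB sN by linarith
qed

lemma ereal_of_enat_Inf_ge:
  assumes "\<And>m. P m \<Longrightarrow> x \<le> real m"
  shows "ereal x \<le> ereal_of_enat (Inf {enat m |m. P m})"
proof -
  have "enat (nat \<lceil>x\<rceil>) \<le> Inf {enat m |m. P m}"
  proof (rule Inf_greatest)
    fix e assume "e \<in> {enat m |m. P m}"
    then obtain m where "e = enat m" "P m" by blast
    moreover have "nat \<lceil>x\<rceil> \<le> m" using assms[OF \<open>P m\<close>] by (simp add: nat_le_iff ceiling_le_iff)
    ultimately show "enat (nat \<lceil>x\<rceil>) \<le> e" by simp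
  qed
  then have "ereal_of_enat (enat (nat \<lceil>x\<rceil>)) \<le> ereal_of_enat (Inf {enat m |m. P m})"
    by (simp only: ereal_of_enat_le_iff)
  moreover have "ereal x \<le> ereal_of_enat (enat (nat \<lceil>x\<rceil>))" by simp linarith
  ultimately show ?thesis by (rule order.trans[rotated])
qed

theorem theorem4p4:
  shows "\<exists>(C'::real) (a::real) (c::real) (\<epsilon>\<^sub>0::real).
    C' > 1 \<and> a \<ge> 0 \<and> c > 0 \<and> \<epsilon>\<^sub>0 > 0 \<and>
    (\<forall>(n::nat) (k::nat) (\<epsilon>::real).
       n > 0 \<longrightarrow> k > 0 \<longrightarrow> real k < real n / C' \<longrightarrow> 0 < \<epsilon> \<longrightarrow> \<epsilon> < \<epsilon>\<^sub>0 \<longrightarrow>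
       (\<forall>M \<in> {m_test (cube n) (PTF n k) \<epsilon>, q_test (cube n) (PTF n k) \<epsilon>}.
          ereal_of_enat M \<ge>
            ereal (c * ((real (binom_le (nat \<lfloor>real n - log 2 (real (n choose k)) - a\<rfloor>) k))\<^sup>2 /
                        (real (binom_le n k) * log 2 (real (binom_le n k))))) \<and>
          ereal_of_enat M \<ge>
            ereal (c * ((real n / (4 * exp 1 * real k)) ^ k /
                        (real k * log 2 (real n / real k))))))"
proof -
  obtain C :: real where C: "1 < C"
    and bounds: "\<And>n k. 0 < k \<Longrightarrow> real k < real n / C \<Longrightarrow>
      (let V = binom_le n k; r = nat \<lfloor>real n - log 2 (real (n choose k)) - 6\<rfloor>; d = binom_le r k;
           L = nat \<lceil>log 2 (4000 * real V)\<rceil> in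
        d \<le> V \<and> ((real (40 * V) + 1)\<^sup>2 + real d * 2 ^ r) / 2 ^ n \<le> 1 / 16 \<and>
        (real n / (2 * real k)) ^ k \<le> real d \<and> real V \<le> (exp 1 * (real n / real k)) ^ k \<and>
        0 < log 2 (real V) \<and> log 2 (real V) \<le> 2 * (real k * log 2 (real n / real k)) \<and>
        real L \<le> 3 * log 2 (real V) \<and> 100 * real L ^ 3 \<le> real d)"
    using parameter_bounds by blast
  show ?thesis
  proof (rule exI[of _ C], rule exI[of _ 6], rule exI[of _ "1 / 2400"], rule exI[of _ "1 / 1280"],
      intro conjI allI impI ballI)
    fix n k :: nat and \<epsilon> :: real
    assume n: "n > 0" and k: "k > 0" and kn: "real k < real n / C" and eps: "0 < \<epsilon>" "\<epsilon> < 1 / 1280"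
    define V where "V = binom_le n k"
    define r where "r = nat \<lfloor>real n - log 2 (real (n choose k)) - 6\<rfloor>"
    define d where "d = binom_le r k"
    define L where "L = nat \<lceil>log 2 (4000 * real V)\<rceil>"
    define lV where "lV = log 2 (real V)"
    define ly where "ly = log 2 (real n / real k)"
    have b: "d \<le> V" "((real (40 * V) + 1)\<^sup>2 + real d * 2 ^ r) / 2 ^ n \<le> 1 / 16"
      "(real n / (2 * real k)) ^ k \<le> real d" "real V \<le> (exp 1 * (real n / real k)) ^ k"
      "0 < lV" "lV \<le> 2 * (real k * ly)" "real L \<le> 3 * lV" "100 * real L ^ 3 \<le> real d"
      using bounds[OF k kn] unfolding Let_def V_def r_def d_def L_def lV_def ly_def by blast+
    have V0: "0 < real V"
      using binom_le_pos[of n k] by (simp add: V_def)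
    have kly: "0 < real k * ly" using b(5,6) by linarith
    define x1 where "x1 = (real d)\<^sup>2 / (real V * lV)"
    define x2 where "x2 = (real n / (4 * exp 1 * real k)) ^ k / (real k * ly)"
    have x1: "0 \<le> x1" using b(5) V0 by (simp add: x1_def)
    have L0: "0 < real L"
    proof -
      have "1 < 4000 * real V" using V0 by simp
      then have "0 < log 2 (4000 * real V)" by simp
      then show ?thesis by (simp add: L_def)
    qed
    \<comment> \<open>The bound actually obtained is of order \<open>d / log V\<close>; it is
      weakened by the factor \<open>d / V \<le> 1\<close> to the stated form. The constant is 400
      times the 3 in \<open>L \<le> 3 * lV\<close>.\<close>
    have "1 / 1200 * x1 \<le> real d / (400 * real L)"
    proof -
      have "(real d)\<^sup>2 / (real V * lV) \<le> (real d * real V) / (real V * lV)"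
        using b(1,5) V0 by (intro divide_right_mono) (auto simp: power2_eq_square mult_left_mono)
      also have "\<dots> = real d / lV" using V0 by simp
      also have "\<dots> \<le> real d / (real L / 3)"
        using b(7) L0 b(5) by (intro divide_left_mono) auto
      finally have "x1 \<le> real d / (real L / 3)" unfolding x1_def .
      then have "1 / 1200 * x1 \<le> 1 / 1200 * (real d / (real L / 3))" by (rule mult_left_mono) simp
      also have "\<dots> = real d / (400 * real L)" by simp
      finally show ?thesis .
    qed
    then have low: "1 / 1200 * x1 \<le> real m"
      if "\<And>y f. y ` {..40 * V} \<subseteq> cube n \<Longrightarrow> f \<in> two_valued (cube n) \<Longrightarrow>
        \<exists>R. index_tester n k \<epsilon> m (40 * V) y f R" for m
      using index_tester_lower_bound[of r k n \<epsilon> m] that b(1,2,8) eps unfolding V_def d_def L_def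
      by fastforce
    \<comment> \<open>The number \<open>4 * exp 1\<close> arises because
      \<open>(n / (4 e k)) ^ k\<close> times the upper bound \<open>(e n / k) ^ k\<close> for
      \<open>V\<close> is the square of the lower bound \<open>(n / (2 k)) ^ k\<close> for
      \<open>d\<close>. Replacing \<open>lV\<close> by \<open>k * ly\<close> costs the factor 2,
      hence 1/2400.\<close>
    have x2: "x2 \<le> 2 * x1"
    proof -
      have nk: "0 < real n / real k" using n k by simp
      have "(real n / (4 * exp 1 * real k)) ^ k * real V \<le>
          (real n / (4 * exp 1 * real k)) ^ k * (exp 1 * (real n / real k)) ^ k"
        using b(4) by (intro mult_left_mono) auto
      also have "\<dots> = (real n / (2 * real k)) ^ k * (real n / (2 * real k)) ^ k"
        unfolding power_mult_distrib[symmetric] by (simp add: field_simps)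
      also have "\<dots> \<le> real d * real d" using b(3) by (intro mult_mono) auto
      finally have "(real n / (4 * exp 1 * real k)) ^ k \<le> (real d)\<^sup>2 / real V"
        using V0 by (simp add: le_divide_eq power2_eq_square)
      then have "x2 \<le> (real d)\<^sup>2 / real V / (real k * ly)"
        unfolding x2_def using kly by (intro divide_right_mono) auto
      also have "\<dots> \<le> (real d)\<^sup>2 / real V / (lV / 2)"
        using b(5,6) V0 kly by (intro divide_left_mono) auto
      finally show ?thesis by (simp add: x1_def mult.commute)
    qed
    fix M assume "M \<in> {m_test (cube n) (PTF n k) \<epsilon>, q_test (cube n) (PTF n k) \<epsilon>}"
    then have M: "ereal (1 / 1200 * x1) \<le> ereal_of_enat M"
    proof (elim insertE emptyE)
      assume "M = m_test (cube n) (PTF n k) \<epsilon>"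
      then show ?thesis
        unfolding m_test_def
        by (auto intro!: ereal_of_enat_Inf_ge low sample_tester_index_tester simp del: times_divide_eq_left)
    next
      assume "M = q_test (cube n) (PTF n k) \<epsilon>"
      then show ?thesis
        unfolding q_test_def
        by (auto intro!: ereal_of_enat_Inf_ge low query_tester_index_tester simp del: times_divide_eq_left)
    qed
    have "ereal (1 / 2400 * x1) \<le> ereal (1 / 1200 * x1)" using x1 by simp
    then have "ereal (1 / 2400 * x1) \<le> ereal_of_enat M" using M by (rule order.trans)
    then show "ereal (1 / 2400 * ((real (binom_le (nat \<lfloor>real n - log 2 (real (n choose k)) - 6\<rfloor>) k))\<^sup>2 /
        (real (binom_le n k) * log 2 (real (binom_le n k))))) \<le> ereal_of_enat M"
      unfolding x1_def d_def r_def V_def lV_def .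
    have "ereal (1 / 2400 * x2) \<le> ereal (1 / 1200 * x1)" using x2 by simp
    then have "ereal (1 / 2400 * x2) \<le> ereal_of_enat M" using M by (rule order.trans)
    then show "ereal (1 / 2400 * ((real n / (4 * exp 1 * real k)) ^ k /
        (real k * log 2 (real n / real k)))) \<le> ereal_of_enat M"
      unfolding x2_def ly_def .
  qed (use C in auto)
qed

end
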